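(* There are universal constants $C<\infty$ and $c>0$ such that the following holds. Let $d\ge1$, let $V:\mathbb R^d\to\mathbb R^d$ belong to $W^{1,p_0}(\gamma_d;\mathbb R^d)$ for some $p_0\ge2$, and suppose that $$L:=\|DV\|_{L^\infty(\gamma_d;\mathrm{HS}_d)}<\infty.$$ Then, for every $p\ge2$, $$\|\delta V\|_{L^p(\gamma_d)}\le C\sqrt p\,|\mathbb E V|+CpL.$$ If $\mathbb E V=0$, then $$\gamma_d\bigl\{|\delta V|\ge t\bigr\}\le2\exp\Bigl\{-\frac{ct}{L}\Bigr\},\qquad t\ge0.$$ The assertions have their usual interpretation when $L=0$ (when $L=0$ and $\mathbb E V=0$, the tail statement means $\delta V=0$ almost everywhere).
   Context: $\gamma_d$ is the standard Gaussian measure on $\mathbb R^d$, $\mathbb E$ is integration against it, and $|\cdot|$ is the Euclidean norm on vectors. $W^{1,p}(\gamma_d;\mathbb R^d)$ is the space of $V=(V_1,\dots,V_d)\in L^p(\gamma_d;\mathbb R^d)$ whose distributional first derivatives are functions with $DV:=(\partial_jV_i)_{i,j}\in L^p(\gamma_d;\mathrm{HS}_d)$, where $\mathrm{HS}_d$ is $\mathbb R^{d\times d}$ with the Hilbert--Schmidt norm $|A|_{\mathrm{HS}}^2=\sum_{i,j}A_{ij}^2$. $\|DV\|_{L^\infty(\gamma_d;\mathrm{HS}_d)}$ is the essential supremum of $|DV|_{\mathrm{HS}}$. The Gaussian divergence $\delta V$ is defined distributionally by $\langle\delta V,F\rangle:=\mathbb E[V\cdot DF]$ for $F\in C_c^\infty(\mathbb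 R^d)$, and is identified with the function $\delta V(x)=x\cdot V(x)-\operatorname{tr}(DV(x))$. "Universal" means independent of $d$, $p$, $p_0$, $V$. *)

theory Defs
  imports "HOL-Probability.Probability"
begin

text \<open>
  The constants in the theorem must not depend on the dimension, so the dimension has to be a
  natural number bound inside the statement. A point of $d$-dimensional space is therefore an
  extensional function on \<open>{..<d}\<close>; this is the underlying space of \<open>Pi\<^sub>M {..<d}\<close>,
  and its subspace topology in \<open>nat \<Rightarrow> real\<close> is the Euclidean topology.
  Vector and matrix values are functions of which only the entries with indices below \<open>d\<close> matter.
\<close>

definition Rd :: "nat \<Rightarrow> (nat \<Rightarrow> real) set" where
  "Rd d = (\<Pi>\<^sub>E i\<in>{..<d}. UNIV)"

definition lebesgue_Rd :: "nat \<Rightarrow> (nat \<Rightarrow> real) measure" where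
  "lebesgue_Rd d = Pi\<^sub>M {..<d} (\<lambda>_. lborel)"

definition gaussian :: "nat \<Rightarrow> (nat \<Rightarrow> real) measure" where
  "gaussian d = Pi\<^sub>M {..<d} (\<lambda>_. density lborel (\<lambda>x. ennreal (std_normal_density x)))"

definition euclidean_norm :: "nat \<Rightarrow> (nat \<Rightarrow> real) \<Rightarrow> real" where
  "euclidean_norm d v = L2_set v {..<d}"

definition HS_norm :: "nat \<Rightarrow> (nat \<Rightarrow> nat \<Rightarrow> real) \<Rightarrow> real" where
  "HS_norm d A = L2_set (\<lambda>(i, j). A i j) ({..<d} \<times> {..<d})"

definition in_Lp :: "'a measure \<Rightarrow> real \<Rightarrow> ('a \<Rightarrow> real) \<Rightarrow> bool" where
  "in_Lp M p f \<longleftrightarrow> f \<in> borel_measurable M \<and> integrable M (\<lambda>x. \<bar>f x\<bar> powr p)"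

text \<open>Only meaningful together with \<^const>\<open>in_Lp\<close>.\<close>

definition Lp_norm :: "'a measure \<Rightarrow> real \<Rightarrow> ('a \<Rightarrow> real) \<Rightarrow> real" where
  "Lp_norm M p f = (integral\<^sup>L M (\<lambda>x. \<bar>f x\<bar> powr p)) powr (1 / p)"

definition Linfinity_norm :: "'a measure \<Rightarrow> ('a \<Rightarrow> real) \<Rightarrow> ereal" where
  "Linfinity_norm M f = esssup M (\<lambda>x. ereal \<bar>f x\<bar>)"

definition partial_deriv :: "nat \<Rightarrow> ((nat \<Rightarrow> real) \<Rightarrow> real) \<Rightarrow> (nat \<Rightarrow> real) \<Rightarrow> real" where
  "partial_deriv i F x = deriv (\<lambda>t. F (x(i := t))) (x i)"

text \<open>
  Smooth means that all iterated partial derivatives exist and are continuous; the list \<open>is\<close>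
  records the directions of differentiation.
\<close>

definition smooth :: "nat \<Rightarrow> ((nat \<Rightarrow> real) \<Rightarrow> real) \<Rightarrow> bool" where
  "smooth d F \<longleftrightarrow>
     (\<forall>is. set is \<subseteq> {..<d} \<longrightarrow>
        continuous_on (Rd d) (foldr partial_deriv is F) \<and>
        (\<forall>i<d. \<forall>x\<in>Rd d.
           (\<lambda>t. foldr partial_deriv is F (x(i := t))) field_differentiable at (x i)))"

definition test_function :: "nat \<Rightarrow> ((nat \<Rightarrow> real) \<Rightarrow> real) \<Rightarrow> bool" where
  "test_function d F \<longleftrightarrow> smooth d F \<and> compact (closure {x \<in> Rd d. F x \<noteq> 0})"

text \<open>\<open>g\<close> is the distributional derivative of \<open>u\<close> in direction \<open>j\<close>; for locally integrable
  \<open>u\<close> and \<open>g\<close>.\<close>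

definition distributional_deriv ::
  "nat \<Rightarrow> nat \<Rightarrow> ((nat \<Rightarrow> real) \<Rightarrow> real) \<Rightarrow> ((nat \<Rightarrow> real) \<Rightarrow> real) \<Rightarrow> bool" where
  "distributional_deriv d j u g \<longleftrightarrow>
     (\<forall>F. test_function d F \<longrightarrow>
        integral\<^sup>L (lebesgue_Rd d) (\<lambda>x. u x * partial_deriv j F x) =
        - integral\<^sup>L (lebesgue_Rd d) (\<lambda>x. g x * F x))"

text \<open>
  \<open>V\<close> belongs to the Gaussian Sobolev space with exponent \<open>p\<close>, and \<open>DV x i j\<close> is a version of the
  derivative of the component \<open>V x i\<close> in direction \<open>j\<close> (which is unique almost everywhere).
\<close>

definition gaussian_sobolev ::
  "nat \<Rightarrow> real \<Rightarrow> ((nat \<Rightarrow> real) \<Rightarrow> nat \<Rightarrow> real) \<Rightarrow> ((nat \<Rightarrow> real) \<Rightarrow> nat \<Rightarrow> nat \<Rightarrow> real) \<Rightarrow> bool"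
where
  "gaussian_sobolev d p V DV \<longleftrightarrow>
     (\<forall>i<d. (\<lambda>x. V x i) \<in> borel_measurable (gaussian d)) \<and>
     (\<forall>i<d. \<forall>j<d. (\<lambda>x. DV x i j) \<in> borel_measurable (gaussian d)) \<and>
     in_Lp (gaussian d) p (\<lambda>x. euclidean_norm d (V x)) \<and>
     in_Lp (gaussian d) p (\<lambda>x. HS_norm d (DV x)) \<and>
     (\<forall>i<d. \<forall>j<d. distributional_deriv d j (\<lambda>x. V x i) (\<lambda>x. DV x i j))"

text \<open>The function \<open>G\<close> represents the distribution $F \mapsto E[V \cdot DF]$.\<close>

definition gaussian_divergence ::
  "nat \<Rightarrow> ((nat \<Rightarrow> real) \<Rightarrow> nat \<Rightarrow> real) \<Rightarrow> ((nat \<Rightarrow> real) \<Rightarrow> real) \<Rightarrow> bool" where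
  "gaussian_divergence d V G \<longleftrightarrow>
     (\<forall>F. test_function d F \<longrightarrow>
        integrable (gaussian d) (\<lambda>x. G x * F x) \<and>
        integral\<^sup>L (gaussian d) (\<lambda>x. G x * F x) =
        integral\<^sup>L (gaussian d) (\<lambda>x. \<Sum>i<d. V x i * partial_deriv i F x))"

definition divergence_fun ::
  "nat \<Rightarrow> ((nat \<Rightarrow> real) \<Rightarrow> nat \<Rightarrow> real) \<Rightarrow> ((nat \<Rightarrow> real) \<Rightarrow> nat \<Rightarrow> nat \<Rightarrow> real) \<Rightarrow>
   (nat \<Rightarrow> real) \<Rightarrow> real" where
  "divergence_fun d V DV x = (\<Sum>i<d. x i * V x i) - (\<Sum>i<d. DV x i i)"

definition gaussian_mean :: "nat \<Rightarrow> ((nat \<Rightarrow> real) \<Rightarrow> nat \<Rightarrow> real) \<Rightarrow> nat \<Rightarrow> real" where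
  "gaussian_mean d V i = integral\<^sup>L (gaussian d) (\<lambda>x. V x i)"

end

theory Submission
  imports Defs "HOL-Real_Asymp.Real_Asymp"
begin

text \<open>
  Let \<open>V\<close> be smooth with \<open>E V = 0\<close>, put \<open>A = DV\<close>, and for \<open>\<bar>s\<bar> L < 1/2\<close> change variables by
  \<open>T(x) = x - s V(x)\<close>. With $J_s = \det(I - sA)$, the mass of $J_s \exp(-|T|^2/2)$ does not depend on
  \<open>s\<close>, because its \<open>s\<close>-derivative is minus the divergence of the density times $(I - sA)^{-1} V$.
  Since $\log J_s \ge -s\,\mathrm{tr} A - (sL)^2$, this says
  $E \exp(s\,\delta V - s^2|V|^2/2) \le \exp((sL)^2)$, in every dimension. The loss $s^2|V|^2/2$ is
  absorbed by the dimension-free bound $E \exp(s^2|V|^2/2) \le \sqrt 2$, obtained by integrating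
  \<open>DV\<close> along the rotation of a Gaussian pair, so $|\delta V|/(5L)$ has exponential moment at most 3.
  Sobolev fields are mollified, and Fatou's lemma passes to the limit. The mean \<open>E V\<close> only
  contributes the Gaussian variable \<open>x \<bullet> E V\<close> to the divergence.
\<close>

subsection \<open>Matrices indexed by natural numbers\<close>

text \<open>The logarithm of the determinant is taken as the trace series -sum s^k tr(A^k)/k. This
  isolates the source of dimension-freeness: from the second power on, traces are at most L^k, and
  the one trace not controlled by the Hilbert-Schmidt norm, that of A itself, is exactly the term
  that completes s x.V to s times the divergence. Only total masses are compared, by a derivative in
  s, so it never matters whether T is a bijection; the price is that every integrand must be
  dominated uniformly in s. The restriction \<open>\<bar>s\<bar> * L \<le> 1/2\<close> provides
  this, since it keeps |T(x)| comparable to |x|. The value s = 2/(5L) satisfies both |s| L < 1/2 and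
  (s^2/2)(pi/2)^2 L^2 <= 1/4, the threshold for the quadratic exponential moment; Cauchy-Schwarz
  then halves s to 1/(5L), and 3 bounds 3/2 + sqrt 2. A mollified field does not have the mean of V,
  so its own mean is subtracted and shown to converge. The case L = 0 follows by using the estimate
  for every l > 0.\<close>

definition mmul :: "nat \<Rightarrow> (nat \<Rightarrow> nat \<Rightarrow> real) \<Rightarrow> (nat \<Rightarrow> nat \<Rightarrow> real) \<Rightarrow> nat \<Rightarrow> nat \<Rightarrow> real" where
  "mmul d A B = (\<lambda>i j. \<Sum>k<d. A i k * B k j)"

definition mtrace :: "nat \<Rightarrow> (nat \<Rightarrow> nat \<Rightarrow> real) \<Rightarrow> real" where
  "mtrace d A = (\<Sum>i<d. A i i)"

text \<open>The zeroth power is the identity on all of \<open>nat\<close>, whereas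
  \<open>mmul d\<close> sums only below \<open>d\<close>. Hence it is neutral only at indices below
  \<open>d\<close>, which is why the algebraic identities carry index bounds.\<close>

fun mpow :: "nat \<Rightarrow> (nat \<Rightarrow> nat \<Rightarrow> real) \<Rightarrow> nat \<Rightarrow> nat \<Rightarrow> nat \<Rightarrow> real" where
  "mpow d A 0 = (\<lambda>i j. of_bool (i = j))"
| "mpow d A (Suc k) = mmul d A (mpow d A k)"

lemma mmul_assoc: "mmul d (mmul d A B) C = mmul d A (mmul d B C)"
proof (intro ext)
  fix i j
  have "(\<Sum>k<d. (\<Sum>l<d. A i l * B l k) * C k j) = (\<Sum>k<d. \<Sum>l<d. A i l * (B l k * C k j))"
    by (simp add: sum_distrib_right mult.assoc)
  also have "\<dots> = (\<Sum>l<d. \<Sum>k<d. A i l * (B l k * C k j))"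
    by (rule sum.swap)
  finally show "mmul d (mmul d A B) C i j = mmul d A (mmul d B C) i j"
    by (simp add: mmul_def sum_distrib_left)
qed

lemma mmul_cong:
  "(\<And>k. k < d \<Longrightarrow> A i k = A' i k) \<Longrightarrow> (\<And>k. k < d \<Longrightarrow> B k j = B' k j) \<Longrightarrow>
   mmul d A B i j = mmul d A' B' i j"
  by (simp add: mmul_def)

lemma sum_mult_of_bool:
  fixes f :: "nat \<Rightarrow> real"
  assumes "j < d"
  shows "(\<Sum>k<d. f k * of_bool (k = j)) = f j" "(\<Sum>k<d. of_bool (j = k) * f k) = f j"
  using assms by (simp_all add: of_bool_def if_distrib[where f="\<lambda>x. _ * x"] if_distrib[where f="\<lambda>x. x * _"] sum.delta cong: if_cong)

lemma mmul_mpow_0: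
  "j < d \<Longrightarrow> mmul d A (mpow d B 0) i j = A i j"
  "i < d \<Longrightarrow> mmul d (mpow d B 0) A i j = A i j"
  by (simp_all only: mmul_def mpow.simps sum_mult_of_bool)

lemma mpow_Suc_right:
  assumes "i < d" "j < d"
  shows "mpow d A (Suc k) i j = mmul d (mpow d A k) A i j"
  using assms
proof (induction k arbitrary: i j)
  case 0
  then show ?case using mmul_mpow_0[of j d A A i] mmul_mpow_0(2)[of i d A A j] by simp
next
  case (Suc k)
  have "mpow d A (Suc (Suc k)) i j = mmul d A (mpow d A (Suc k)) i j" by simp
  also have "\<dots> = mmul d A (mmul d (mpow d A k) A) i j"
    by (rule mmul_cong) (use Suc in auto)
  also have "\<dots> = mmul d (mpow d A (Suc k)) A i j" by (simp add: mmul_assoc)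
  finally show ?case .
qed

lemma mtrace_commute: "mtrace d (mmul d A B) = mtrace d (mmul d B A)"
proof -
  have "mtrace d (mmul d A B) = (\<Sum>i<d. \<Sum>k<d. A i k * B k i)" by (simp add: mtrace_def mmul_def)
  also have "\<dots> = (\<Sum>k<d. \<Sum>i<d. A i k * B k i)" by (rule sum.swap)
  finally show ?thesis by (simp add: mtrace_def mmul_def mult.commute)
qed

lemma HS_norm_nonneg [simp]: "0 \<le> HS_norm d A"
  by (simp add: HS_norm_def)

lemma HS_norm_sqr: "(HS_norm d A)\<^sup>2 = (\<Sum>i<d. \<Sum>j<d. (A i j)\<^sup>2)"
  by (simp add: HS_norm_def L2_set_def sum_nonneg sum.cartesian_product case_prod_unfold)

lemma HS_norm_cong: "(\<And>i j. i < d \<Longrightarrow> j < d \<Longrightarrow> A i j = B i j) \<Longrightarrow> HS_norm d A = HS_norm d B"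
  unfolding HS_norm_def by (rule L2_set_cong) auto

lemma HS_norm_triangle: "HS_norm d (\<lambda>i j. A i j + B i j) \<le> HS_norm d A + HS_norm d B"
  using L2_set_triangle_ineq[of "case_prod A" "case_prod B" "{..<d}\<times>{..<d}"]
  by (simp add: HS_norm_def case_prod_unfold)

lemma abs_le_HS_norm:
  assumes "i < d" "j < d" shows "\<bar>A i j\<bar> \<le> HS_norm d A"
proof -
  have "L2_set (\<lambda>z. \<bar>(\<lambda>(i,j). A i j) z\<bar>) ({..<d}\<times>{..<d}) \<ge> \<bar>(\<lambda>(i,j). A i j) (i,j)\<bar>"
    by (rule member_le_L2_set[of _ "(i,j)" "\<lambda>z. \<bar>(\<lambda>(i,j). A i j) z\<bar>"]) (use assms in auto)
  then show ?thesis by (simp add: HS_norm_def L2_set_def case_prod_unfold)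
qed

lemma cauchy_schwarz_sum:
  fixes f g :: "'a \<Rightarrow> real"
  shows "(\<Sum>i\<in>S. f i * g i)\<^sup>2 \<le> (\<Sum>i\<in>S. (f i)\<^sup>2) * (\<Sum>i\<in>S. (g i)\<^sup>2)"
proof -
  have "\<bar>\<Sum>i\<in>S. f i * g i\<bar> \<le> L2_set f S * L2_set g S"
    using sum_abs[of "\<lambda>i. f i * g i" S] L2_set_mult_ineq[of f g S] by (simp add: abs_mult)
  then have "\<bar>\<Sum>i\<in>S. f i * g i\<bar>\<^sup>2 \<le> (L2_set f S * L2_set g S)\<^sup>2"
    by (rule power_mono) simp
  then show ?thesis by (simp add: power_mult_distrib L2_set_def sum_nonneg)
qed

text \<open>Cauchy-Schwarz for each row of \<open>A\<close> against each column of \<open>B\<close>;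
  the sum over all pairs factorises.\<close>

lemma HS_norm_mmul: "HS_norm d (mmul d A B) \<le> HS_norm d A * HS_norm d B"
proof -
  have "(HS_norm d (mmul d A B))\<^sup>2 = (\<Sum>i<d. \<Sum>j<d. (\<Sum>k<d. A i k * B k j)\<^sup>2)"
    by (simp add: HS_norm_sqr mmul_def)
  also have "\<dots> \<le> (\<Sum>i<d. \<Sum>j<d. (\<Sum>k<d. (A i k)\<^sup>2) * (\<Sum>k<d. (B k j)\<^sup>2))"
    by (intro sum_mono cauchy_schwarz_sum)
  also have "\<dots> = (\<Sum>i<d. \<Sum>k<d. (A i k)\<^sup>2) * (\<Sum>j<d. \<Sum>k<d. (B k j)\<^sup>2)"
    by (simp add: sum_product)
  also have "(\<Sum>j<d. \<Sum>k<d. (B k j)\<^sup>2) = (\<Sum>k<d. \<Sum>j<d. (B k j)\<^sup>2)"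
    by (rule sum.swap)
  finally have "(HS_norm d (mmul d A B))\<^sup>2 \<le> (HS_norm d A * HS_norm d B)\<^sup>2"
    by (simp add: HS_norm_sqr power_mult_distrib)
  then show ?thesis by (rule power2_le_imp_le) simp
qed

text \<open>The trace of a product is the Hilbert-Schmidt inner product of \<open>A\<close> with the
  transpose of \<open>B\<close>. No factor \<open>d\<close> appears, which is the root of all
  dimension-free bounds below.\<close>

lemma abs_mtrace_mmul: "\<bar>mtrace d (mmul d A B)\<bar> \<le> HS_norm d A * HS_norm d B"
proof -
  have "(mtrace d (mmul d A B))\<^sup>2 = (\<Sum>z\<in>{..<d}\<times>{..<d}. A (fst z) (snd z) * B (snd z) (fst z))\<^sup>2"
    by (simp add: mtrace_def mmul_def sum.cartesian_product case_prod_unfold)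
  also have "\<dots> \<le> (\<Sum>z\<in>{..<d}\<times>{..<d}. (A (fst z) (snd z))\<^sup>2) * (\<Sum>z\<in>{..<d}\<times>{..<d}. (B (snd z) (fst z))\<^sup>2)"
    by (rule cauchy_schwarz_sum)
  also have "(\<Sum>z\<in>{..<d}\<times>{..<d}. (B (snd z) (fst z))\<^sup>2) = (\<Sum>i<d. \<Sum>j<d. (B j i)\<^sup>2)"
    by (simp add: sum.cartesian_product case_prod_unfold)
  also have "\<dots> = (\<Sum>j<d. \<Sum>i<d. (B j i)\<^sup>2)" by (rule sum.swap)
  finally have "\<bar>mtrace d (mmul d A B)\<bar>\<^sup>2 \<le> (HS_norm d A * HS_norm d B)\<^sup>2"
    by (simp add: HS_norm_sqr power_mult_distrib sum.cartesian_product case_prod_unfold)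
  then show ?thesis by (rule power2_le_imp_le) simp
qed

text \<open>The factor \<open>X\<close> in front lets the induction start at the zeroth power
  without paying sqrt d, the Hilbert-Schmidt norm of the identity.\<close>

lemma HS_norm_mmul_mpow:
  assumes "HS_norm d A \<le> L"
  shows "HS_norm d (mmul d X (mpow d A k)) \<le> HS_norm d X * L ^ k"
proof (induction k arbitrary: X)
  case 0
  have "HS_norm d (mmul d X (mpow d A 0)) = HS_norm d X"
    by (rule HS_norm_cong) (rule mmul_mpow_0)
  then show ?case by simp
next
  case (Suc k)
  have "mmul d X (mpow d A (Suc k)) = mmul d (mmul d X A) (mpow d A k)" by (simp add: mmul_assoc)
  then have "HS_norm d (mmul d X (mpow d A (Suc k))) \<le> HS_norm d (mmul d X A) * L ^ k"
    using Suc by simp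
  also have "\<dots> \<le> (HS_norm d X * L) * L ^ k"
    using assms order.trans[OF HS_norm_nonneg assms]
    by (intro mult_right_mono order.trans[OF HS_norm_mmul] mult_left_mono zero_le_power) auto
  finally show ?case by (simp add: mult.assoc)
qed

lemma HS_norm_mpow_Suc:
  assumes "HS_norm d A \<le> L" shows "HS_norm d (mpow d A (Suc k)) \<le> L ^ Suc k"
proof -
  have "HS_norm d (mmul d A (mpow d A k)) \<le> HS_norm d A * L ^ k"
    by (rule HS_norm_mmul_mpow[OF assms])
  also have "\<dots> \<le> L * L ^ k"
    using assms order.trans[OF HS_norm_nonneg assms] by (intro mult_right_mono) auto
  finally show ?thesis by simp
qed

text \<open>Entrywise the bound also covers the identity, which its Hilbert-Schmidt norm would not
  give.\<close>

lemma abs_mpow: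
  assumes "HS_norm d A \<le> L" "i < d" "j < d" shows "\<bar>mpow d A k i j\<bar> \<le> L ^ k"
proof (cases k)
  case 0
  then show ?thesis by simp
next
  case (Suc m)
  then show ?thesis
    using HS_norm_mpow_Suc[OF assms(1), of m] abs_le_HS_norm[OF assms(2,3), of "mpow d A k"]
    by simp
qed

text \<open>Two factors are needed to apply Cauchy-Schwarz to the trace; for the first power such a
  bound would have to involve \<open>d\<close>.\<close>

lemma abs_mtrace_mpow:
  assumes "HS_norm d A \<le> L" shows "\<bar>mtrace d (mpow d A (Suc (Suc k)))\<bar> \<le> L ^ Suc (Suc k)"
proof -
  have "\<bar>mtrace d (mpow d A (Suc (Suc k)))\<bar> \<le> HS_norm d A * HS_norm d (mpow d A (Suc k))"
    using abs_mtrace_mmul[of d A "mpow d A (Suc k)"] by simp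
  also have "\<dots> \<le> L * L ^ Suc k"
    using assms order.trans[OF HS_norm_nonneg assms] by (intro mult_mono HS_norm_mpow_Suc) auto
  finally show ?thesis by simp
qed

text \<open>For \<open>\<bar>s\<bar> HS_norm d A < 1\<close>, \<open>resolvent\<close> is the inverse of $I - sA$ and
  \<open>logdet\<close> is $\log\det(I - sA)$.\<close>

definition resolvent :: "nat \<Rightarrow> real \<Rightarrow> (nat \<Rightarrow> nat \<Rightarrow> real) \<Rightarrow> nat \<Rightarrow> nat \<Rightarrow> real" where
  "resolvent d s A i j = (\<Sum>k. s ^ k * mpow d A k i j)"

definition logdet :: "nat \<Rightarrow> real \<Rightarrow> (nat \<Rightarrow> nat \<Rightarrow> real) \<Rightarrow> real" where
  "logdet d s A = - (\<Sum>k. s ^ Suc k * mtrace d (mpow d A (Suc k)) / real (Suc k))"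

context
  fixes d :: nat and s L :: real
  assumes sL: "\<bar>s\<bar> * L < 1" and L0: "0 \<le> L"
begin

lemma summable_geo: "summable (\<lambda>k. (\<bar>s\<bar> * L) ^ k)"
  using sL L0 by (intro summable_geometric) auto

lemma abs_term_resolvent:
  assumes "HS_norm d A \<le> L" "i < d" "j < d"
  shows "\<bar>s ^ k * mpow d A k i j\<bar> \<le> (\<bar>s\<bar> * L) ^ k"
  using abs_mpow[OF assms, of k]
  by (auto simp: abs_mult power_abs power_mult_distrib intro!: mult_left_mono)

lemma summable_resolvent:
  assumes "HS_norm d A \<le> L" "i < d" "j < d"
  shows "summable (\<lambda>k. s ^ k * mpow d A k i j)"
  by (rule summable_comparison_test'[OF summable_geo, of 0]) (use abs_term_resolvent[OF assms] in auto)

lemma abs_resolvent: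
  assumes "HS_norm d A \<le> L" "i < d" "j < d"
  shows "\<bar>resolvent d s A i j\<bar> \<le> 1 / (1 - \<bar>s\<bar> * L)"
proof -
  have "norm (\<Sum>k. s ^ k * mpow d A k i j) \<le> (\<Sum>k. (\<bar>s\<bar> * L) ^ k)"
    using abs_term_resolvent[OF assms] by (intro norm_suminf_le summable_geo) auto
  also have "\<dots> = 1 / (1 - \<bar>s\<bar> * L)"
    using sL L0 by (intro suminf_geometric) auto
  finally show ?thesis by (simp add: resolvent_def)
qed

text \<open>Split off the first term of the Neumann series and pull one factor \<open>A\<close> out
  on the left. The companion with \<open>A\<close> on the right is needed to solve for the
  derivative of the resolvent.\<close>

lemma resolvent_left:
  assumes "HS_norm d A \<le> L" "i < d" "j < d"
  shows "resolvent d s A i j = of_bool (i = j) + s * (\<Sum>k<d. A i k * resolvent d s A k j)"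
proof -
  have "resolvent d s A i j = (\<Sum>k. s ^ Suc k * mpow d A (Suc k) i j) + of_bool (i = j)"
    using suminf_split_head[OF summable_resolvent[OF assms]] by (simp add: resolvent_def)
  also have "(\<Sum>k. s ^ Suc k * mpow d A (Suc k) i j) = (\<Sum>k. \<Sum>m<d. s * A i m * (s ^ k * mpow d A k m j))"
    by (simp add: mmul_def sum_distrib_left mult_ac)
  also have "\<dots> = (\<Sum>m<d. \<Sum>k. s * A i m * (s ^ k * mpow d A k m j))"
    by (rule suminf_sum) (use summable_resolvent[OF assms(1) _ assms(3)] in \<open>auto intro!: summable_mult\<close>)
  also have "\<dots> = (\<Sum>m<d. s * A i m * resolvent d s A m j)"
    by (intro sum.cong refl) (simp add: resolvent_def suminf_mult summable_resolvent[OF assms(1) _ assms(3)])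
  finally show ?thesis by (simp add: sum_distrib_left mult.assoc)
qed

lemma resolvent_right:
  assumes "HS_norm d A \<le> L" "i < d" "j < d"
  shows "resolvent d s A i j = of_bool (i = j) + s * (\<Sum>k<d. resolvent d s A i k * A k j)"
proof -
  have "resolvent d s A i j = (\<Sum>k. s ^ Suc k * mpow d A (Suc k) i j) + of_bool (i = j)"
    using suminf_split_head[OF summable_resolvent[OF assms]] by (simp add: resolvent_def)
  also have "(\<Sum>k. s ^ Suc k * mpow d A (Suc k) i j) = (\<Sum>k. \<Sum>m<d. s * A m j * (s ^ k * mpow d A k i m))"
    by (subst mpow_Suc_right[OF assms(2,3)]) (simp add: mmul_def sum_distrib_left mult_ac)
  also have "\<dots> = (\<Sum>m<d. \<Sum>k. s * A m j * (s ^ k * mpow d A k i m))"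
    by (rule suminf_sum) (use summable_resolvent[OF assms(1,2)] in \<open>auto intro!: summable_mult\<close>)
  also have "\<dots> = (\<Sum>m<d. s * A m j * resolvent d s A i m)"
    by (intro sum.cong refl) (simp add: resolvent_def suminf_mult summable_resolvent[OF assms(1,2)])
  finally show ?thesis by (simp add: sum_distrib_left mult_ac)
qed


end

section \<open>Derivatives of powers, resolvent and log-determinant along a matrix-valued
  curve\<close>

lemma mpow_add:
  assumes "i < d" "j < d"
  shows "mmul d (mpow d A a) (mpow d A b) i j = mpow d A (a + b) i j"
  using assms
proof (induction a arbitrary: i)
  case 0
  then show ?case using mmul_mpow_0(2)[of i d A "mpow d A b" j] by simp
next
  case (Suc a)
  have "mmul d (mpow d A (Suc a)) (mpow d A b) i j = mmul d A (mmul d (mpow d A a) (mpow d A b)) i j"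
    by (simp add: mmul_assoc)
  also have "\<dots> = mmul d A (mpow d A (a + b)) i j"
    by (rule mmul_cong) (use Suc in auto)
  finally show ?case by simp
qed

text \<open>The derivative of the power map at \<open>A\<close> in the direction \<open>X\<close>,
  generated by the product rule for A A^k, so that no sum over the position of \<open>X\<close> has
  to be written.\<close>

fun dmpow :: "nat \<Rightarrow> (nat \<Rightarrow> nat \<Rightarrow> real) \<Rightarrow> (nat \<Rightarrow> nat \<Rightarrow> real) \<Rightarrow> nat \<Rightarrow> nat \<Rightarrow> nat \<Rightarrow> real" where
  "dmpow d A X 0 = (\<lambda>i j. 0)"
| "dmpow d A X (Suc k) = (\<lambda>i j. mmul d X (mpow d A k) i j + mmul d A (dmpow d A X k) i j)"

lemma DERIV_mpow:
  assumes "\<And>i j. i < d \<Longrightarrow> j < d \<Longrightarrow> ((\<lambda>t. A t i j) has_real_derivative X i j) (at u)" "i < d" "j < d"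
  shows "((\<lambda>t. mpow d (A t) k i j) has_real_derivative dmpow d (A u) X k i j) (at u)"
  using assms(2,3)
proof (induction k arbitrary: i)
  case 0
  then show ?case by simp
next
  case (Suc k)
  show ?case unfolding mpow.simps dmpow.simps mmul_def
    by (rule derivative_eq_intros | rule assms Suc Suc.IH | simp add: sum.distrib[symmetric])+
      (use Suc in \<open>auto simp: algebra_simps sum.distrib[symmetric]\<close>)
qed

lemma HS_norm_dmpow:
  assumes A: "HS_norm d A \<le> L" and X: "HS_norm d X \<le> M"
  shows "HS_norm d (dmpow d A X (Suc k)) \<le> real (Suc k) * (M * L ^ k)"
proof (induction k)
  case 0
  have "HS_norm d (dmpow d A X (Suc 0)) = HS_norm d X"
    by (rule HS_norm_cong) (simp add: mmul_mpow_0(1)[simplified] mmul_def)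
  then show ?case using X by simp
next
  case (Suc k)
  have L0: "0 \<le> L" using order.trans[OF HS_norm_nonneg A] .
  have "HS_norm d (dmpow d A X (Suc (Suc k))) \<le>
      HS_norm d (mmul d X (mpow d A (Suc k))) + HS_norm d (mmul d A (dmpow d A X (Suc k)))"
    unfolding dmpow.simps(2)[of d A X "Suc k"] by (rule HS_norm_triangle)
  also have "\<dots> \<le> M * L ^ Suc k + L * (real (Suc k) * (M * L ^ k))"
    by (intro add_mono order.trans[OF HS_norm_mmul_mpow[OF A]] order.trans[OF HS_norm_mmul] mult_mono X A Suc)
      (use L0 order.trans[OF HS_norm_nonneg X] in auto)
  finally show ?case by (simp add: algebra_simps)
qed

lemma mtrace_cong: "(\<And>i. i < d \<Longrightarrow> A i i = B i i) \<Longrightarrow> mtrace d A = mtrace d B"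
  by (simp add: mtrace_def)

text \<open>The derivative of A^(k+1) has k+1 terms, each with one factor replaced by
  \<open>X\<close>; by cyclicity they all have the same trace. The prefix A^m is the generalisation
  that makes the induction go through.\<close>

lemma mtrace_mpow_dmpow:
  "mtrace d (mmul d (mpow d A m) (dmpow d A X (Suc k))) = real (Suc k) * mtrace d (mmul d X (mpow d A (m + k)))"
proof (induction k arbitrary: m)
  have split: "mtrace d (mmul d (mpow d A m) (dmpow d A X (Suc k))) =
      mtrace d (mmul d X (mpow d A (m + k))) + mtrace d (mmul d (mpow d A (Suc m)) (dmpow d A X k))" for m k
  proof -
    have "mtrace d (mmul d (mpow d A m) (dmpow d A X (Suc k))) =
      mtrace d (mmul d (mpow d A m) (mmul d X (mpow d A k))) + mtrace d (mmul d (mpow d A m) (mmul d A (dmpow d A X k)))"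
      by (simp add: mtrace_def mmul_def sum.distrib algebra_simps)
    also have "mtrace d (mmul d (mpow d A m) (mmul d X (mpow d A k))) =
        mtrace d (mmul d X (mmul d (mpow d A k) (mpow d A m)))"
      by (subst mtrace_commute) (simp add: mmul_assoc)
    also have "\<dots> = mtrace d (mmul d X (mpow d A (m + k)))"
      by (intro mtrace_cong mmul_cong refl) (simp add: mpow_add add.commute)
    also have "mtrace d (mmul d (mpow d A m) (mmul d A (dmpow d A X k))) =
        mtrace d (mmul d (mpow d A (Suc m)) (dmpow d A X k))"
      unfolding mmul_assoc[symmetric]
      by (intro mtrace_cong mmul_cong refl) (simp add: mpow_Suc_right del: mpow.simps)
    finally show ?thesis .
  qed
  {
    case 0
    show ?case unfolding split by (simp add: mtrace_def mmul_def)
  next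
    case (Suc k)
    show ?case unfolding split[of m "Suc k"] Suc by (simp add: algebra_simps)
  }
qed

lemma mtrace_dmpow: "mtrace d (dmpow d A X (Suc k)) = real (Suc k) * mtrace d (mmul d X (mpow d A k))"
proof -
  have "mtrace d (dmpow d A X (Suc k)) = mtrace d (mmul d (mpow d A 0) (dmpow d A X (Suc k)))"
    by (rule mtrace_cong) (rule mmul_mpow_0(2)[symmetric])
  then show ?thesis unfolding mtrace_mpow_dmpow by simp
qed

text \<open>The factor \<open>d\<close> is harmless here: this bound only feeds convergence of the
  series, not its size.\<close>

lemma abs_mtrace_mpow':
  assumes "HS_norm d A \<le> L" shows "\<bar>mtrace d (mpow d A k)\<bar> \<le> real d * L ^ k"
proof -
  have "\<bar>mtrace d (mpow d A k)\<bar> \<le> (\<Sum>i<d. \<bar>mpow d A k i i\<bar>)" unfolding mtrace_def by (rule sum_abs)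
  also have "\<dots> \<le> (\<Sum>i<d. L ^ k)" by (intro sum_mono abs_mpow[OF assms]) auto
  finally show ?thesis by simp
qed

context
  fixes d :: nat and s L :: real
  assumes sL: "\<bar>s\<bar> * L < 1" and L0: "0 \<le> L"
begin

lemma summable_deriv_geo: "summable (\<lambda>k. real k * (\<bar>s\<bar> * L) ^ (k - 1))"
  using geometric_deriv_sums[of "\<bar>s\<bar> * L"] sL L0 
  by (subst summable_Suc_iff[symmetric]) (auto simp: sums_iff abs_mult)

text \<open>Termwise differentiation under the majorant k (|s| L)^(k-1). The series is only an
  intermediate form of the derivative.\<close>

lemma DERIV_resolvent_series:
  assumes dA: "\<And>u i j. i < d \<Longrightarrow> j < d \<Longrightarrow> ((\<lambda>t. A t i j) has_real_derivative X u i j) (at u)"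
    and A: "\<And>u. HS_norm d (A u) \<le> L" and X: "\<And>u. HS_norm d (X u) \<le> M" and ij: "i < d" "j < d"
  shows "((\<lambda>t. resolvent d s (A t) i j) has_real_derivative (\<Sum>k. s ^ k * dmpow d (A u) (X u) k i j)) (at u)"
  unfolding resolvent_def
proof (rule has_field_derivative_series'(2)[where S=UNIV])
  show "((\<lambda>t. s ^ k * mpow d (A t) k i j) has_real_derivative s ^ k * dmpow d (A u) (X u) k i j) (at u)" for k u
    by (intro DERIV_cmult DERIV_mpow dA ij)
  show "uniformly_convergent_on UNIV (\<lambda>n u. \<Sum>k<n. s ^ k * dmpow d (A u) (X u) k i j)"
  proof (rule Weierstrass_m_test')
    show "summable (\<lambda>k. \<bar>s\<bar> * M * (real k * (\<bar>s\<bar> * L) ^ (k - 1)))"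
      by (intro summable_mult summable_deriv_geo)
    show "norm (s ^ k * dmpow d (A u) (X u) k i j) \<le> \<bar>s\<bar> * M * (real k * (\<bar>s\<bar> * L) ^ (k - 1))" for k u
    proof (cases k)
      case (Suc m)
      have "\<bar>dmpow d (A u) (X u) (Suc m) i j\<bar> \<le> real (Suc m) * (M * L ^ m)"
        using HS_norm_dmpow[OF A X, of u u m] abs_le_HS_norm[OF ij] by (meson order.trans)
      then have "\<bar>s\<bar> ^ Suc m * \<bar>dmpow d (A u) (X u) (Suc m) i j\<bar> \<le> \<bar>s\<bar> ^ Suc m * (real (Suc m) * (M * L ^ m))"
        by (rule mult_left_mono) simp
      then show ?thesis
        by (simp only: Suc) (simp add: abs_mult power_abs power_mult_distrib mult_ac del: dmpow.simps)
    qed simp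
  qed
qed (use summable_resolvent[OF sL L0 A ij] in auto)

text \<open>The rule for the derivative of an inverse, R' = s R X R. Differentiating R = I + s A R
  gives D = s X R + s A D, and multiplying by R on the left solves for D because R - s R A =
  I.\<close>

lemma DERIV_resolvent:
  assumes dA: "\<And>u i j. i < d \<Longrightarrow> j < d \<Longrightarrow> ((\<lambda>t. A t i j) has_real_derivative X u i j) (at u)"
    and A: "\<And>u. HS_norm d (A u) \<le> L" and X: "\<And>u. HS_norm d (X u) \<le> M" and ij: "i < d" "j < d"
  shows "((\<lambda>t. resolvent d s (A t) i j) has_real_derivative
     s * mmul d (resolvent d s (A u)) (mmul d (X u) (resolvent d s (A u))) i j) (at u)"
proof -
  define D where "D i j = (\<Sum>k. s ^ k * dmpow d (A u) (X u) k i j)" for i j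
  define R where "R = resolvent d s (A u)"
  have D: "((\<lambda>t. resolvent d s (A t) i j) has_real_derivative D i j) (at u)" if "i < d" "j < d" for i j
    unfolding D_def by (rule DERIV_resolvent_series[OF dA A X that])
  have "((\<lambda>t. of_bool (i = j) + s * (\<Sum>k<d. A t i k * resolvent d s (A t) k j)) has_real_derivative
      0 + s * (\<Sum>k<d. X u i k * R k j + D k j * A u i k)) (at u)" if ij: "i < d" "j < d" for i j
    unfolding R_def
    by (intro DERIV_add DERIV_const DERIV_cmult DERIV_sum DERIV_mult) (use ij in \<open>auto intro: D dA\<close>)
  then have "((\<lambda>t. resolvent d s (A t) i j) has_real_derivative
      0 + s * (\<Sum>k<d. X u i k * R k j + D k j * A u i k)) (at u)" if ij: "i < d" "j < d" for i j
    using that resolvent_left[OF sL L0 A that] by simp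
  then have D_eq: "D i j = s * mmul d (X u) R i j + s * mmul d (A u) D i j" if "i < d" "j < d" for i j
    using DERIV_unique[OF D[OF that]] that
    by (simp add: mmul_def sum.distrib algebra_simps)
  \<comment> \<open>Insert the identity as R - s R A; the two terms containing A D then
    cancel.\<close>
  have "D i j = (\<Sum>k<d. of_bool (i = k) * D k j)"
    using ij by (simp add: sum_mult_of_bool)
  also have "\<dots> = (\<Sum>k<d. (R i k - s * mmul d R (A u) i k) * D k j)"
    using resolvent_right[OF sL L0 A, of i _ u] ij by (intro sum.cong) (auto simp: R_def mmul_def)
  also have "\<dots> = mmul d R D i j - s * mmul d (mmul d R (A u)) D i j"
    by (simp add: mmul_def algebra_simps sum_subtractf sum_distrib_left)
  also have "mmul d R D i j = mmul d R (\<lambda>i j. s * mmul d (X u) R i j + s * mmul d (A u) D i j) i j"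
    using D_eq ij by (intro mmul_cong) auto
  also have "\<dots> = s * mmul d R (mmul d (X u) R) i j + s * mmul d R (mmul d (A u) D) i j"
    by (simp add: mmul_def[of d R] algebra_simps sum.distrib sum_distrib_left)
  finally show ?thesis using D[OF ij] by (simp add: R_def mmul_assoc)
qed

lemma summable_logdet:
  assumes "HS_norm d A \<le> L"
  shows "summable (\<lambda>k. s ^ Suc k * mtrace d (mpow d A (Suc k)) / real (Suc k))"
proof (rule summable_comparison_test'[where N=0])
  show "summable (\<lambda>k. real d * (\<bar>s\<bar> * L) ^ Suc k)"
    using summable_geo[OF sL L0] by (subst summable_Suc_iff) (intro summable_mult)
  fix k
  have "\<bar>s\<bar> ^ Suc k * \<bar>mtrace d (mpow d A (Suc k))\<bar> / real (Suc k) \<le> \<bar>s\<bar> ^ Suc k * (real d * L ^ Suc k) / 1"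
    by (intro frac_le mult_left_mono abs_mtrace_mpow' assms) (use L0 in auto)
  then show "norm (s ^ Suc k * mtrace d (mpow d A (Suc k)) / real (Suc k)) \<le> real d * (\<bar>s\<bar> * L) ^ Suc k"
    by (simp add: abs_mult power_abs power_mult_distrib mult_ac del: mpow.simps)
qed

end

context
  fixes d :: nat and s L :: real
  assumes sL: "\<bar>s\<bar> * L < 1" and L0: "0 \<le> L"
begin

text \<open>Jacobi's formula. In the k-th term the factor k produced by the derivative of the trace
  cancels the denominator, which leaves the Neumann series of the resolvent.\<close>

lemma DERIV_logdet:
  assumes dA: "\<And>u i j. i < d \<Longrightarrow> j < d \<Longrightarrow> ((\<lambda>t. A t i j) has_real_derivative X u i j) (at u)"
    and A: "\<And>u. HS_norm d (A u) \<le> L" and X: "\<And>u. HS_norm d (X u) \<le> M"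
  shows "((\<lambda>t. logdet d s (A t)) has_real_derivative
     - (s * mtrace d (mmul d (X u) (resolvent d s (A u))))) (at u)"
proof -
  have M0: "0 \<le> M" using order.trans[OF HS_norm_nonneg X] .
  have bd: "\<bar>s ^ k * mtrace d (mmul d (X u) (mpow d (A u) k))\<bar> \<le> real d * (M * (\<bar>s\<bar> * L) ^ k)" for k u
  proof -
    have "\<bar>mtrace d (mmul d (X u) (mpow d (A u) k))\<bar> \<le> (\<Sum>i<d. \<bar>mmul d (X u) (mpow d (A u) k) i i\<bar>)"
      unfolding mtrace_def by (rule sum_abs)
    also have "\<dots> \<le> (\<Sum>i<d. M * L ^ k)"
    proof (rule sum_mono)
      fix i assume "i \<in> {..<d}"
      then have "\<bar>mmul d (X u) (mpow d (A u) k) i i\<bar> \<le> HS_norm d (X u) * L ^ k"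
        by (intro order.trans[OF abs_le_HS_norm HS_norm_mmul_mpow[OF A]]) auto
      also have "\<dots> \<le> M * L ^ k" using X L0 by (intro mult_right_mono) auto
      finally show "\<bar>mmul d (X u) (mpow d (A u) k) i i\<bar> \<le> M * L ^ k" .
    qed
    finally have "\<bar>s\<bar> ^ k * \<bar>mtrace d (mmul d (X u) (mpow d (A u) k))\<bar> \<le> \<bar>s\<bar> ^ k * (real d * (M * L ^ k))"
      by (intro mult_left_mono) auto
    then show ?thesis by (simp add: abs_mult power_abs power_mult_distrib mult_ac)
  qed
  have "((\<lambda>t. \<Sum>k. s ^ Suc k * mtrace d (mpow d (A t) (Suc k)) / real (Suc k)) has_real_derivative
      (\<Sum>k. s * (s ^ k * mtrace d (mmul d (X u) (mpow d (A u) k))))) (at u)"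
  proof (rule has_field_derivative_series'(2)[where S=UNIV])
    show "((\<lambda>t. s ^ Suc k * mtrace d (mpow d (A t) (Suc k)) / real (Suc k)) has_real_derivative
        s * (s ^ k * mtrace d (mmul d (X u) (mpow d (A u) k)))) (at u)" for k u
    proof -
      have "((\<lambda>t. s ^ Suc k * mtrace d (mpow d (A t) (Suc k)) / real (Suc k)) has_real_derivative
        s ^ Suc k * mtrace d (dmpow d (A u) (X u) (Suc k)) / real (Suc k)) (at u)"
        unfolding mtrace_def by (intro DERIV_cdivide DERIV_cmult DERIV_sum DERIV_mpow dA) auto
      then show ?thesis unfolding mtrace_dmpow by (simp add: mult.assoc)
    qed
    show "uniformly_convergent_on UNIV (\<lambda>n u. \<Sum>k<n. s * (s ^ k * mtrace d (mmul d (X u) (mpow d (A u) k))))"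
    proof (rule Weierstrass_m_test')
      show "summable (\<lambda>k. \<bar>s\<bar> * (real d * (M * (\<bar>s\<bar> * L) ^ k)))"
        by (intro summable_mult summable_geo[OF sL L0])
    qed (use bd in \<open>auto simp: abs_mult intro!: mult_left_mono\<close>)
  qed (use summable_logdet[OF sL L0 A] in auto)
  also have "(\<Sum>k. s * (s ^ k * mtrace d (mmul d (X u) (mpow d (A u) k)))) =
      (\<Sum>k. \<Sum>i<d. \<Sum>j<d. s * X u i j * (s ^ k * mpow d (A u) k j i))"
    by (simp add: mtrace_def mmul_def sum_distrib_left mult_ac)
  also have "\<dots> = (\<Sum>i<d. \<Sum>j<d. \<Sum>k. s * X u i j * (s ^ k * mpow d (A u) k j i))"
    using summable_resolvent[OF sL L0 A]
    by (subst suminf_sum suminf_sum, auto intro!: summable_sum summable_mult sum.cong suminf_sum)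
  also have "\<dots> = (\<Sum>i<d. \<Sum>j<d. s * X u i j * resolvent d s (A u) j i)"
    by (intro sum.cong refl) (simp add: resolvent_def suminf_mult summable_resolvent[OF sL L0 A])
  also have "\<dots> = s * mtrace d (mmul d (X u) (resolvent d s (A u)))"
    by (simp add: mtrace_def mmul_def sum_distrib_left mult_ac)
  finally show ?thesis unfolding logdet_def by (rule DERIV_minus)
qed

text \<open>Now the matrix is fixed and the scale varies, so this is the derivative of an ordinary
  power series inside its disc of convergence.\<close>

lemma DERIV_logdet_scale:
  assumes A: "HS_norm d A \<le> L"
  shows "((\<lambda>r. logdet d r A) has_real_derivative - mtrace d (mmul d A (resolvent d s A))) (at s)"
proof -
  \<comment> \<open>A radius strictly above |s| at which the series still converges. The denominator
    uses L + 1 rather than L because L may be 0.\<close>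
  define K where "K = \<bar>s\<bar> + (1 - \<bar>s\<bar> * L) / (2 * (L + 1))"
  have sK: "\<bar>s\<bar> < K" unfolding K_def using sL L0 by simp
  have "(1 - \<bar>s\<bar> * L) / (2 * (L + 1)) * L \<le> (1 - \<bar>s\<bar> * L) / 2"
    using sL L0 by (simp add: divide_simps)
  moreover have "K * L = \<bar>s\<bar> * L + (1 - \<bar>s\<bar> * L) / (2 * (L + 1)) * L"
    by (simp add: K_def distrib_right)
  ultimately have "K * L \<le> \<bar>s\<bar> * L + (1 - \<bar>s\<bar> * L) / 2" by (simp only:)
  also have "\<dots> < 1" using sL by (simp add: field_simps)
  finally have KL: "\<bar>K\<bar> * L < 1" using sK by simp
  \<comment> \<open>\<open>logdet\<close> starts at exponent 1; a zero constant coefficient turns it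
    into a standard power series.\<close>
  define c where "c k = (if k = 0 then 0 else mtrace d (mpow d A k) / real k)" for k
  have c0: "c 0 = 0" by (simp add: c_def)
  have eq: "logdet d r A = - (\<Sum>k. c k * r ^ k)" if "\<bar>r\<bar> \<le> \<bar>K\<bar>" for r
  proof -
    have rL: "\<bar>r\<bar> * L < 1"  using KL that L0 by (smt (verit) mult_right_mono)
    have "(\<lambda>k. c (Suc k) * r ^ Suc k) = (\<lambda>k. r ^ Suc k * mtrace d (mpow d A (Suc k)) / real (Suc k))"
      by (auto simp: c_def)
    moreover have "summable (\<lambda>k. r ^ Suc k * mtrace d (mpow d A (Suc k)) / real (Suc k))"
      using rL L0 A by (rule summable_logdet)
    ultimately have "summable (\<lambda>k. c (Suc k) * r ^ Suc k)"
      and eq: "logdet d r A = - (\<Sum>k. c (Suc k) * r ^ Suc k)"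
      by (simp_all only: logdet_def)
    then have "summable (\<lambda>k. c k * r ^ k)"
      by (subst (asm) summable_Suc_iff[of "\<lambda>k. c k * r ^ k"])
    from suminf_split_head[OF this] eq show ?thesis by (simp add: c0)
  qed
  have "summable (\<lambda>k. c (Suc k) * K ^ Suc k)"
    using summable_logdet[OF KL L0 A] by (simp add: c_def mult_ac del: mpow.simps)
  then have "summable (\<lambda>k. c k * K ^ k)"
    by (subst (asm) summable_Suc_iff)
  then have "((\<lambda>r. \<Sum>k. c k * r ^ k) has_real_derivative (\<Sum>k. diffs c k * s ^ k)) (at s)"
    by (rule termdiffs_strong) (use sK in simp)
  moreover have "(\<Sum>k. diffs c k * s ^ k) = (\<Sum>k. \<Sum>i<d. \<Sum>j<d. A i j * (s ^ k * mpow d A k j i))"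
  proof -
    have "diffs c k = mtrace d (mpow d A (Suc k))" for k by (simp add: diffs_def c_def)
    then show ?thesis by (simp add: mtrace_def mmul_def sum_distrib_right sum_distrib_left mult_ac)
  qed
  moreover have "\<dots> = (\<Sum>i<d. \<Sum>j<d. \<Sum>k. A i j * (s ^ k * mpow d A k j i))"
    using summable_resolvent[OF sL L0 A]
    by (subst suminf_sum suminf_sum, auto intro!: summable_sum summable_mult sum.cong suminf_sum)
  moreover have "\<dots> = mtrace d (mmul d A (resolvent d s A))"
    unfolding mtrace_def mmul_def
    by (intro sum.cong refl) (simp add: resolvent_def suminf_mult summable_resolvent[OF sL L0 A])
  ultimately have "((\<lambda>r. - (\<Sum>k. c k * r ^ k)) has_real_derivative - mtrace d (mmul d A (resolvent d s A))) (at s)"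
    by (auto intro: DERIV_minus)
  then show ?thesis
  proof (rule has_field_derivative_transform_within_open)
    show "open {-K<..<K}" "s \<in> {-K<..<K}" using sK by auto
  qed (use eq in auto)
qed

text \<open>The added trace cancels the first term of the series. The remaining denominators are at
  least 2 and the geometric sum is at most 2, so the constants multiply to 1.\<close>

lemma abs_logdet_add_trace_le:
  assumes A: "HS_norm d A \<le> L" and sL2: "\<bar>s\<bar> * L \<le> 1 / 2"
  shows "\<bar>logdet d s A + s * mtrace d A\<bar> \<le> (s * L)\<^sup>2"
proof -
  define f where "f k = s ^ Suc k * mtrace d (mpow d A (Suc k)) / real (Suc k)" for k
  have f0: "f 0 = s * mtrace d A"
    using mmul_mpow_0(1)[of _ d A A] by (auto simp: f_def intro!: mtrace_cong)
  have sf: "summable f" unfolding f_def by (rule summable_logdet[OF sL L0 A])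
  have "logdet d s A + s * mtrace d A = - (\<Sum>k. f (Suc k))"
    using suminf_split_head[OF sf] f0 unfolding logdet_def f_def[symmetric] by simp
  moreover have "norm (\<Sum>k. f (Suc k)) \<le> (\<Sum>k. (\<bar>s\<bar> * L)\<^sup>2 / 2 * (\<bar>s\<bar> * L) ^ k)"
  proof (rule norm_suminf_le)
    fix k
    have "\<bar>s\<bar> ^ Suc (Suc k) * \<bar>mtrace d (mpow d A (Suc (Suc k)))\<bar> / real (Suc (Suc k)) \<le>
        \<bar>s\<bar> ^ Suc (Suc k) * L ^ Suc (Suc k) / 2"
      by (intro frac_le mult_left_mono abs_mtrace_mpow A) (use L0 in auto)
    then show "norm (f (Suc k)) \<le> (\<bar>s\<bar> * L)\<^sup>2 / 2 * (\<bar>s\<bar> * L) ^ k"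
      by (simp add: f_def abs_mult power_abs power_mult_distrib power2_eq_square mult_ac del: mpow.simps abs_mult_self_eq)
  qed (intro summable_mult summable_geo[OF sL L0])
  moreover have "\<dots> = (\<bar>s\<bar> * L)\<^sup>2 / 2 * (1 / (1 - \<bar>s\<bar> * L))"
    using sL L0 by (subst suminf_mult[OF summable_geo[OF sL L0]]) (simp add: suminf_geometric)
  moreover have "\<dots> \<le> (\<bar>s\<bar> * L)\<^sup>2 / 2 * 2"
    using sL2 by (intro mult_left_mono) (auto simp: divide_simps)
  ultimately show ?thesis by (simp add: power_mult_distrib)
qed

end

subsection \<open>Calculus on the coordinate space\<close>

lemma Rd_upd [simp]: "x \<in> Rd d \<Longrightarrow> l < d \<Longrightarrow> x(l := t) \<in> Rd d"
  by (auto simp: Rd_def PiE_def extensional_def)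

lemma space_lebesgue_Rd [simp]: "space (lebesgue_Rd d) = Rd d"
  by (simp add: lebesgue_Rd_def space_PiM Rd_def)

lemma sets_gaussian: "sets (gaussian d) = sets (lebesgue_Rd d)"
  unfolding gaussian_def lebesgue_Rd_def by (intro sets_PiM_cong) auto

lemma space_gaussian [simp]: "space (gaussian d) = Rd d"
  by (simp add: gaussian_def space_PiM Rd_def)

lemma measurable_gaussian_iff: "f \<in> borel_measurable (gaussian d) \<longleftrightarrow> f \<in> borel_measurable (lebesgue_Rd d)"
  by (simp add: measurable_cong_sets[OF sets_gaussian refl])

lemma measurable_coord [measurable]: "i < d \<Longrightarrow> (\<lambda>x. x i) \<in> borel_measurable (lebesgue_Rd d)"
  unfolding lebesgue_Rd_def using measurable_component_singleton[of i "{..<d}" "\<lambda>_. lborel"] by simp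

text \<open>The mean value inequality bounds every difference quotient by \<open>D\<close>, so
  dominated convergence applies along each sequence tending to \<open>t\<close>. Domination on an
  open interval is all that is available later, where \<open>s\<close> must stay small.\<close>

lemma DERIV_integral_dominated:
  fixes f f' :: "real \<Rightarrow> 'a \<Rightarrow> real"
  assumes t: "t \<in> {a<..<b}"
    and int: "\<And>u. u \<in> {a<..<b} \<Longrightarrow> integrable M (f u)"
    and der: "\<And>u x. u \<in> {a<..<b} \<Longrightarrow> x \<in> space M \<Longrightarrow> ((\<lambda>u. f u x) has_real_derivative f' u x) (at u)"
    and bd: "\<And>u x. u \<in> {a<..<b} \<Longrightarrow> x \<in> space M \<Longrightarrow> \<bar>f' u x\<bar> \<le> D x"
    and D: "integrable M D" and meas: "f' t \<in> borel_measurable M"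
  shows "((\<lambda>u. \<integral>x. f u x \<partial>M) has_real_derivative (\<integral>x. f' t x \<partial>M)) (at t)"
proof -
  have "((\<lambda>u. ((\<integral>x. f u x \<partial>M) - (\<integral>x. f t x \<partial>M)) / (u - t)) \<longlongrightarrow> (\<integral>x. f' t x \<partial>M)) (at t within {a<..<b})"
    unfolding tendsto_at_iff_sequentially
  proof (intro allI impI)
    fix X :: "nat \<Rightarrow> real" assume X: "\<forall>i. X i \<in> {a<..<b} - {t}" "X \<longlonglongrightarrow> t"
    have "(\<lambda>n. \<integral>x. (f (X n) x - f t x) / (X n - t) \<partial>M) \<longlonglongrightarrow> (\<integral>x. f' t x \<partial>M)"
    proof (rule integral_dominated_convergence[where w=D])
      show "(\<lambda>x. (f (X n) x - f t x) / (X n - t)) \<in> borel_measurable M" for n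
        using int[of "X n"] int[of t] X t by (auto intro!: borel_measurable_divide borel_measurable_diff)
      show "AE x in M. (\<lambda>n. (f (X n) x - f t x) / (X n - t)) \<longlonglongrightarrow> f' t x"
      proof (rule AE_I2)
        fix x assume x: "x \<in> space M"
        show "(\<lambda>n. (f (X n) x - f t x) / (X n - t)) \<longlonglongrightarrow> f' t x"
          using der[OF t x] X unfolding has_field_derivative_iff
          by (auto simp: tendsto_at_iff_sequentially comp_def)
      qed
      show "AE x in M. norm ((f (X n) x - f t x) / (X n - t)) \<le> D x" for n
      proof (rule AE_I2)
        fix x assume x: "x \<in> space M"
        have Xn: "X n \<in> {a<..<b}" "X n \<noteq> t" using X by auto
        have "norm (f (X n) x - f t x) \<le> D x * norm (X n - t)"
        proof (rule field_differentiable_bound[where S="{a<..<b}" and f="\<lambda>u. f u x" and f'="\<lambda>u. f' u x"])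
          show "((\<lambda>u. f u x) has_real_derivative f' u x) (at u within {a<..<b})" if "u \<in> {a<..<b}" for u
            using der[OF that x] by (rule has_field_derivative_at_within)
          show "norm (f' u x) \<le> D x" if "u \<in> {a<..<b}" for u using bd[OF that x] by simp
        qed (use Xn t in auto)
        then show "norm ((f (X n) x - f t x) / (X n - t)) \<le> D x"
          using Xn by (simp add: divide_simps abs_mult)
      qed
    qed (use D meas in auto)
    moreover have "(\<integral>x. (f (X n) x - f t x) / (X n - t) \<partial>M) = ((\<integral>x. f (X n) x \<partial>M) - (\<integral>x. f t x \<partial>M)) / (X n - t)" for n
    proof -
      have "integrable M (f (X n))" "integrable M (f t)" using int X t by auto
      then show ?thesis by simp
    qed
    ultimately show "((\<lambda>u. ((\<integral>x. f u x \<partial>M) - (\<integral>x. f t x \<partial>M)) / (u - t)) \<circ> X) \<longlonglongrightarrow> (\<integral>x. f' t x \<partial>M)"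
      unfolding comp_def by (simp only:)
  qed
  then show ?thesis
    unfolding has_field_derivative_iff using t at_within_open[of t "{a<..<b}"] by simp
qed

text \<open>Integrability of \<open>g'\<close> is not assumed: a non-integrable function has
  integral 0 by convention, so the conclusion holds in that case too. This spares the null-set
  bookkeeping for slices after Fubini.\<close>

lemma integral_derivative_eq_0:
  fixes g g' :: "real \<Rightarrow> real"
  assumes der: "\<And>t. (g has_real_derivative g' t) (at t)"
    and lim: "(g \<longlongrightarrow> 0) at_top" "(g \<longlongrightarrow> 0) at_bot"
  shows "(\<integral>t. g' t \<partial>lborel) = 0"
proof (cases "integrable lborel g'")
  case int: True
  have "(\<lambda>n. \<integral>t. indicator {- real n..real n} t * g' t \<partial>lborel) \<longlonglongrightarrow> (\<integral>t. g' t \<partial>lborel)"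
  proof (rule integral_dominated_convergence[where w="\<lambda>t. \<bar>g' t\<bar>"])
    show "AE t in lborel. (\<lambda>n. indicator {- real n..real n} t * g' t) \<longlonglongrightarrow> g' t"
    proof (rule AE_I2)
      fix t :: real
      have "\<forall>\<^sub>F n in sequentially. \<bar>t\<bar> \<le> real n"
        using eventually_ge_at_top[of "nat \<lceil>\<bar>t\<bar>\<rceil>"] by eventually_elim linarith
      then have "\<forall>\<^sub>F n in sequentially. indicator {- real n..real n} t * g' t = g' t"
        by (rule eventually_mono) (auto simp: indicator_def)
      then show "(\<lambda>n. indicator {- real n..real n} t * g' t) \<longlonglongrightarrow> g' t"
        by (rule tendsto_eventually)
    qed
  qed (use int in \<open>auto simp: indicator_def intro!: AE_I2\<close>)
  moreover have "(\<integral>t. indicator {- real n..real n} t * g' t \<partial>lborel) = g (real n) - g (- real n)" for n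
  proof -
    have "set_integrable lborel {- real n..real n} g'"
      unfolding set_integrable_def using int by (intro integrable_mult_indicator) auto
    then have "(\<integral>t. indicator {- real n..real n} t * g' t \<partial>lborel) = integral {- real n..real n} g'"
      using set_borel_integral_eq_integral(2)[of "{- real n..real n}" g'] by (simp add: set_lebesgue_integral_def)
    also have "(g' has_integral g (real n) - g (- real n)) {- real n..real n}"
      using der by (intro fundamental_theorem_of_calculus)
        (auto simp: has_real_derivative_iff_has_vector_derivative[symmetric] intro: has_field_derivative_at_within)
    then have "integral {- real n..real n} g' = g (real n) - g (- real n)" by (rule integral_unique)
    finally show ?thesis .
  qed
  moreover have "(\<lambda>n. g (real n) - g (- real n)) \<longlonglongrightarrow> 0 - 0"
    by (intro tendsto_diff filterlim_compose[OF lim(1)] filterlim_compose[OF lim(2)])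
      (auto simp: filterlim_uminus_at_bot filterlim_real_sequentially)
  ultimately show ?thesis using LIMSEQ_unique by fastforce
qed (simp add: not_integrable_integral_eq)

interpretation lborel_product: product_sigma_finite "\<lambda>_::nat. lborel :: real measure" ..

text \<open>Fubini with coordinate \<open>l\<close> innermost: each inner integral is that of a
  derivative whose primitive vanishes at both ends.\<close>

lemma integral_partial_derivative_eq_0:
  assumes l: "l < d" and int: "integrable (lebesgue_Rd d) q'"
    and der: "\<And>x. x \<in> Rd d \<Longrightarrow> ((\<lambda>t. q (x(l := t))) has_real_derivative q' x) (at (x l))"
    and lim: "\<And>x. x \<in> Rd d \<Longrightarrow> ((\<lambda>t. q (x(l := t))) \<longlongrightarrow> 0) at_top"
             "\<And>x. x \<in> Rd d \<Longrightarrow> ((\<lambda>t. q (x(l := t))) \<longlongrightarrow> 0) at_bot"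
  shows "(\<integral>x. q' x \<partial>lebesgue_Rd d) = 0"
proof -
  have ins: "{..<d} = insert l ({..<d} - {l})" using l by auto
  have "(\<integral>x. q' x \<partial>lebesgue_Rd d) = (\<integral>x. (\<integral>t. q' (x(l := t)) \<partial>lborel) \<partial>Pi\<^sub>M ({..<d} - {l}) (\<lambda>_. lborel))"
    unfolding lebesgue_Rd_def
    by (subst ins, rule lborel_product.product_integral_insert) (use int ins in \<open>auto simp: lebesgue_Rd_def\<close>)
  also have "\<dots> = (\<integral>x. 0 \<partial>Pi\<^sub>M ({..<d} - {l}) (\<lambda>_. lborel :: real measure))"
  proof (rule Bochner_Integration.integral_cong[OF refl])
    fix x assume "x \<in> space (Pi\<^sub>M ({..<d} - {l}) (\<lambda>_. lborel :: real measure))"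
    then have x: "x(l := t) \<in> Rd d" for t using l by (auto simp: space_PiM Rd_def PiE_def extensional_def)
    show "(\<integral>t. q' (x(l := t)) \<partial>lborel) = 0"
    proof (rule integral_derivative_eq_0)
      show "((\<lambda>t. q (x(l := t))) has_real_derivative q' (x(l := t))) (at t)" for t
        using der[OF x[of t]] by simp
    qed (use lim[OF x[of 0]] in auto)
  qed
  finally show ?thesis by simp
qed

text \<open>Differentiability along smooth paths covers both coordinate lines and the rotation path of
  the Gaussian concentration argument.\<close>

definition smooth_path :: "nat \<Rightarrow> (real \<Rightarrow> nat \<Rightarrow> real) \<Rightarrow> (real \<Rightarrow> nat \<Rightarrow> real) \<Rightarrow> bool" where
  "smooth_path d c c' \<longleftrightarrow> (\<forall>t. c t \<in> Rd d) \<and>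
     (\<forall>j<d. (\<forall>t. ((\<lambda>t. c t j) has_real_derivative c' t j) (at t)) \<and> continuous_on UNIV (\<lambda>t. c' t j))"

lemma smooth_path_coord:
  assumes "x \<in> Rd d" "l < d"
  shows "smooth_path d (\<lambda>t. x(l := t)) (\<lambda>t j. of_bool (j = l))"
  using assms by (auto simp: smooth_path_def intro!: derivative_eq_intros)

lemma euclidean_norm_nonneg [simp]: "0 \<le> euclidean_norm d v"
  by (simp add: euclidean_norm_def)

lemma euclidean_norm_sqr: "(euclidean_norm d v)\<^sup>2 = (\<Sum>i<d. (v i)\<^sup>2)"
  by (simp add: euclidean_norm_def L2_set_def sum_nonneg)

lemma abs_le_euclidean_norm: "i < d \<Longrightarrow> \<bar>v i\<bar> \<le> euclidean_norm d v"
  unfolding euclidean_norm_def L2_set_def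
  by (rule real_le_rsqrt) (auto intro!: member_le_sum[of i _ "\<lambda>i. (v i)\<^sup>2"])

lemma euclidean_norm_triangle: "euclidean_norm d (\<lambda>i. u i + v i) \<le> euclidean_norm d u + euclidean_norm d v"
  unfolding euclidean_norm_def by (rule L2_set_triangle_ineq)

lemma euclidean_norm_scale: "euclidean_norm d (\<lambda>i. a * v i) = \<bar>a\<bar> * euclidean_norm d v"
  unfolding euclidean_norm_def L2_set_def
  by (simp add: power_mult_distrib real_sqrt_mult flip: sum_distrib_left)

lemma euclidean_norm_cong: "(\<And>i. i < d \<Longrightarrow> u i = v i) \<Longrightarrow> euclidean_norm d u = euclidean_norm d v"
  unfolding euclidean_norm_def by (rule L2_set_cong) auto

lemma euclidean_norm_uminus [simp]: "euclidean_norm d (\<lambda>i. - v i) = euclidean_norm d v"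
  using euclidean_norm_scale[of d "-1" v] by simp

lemma abs_sum_mult_le: "\<bar>\<Sum>i<d. u i * v i\<bar> \<le> euclidean_norm d u * euclidean_norm d v"
  using sum_abs[of "\<lambda>i. u i * v i" "{..<d}"] L2_set_mult_ineq[of u v "{..<d}"]
  by (simp add: abs_mult euclidean_norm_def)

lemma euclidean_norm_matrix_vector:
  "euclidean_norm d (\<lambda>i. \<Sum>j<d. A i j * v j) \<le> HS_norm d A * euclidean_norm d v"
proof -
  have "(euclidean_norm d (\<lambda>i. \<Sum>j<d. A i j * v j))\<^sup>2 = (\<Sum>i<d. (\<Sum>j<d. A i j * v j)\<^sup>2)"
    by (rule euclidean_norm_sqr)
  also have "\<dots> \<le> (\<Sum>i<d. (\<Sum>j<d. (A i j)\<^sup>2) * (\<Sum>j<d. (v j)\<^sup>2))"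
    by (intro sum_mono cauchy_schwarz_sum)
  also have "\<dots> = (HS_norm d A * euclidean_norm d v)\<^sup>2"
    by (simp add: HS_norm_sqr euclidean_norm_sqr power_mult_distrib flip: sum_distrib_right)
  finally show ?thesis by (rule power2_le_imp_le) simp
qed

subsection \<open>The change of variables identity\<close>

text \<open>The interface that a mollified Sobolev field satisfies: \<open>A\<close> is the first
  and \<open>H\<close> the second derivative of \<open>V\<close>. \<open>L\<close> must be the
  original bound on the derivative, since it enters the final constants; \<open>B\<close> serves
  only to dominate derivatives, so it may depend on the dimension and on the mollifier. Positivity
  of \<open>L\<close> allows scales proportional to 1/L.\<close>

locale smooth_field =
  fixes d :: nat and V :: "(nat \<Rightarrow> real) \<Rightarrow> nat \<Rightarrow> real"
    and A :: "(nat \<Rightarrow> real) \<Rightarrow> nat \<Rightarrow> nat \<Rightarrow> real"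
    and H :: "(nat \<Rightarrow> real) \<Rightarrow> nat \<Rightarrow> nat \<Rightarrow> nat \<Rightarrow> real"
    and L B :: real
  assumes DERIV_V: "\<And>c c' i t. smooth_path d c c' \<Longrightarrow> i < d \<Longrightarrow>
      ((\<lambda>t. V (c t) i) has_real_derivative (\<Sum>j<d. A (c t) i j * c' t j)) (at t)"
    and DERIV_A: "\<And>c c' i j t. smooth_path d c c' \<Longrightarrow> i < d \<Longrightarrow> j < d \<Longrightarrow>
      ((\<lambda>t. A (c t) i j) has_real_derivative (\<Sum>k<d. H (c t) i j k * c' t k)) (at t)"
    and H_commute: "\<And>x i j k. x \<in> Rd d \<Longrightarrow> i < d \<Longrightarrow> j < d \<Longrightarrow> k < d \<Longrightarrow> H x i j k = H x i k j"
    and HS_A: "\<And>x. x \<in> Rd d \<Longrightarrow> HS_norm d (A x) \<le> L"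
    and H_bound: "\<And>x i j k. x \<in> Rd d \<Longrightarrow> i < d \<Longrightarrow> j < d \<Longrightarrow> k < d \<Longrightarrow> \<bar>H x i j k\<bar> \<le> B"
    and V_meas [measurable]: "\<And>i. i < d \<Longrightarrow> (\<lambda>x. V x i) \<in> borel_measurable (lebesgue_Rd d)"
    and A_meas [measurable]: "\<And>i j. i < d \<Longrightarrow> j < d \<Longrightarrow> (\<lambda>x. A x i j) \<in> borel_measurable (lebesgue_Rd d)"
    and H_meas [measurable]: "\<And>i j k. i < d \<Longrightarrow> j < d \<Longrightarrow> k < d \<Longrightarrow> (\<lambda>x. H x i j k) \<in> borel_measurable (lebesgue_Rd d)"
    and L_pos: "0 < L"
begin

lemma DERIV_V_coord:
  assumes "x \<in> Rd d" "i < d" "l < d"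
  shows "((\<lambda>t. V (x(l := t)) i) has_real_derivative A (x(l := t)) i l) (at t)"
  using DERIV_V[OF smooth_path_coord[OF assms(1,3)] assms(2), of t] assms(3)
  by (simp add: of_bool_def if_distrib[where f="\<lambda>a. _ * a"] cong: if_cong)

lemma DERIV_A_coord:
  assumes "x \<in> Rd d" "i < d" "j < d" "l < d"
  shows "((\<lambda>t. A (x(l := t)) i j) has_real_derivative H (x(l := t)) i j l) (at t)"
  using DERIV_A[OF smooth_path_coord[OF assms(1,4)] assms(2,3), of t] assms(4)
  by (simp add: of_bool_def if_distrib[where f="\<lambda>a. _ * a"] cong: if_cong)

text \<open>The scalar mean value theorem along the segment, applied to the component of
  \<open>V\<close> in the direction u = V x - V y. Testing with u itself produces |u|^2 on the left,
  and one factor |u| cancels.\<close>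

lemma V_lipschitz:
  assumes x: "x \<in> Rd d" and y: "y \<in> Rd d"
  shows "euclidean_norm d (\<lambda>i. V x i - V y i) \<le> L * euclidean_norm d (\<lambda>i. x i - y i)"
proof -
  define c where "c t = (\<lambda>i\<in>{..<d}. y i + t * (x i - y i))" for t
  have c: "smooth_path d c (\<lambda>t i. x i - y i)"
    by (auto simp: smooth_path_def c_def Rd_def intro!: derivative_eq_intros)
  define u where "u i = V x i - V y i" for i
  have c01: "c 0 = y" "c 1 = x"
    using x y by (auto simp: c_def Rd_def PiE_def extensional_def fun_eq_iff)
  have "\<exists>z>0. z < 1 \<and> (\<Sum>i<d. u i * V (c 1) i) - (\<Sum>i<d. u i * V (c 0) i) =
      (1 - 0) * (\<Sum>i<d. u i * (\<Sum>j<d. A (c z) i j * (x j - y j)))"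
    by (rule MVT2) (auto intro!: DERIV_sum DERIV_cmult DERIV_V[OF c])
  then obtain z where z: "(\<Sum>i<d. u i * V (c 1) i) - (\<Sum>i<d. u i * V (c 0) i) =
      (\<Sum>i<d. u i * (\<Sum>j<d. A (c z) i j * (x j - y j)))" by auto
  have cz: "c z \<in> Rd d" by (simp add: c_def Rd_def)
  have "(euclidean_norm d u)\<^sup>2 = (\<Sum>i<d. u i * V x i) - (\<Sum>i<d. u i * V y i)"
    unfolding euclidean_norm_sqr sum_subtractf[symmetric]
    by (simp add: power2_eq_square right_diff_distrib[symmetric] u_def)
  also have "\<dots> = (\<Sum>i<d. u i * (\<Sum>j<d. A (c z) i j * (x j - y j)))"
    using z by (simp only: c01)
  also have "\<dots> \<le> euclidean_norm d u * euclidean_norm d (\<lambda>i. \<Sum>j<d. A (c z) i j * (x j - y j))"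
    by (rule order.trans[OF abs_ge_self abs_sum_mult_le])
  also have "\<dots> \<le> euclidean_norm d u * (HS_norm d (A (c z)) * euclidean_norm d (\<lambda>i. x i - y i))"
    by (intro mult_left_mono euclidean_norm_matrix_vector) simp
  also have "\<dots> \<le> euclidean_norm d u * (L * euclidean_norm d (\<lambda>i. x i - y i))"
    by (intro mult_left_mono mult_right_mono HS_A cz) simp_all
  finally have *: "euclidean_norm d u * euclidean_norm d u \<le>
      euclidean_norm d u * (L * euclidean_norm d (\<lambda>i. x i - y i))"
    by (simp add: power2_eq_square)
  show ?thesis
  proof (cases "euclidean_norm d u = 0")
    case True
    then show ?thesis using L_pos by (simp add: u_def[abs_def])
  next
    case False
    then have "0 < euclidean_norm d u" using euclidean_norm_nonneg[of d u] by linarith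
    then show ?thesis using * unfolding u_def[abs_def] by simp
  qed
qed

definition T :: "real \<Rightarrow> (nat \<Rightarrow> real) \<Rightarrow> nat \<Rightarrow> real" where
  "T s x i = x i - s * V x i"

abbreviation R :: "real \<Rightarrow> (nat \<Rightarrow> real) \<Rightarrow> nat \<Rightarrow> nat \<Rightarrow> real" where
  "R s x \<equiv> resolvent d s (A x)"

text \<open>The pull-back of the Gaussian density under \<open>T s\<close>, with the Jacobian in
  logarithmic form and without the normalising constant.\<close>

definition \<phi> :: "real \<Rightarrow> (nat \<Rightarrow> real) \<Rightarrow> real" where
  "\<phi> s x = exp (logdet d s (A x) - (\<Sum>i<d. (T s x i)\<^sup>2) / 2)"

text \<open>The derivative of \<open>\<phi>\<close> in \<open>s\<close>, as \<open>DERIV_phi\<close>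
  confirms.\<close>

definition p :: "real \<Rightarrow> (nat \<Rightarrow> real) \<Rightarrow> real" where
  "p s x = \<phi> s x * (- mtrace d (mmul d (A x) (R s x)) + (\<Sum>i<d. T s x i * V x i))"

definition w :: "real \<Rightarrow> (nat \<Rightarrow> real) \<Rightarrow> nat \<Rightarrow> real" where
  "w s x l = (\<Sum>j<d. R s x l j * V x j)"

definition Hm :: "(nat \<Rightarrow> real) \<Rightarrow> nat \<Rightarrow> nat \<Rightarrow> nat \<Rightarrow> real" where
  "Hm x l i j = H x i j l"

text \<open>The derivative in direction \<open>l\<close> of the component \<open>\<phi> * w\<close>
  with index \<open>l\<close>: the first summand differentiates \<open>\<phi>\<close>, the second
  differentiates \<open>w\<close>. It is written out because measurability and growth are read off
  the formula.\<close>

definition q' :: "nat \<Rightarrow> real \<Rightarrow> (nat \<Rightarrow> real) \<Rightarrow> real" where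
  "q' l s x = \<phi> s x * (- (s * mtrace d (mmul d (Hm x l) (R s x)))
       - (\<Sum>i<d. T s x i * (of_bool (i = l) - s * A x i l))) * w s x l
     + \<phi> s x * (\<Sum>j<d. s * mmul d (R s x) (mmul d (Hm x l) (R s x)) l j * V x j + R s x l j * A x j l)"

lemma HS_Hm:
  assumes "x \<in> Rd d" "l < d" shows "HS_norm d (Hm x l) \<le> real d * B"
proof -
  have B: "0 \<le> B" using H_bound[OF assms(1,2,2,2)] by linarith
  have "(HS_norm d (Hm x l))\<^sup>2 \<le> (\<Sum>i<d. \<Sum>j<d. B\<^sup>2)"
    unfolding HS_norm_sqr Hm_def using H_bound[OF assms(1) _ _ assms(2)] B
    by (intro sum_mono) (auto intro!: abs_le_square_iff[THEN iffD1])
  also have "\<dots> = (real d * B)\<^sup>2" by (simp add: power2_eq_square)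
  finally show ?thesis by (rule power2_le_imp_le) (use B in simp)
qed

lemma sL_lt_1: "\<bar>s\<bar> * L \<le> 1 / 2 \<Longrightarrow> \<bar>s\<bar> * L < 1"
  by simp

lemma L_nonneg: "0 \<le> L" using L_pos by simp

lemma DERIV_phi:
  assumes "x \<in> Rd d" "\<bar>s\<bar> * L \<le> 1 / 2"
  shows "((\<lambda>s. \<phi> s x) has_real_derivative p s x) (at s)"
proof -
  have "((\<lambda>s. (T s x i)\<^sup>2) has_real_derivative - 2 * V x i * T s x i) (at s)" for i
    unfolding T_def by (auto intro!: derivative_eq_intros)
  then have "((\<lambda>s. (\<Sum>i<d. (T s x i)\<^sup>2) / 2) has_real_derivative (\<Sum>i<d. - 2 * V x i * T s x i) / 2) (at s)"
    by (intro DERIV_cdivide DERIV_sum)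
  also have "(\<Sum>i<d. - 2 * V x i * T s x i) / 2 = - (\<Sum>i<d. T s x i * V x i)"
    unfolding sum_divide_distrib sum_negf[symmetric] by (intro sum.cong refl) (simp add: field_simps)
  finally have "((\<lambda>s. \<phi> s x) has_real_derivative
      exp (logdet d s (A x) - (\<Sum>i<d. (T s x i)\<^sup>2) / 2) *
      (- mtrace d (mmul d (A x) (R s x)) - - (\<Sum>i<d. T s x i * V x i))) (at s)"
    unfolding \<phi>_def
    by (intro DERIV_chain2[OF DERIV_exp] DERIV_diff DERIV_logdet_scale[OF sL_lt_1[OF assms(2)] L_nonneg HS_A[OF assms(1)]])
  then show ?thesis by (simp add: p_def \<phi>_def)
qed

lemma DERIV_q:
  assumes x: "x \<in> Rd d" and s: "\<bar>s\<bar> * L \<le> 1 / 2" and l: "l < d"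
  shows "((\<lambda>t. \<phi> s (x(l := t)) * w s (x(l := t)) l) has_real_derivative q' l s x) (at (x l))"
proof -
  have R: "((\<lambda>t. R s (x(l := t)) l j) has_real_derivative s * mmul d (R s x) (mmul d (Hm x l) (R s x)) l j) (at (x l))"
    if "j < d" for j
    using DERIV_resolvent[OF sL_lt_1[OF s] L_nonneg, where A="\<lambda>t. A (x(l := t))" and X="\<lambda>t. Hm (x(l := t)) l"
        and M="real d * B" and u="x l" and i=l and j=j]
    by (simp add: that l x HS_A HS_Hm DERIV_A_coord Hm_def)
  have S: "((\<lambda>t. logdet d s (A (x(l := t)))) has_real_derivative - (s * mtrace d (mmul d (Hm x l) (R s x)))) (at (x l))"
    using DERIV_logdet[OF sL_lt_1[OF s] L_nonneg, where A="\<lambda>t. A (x(l := t))" and X="\<lambda>t. Hm (x(l := t)) l"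
        and M="real d * B" and u="x l"]
    by (simp add: l x HS_A HS_Hm DERIV_A_coord Hm_def)
  have V: "((\<lambda>t. V (x(l := t)) i) has_real_derivative A x i l) (at (x l))" if "i < d" for i
    using DERIV_V_coord[OF x that l, of "x l"] by simp
  have X: "((\<lambda>t. (x(l := t)) i) has_real_derivative of_bool (i = l)) (at (x l))" for i
    by (cases "i = l") auto
  have "((\<lambda>t. T s (x(l := t)) i) has_real_derivative of_bool (i = l) - s * A x i l) (at (x l))" if "i < d" for i
    unfolding T_def by (intro DERIV_diff DERIV_cmult X V that)
  then have E: "((\<lambda>t. (\<Sum>i<d. (T s (x(l := t)) i)\<^sup>2) / 2) has_real_derivative
      (\<Sum>i<d. 2 * (of_bool (i = l) - s * A x i l) * T s x i) / 2) (at (x l))"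
    by (intro DERIV_cdivide DERIV_sum) (auto intro!: derivative_eq_intros)
  have phi: "((\<lambda>t. \<phi> s (x(l := t))) has_real_derivative
      exp (logdet d s (A (x(l := x l))) - (\<Sum>i<d. (T s (x(l := x l)) i)\<^sup>2) / 2) *
      (- (s * mtrace d (mmul d (Hm x l) (R s x))) - (\<Sum>i<d. 2 * (of_bool (i = l) - s * A x i l) * T s x i) / 2)) (at (x l))"
    unfolding \<phi>_def by (rule DERIV_chain2[OF DERIV_exp]) (intro DERIV_diff S E)
  have W: "((\<lambda>t. w s (x(l := t)) l) has_real_derivative
      (\<Sum>j<d. s * mmul d (R s x) (mmul d (Hm x l) (R s x)) l j * V (x(l := x l)) j + A x j l * R s (x(l := x l)) l j)) (at (x l))"
    unfolding w_def by (intro DERIV_sum DERIV_mult R V) auto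
  have half: "(\<Sum>i<d. 2 * (of_bool (i = l) - s * A x i l) * T s x i) / 2 = (\<Sum>i<d. T s x i * (of_bool (i = l) - s * A x i l))"
    unfolding sum_divide_distrib by (intro sum.cong refl) (simp add: field_simps)
  show ?thesis
    using DERIV_mult[OF phi W] unfolding q'_def half by (simp add: \<phi>_def mult_ac)
qed

text \<open>The Jacobian factor and the resolvent conspire (Piola's identity): all second derivatives
  cancel, because they are symmetric in the two directions of differentiation.\<close>

lemma sum_q':
  assumes x: "x \<in> Rd d" and s: "\<bar>s\<bar> * L \<le> 1 / 2"
  shows "(\<Sum>l<d. q' l s x) = - p s x"
proof -
  note R_left = resolvent_left[OF sL_lt_1[OF s] L_nonneg HS_A[OF x]]
  \<comment> \<open>The derivative of the Jacobian (left) against the derivative of the resolvent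
    (right). Exchanging the last two indices of \<open>H\<close> turns one contraction into the
    other.\<close>
  have 1: "(\<Sum>l<d. mtrace d (mmul d (Hm x l) (R s x)) * w s x l) =
      (\<Sum>l<d. \<Sum>j<d. mmul d (R s x) (mmul d (Hm x l) (R s x)) l j * V x j)"
  proof -
    have "(\<Sum>l<d. mtrace d (mmul d (Hm x l) (R s x)) * w s x l) =
        (\<Sum>l<d. \<Sum>m<d. \<Sum>n<d. H x m n l * R s x n m * w s x l)"
      by (simp add: mtrace_def mmul_def Hm_def sum_distrib_right)
    also have "\<dots> = (\<Sum>l<d. \<Sum>n<d. \<Sum>m<d. H x m l n * R s x n m * w s x l)"
      by (rule sum.cong[OF refl], subst sum.swap, intro sum.cong refl) (simp add: H_commute[OF x])
    also have "\<dots> = (\<Sum>n<d. \<Sum>l<d. \<Sum>m<d. H x m l n * R s x n m * w s x l)"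
      by (rule sum.swap)
    also have "\<dots> = (\<Sum>n<d. \<Sum>m<d. R s x n m * (\<Sum>l<d. H x m l n * w s x l))"
      by (rule sum.cong[OF refl], subst sum.swap) (simp add: sum_distrib_left mult_ac)
    also have "\<dots> = (\<Sum>n<d. \<Sum>m<d. R s x n m * (\<Sum>l<d. \<Sum>j<d. Hm x n m l * R s x l j * V x j))"
      by (simp add: w_def Hm_def sum_distrib_left mult_ac)
    also have "\<dots> = (\<Sum>n<d. \<Sum>j<d. mmul d (R s x) (mmul d (Hm x n) (R s x)) n j * V x j)"
    proof (rule sum.cong[OF refl])
      fix n
      have "(\<Sum>m<d. R s x n m * (\<Sum>l<d. \<Sum>j<d. Hm x n m l * R s x l j * V x j)) =
          (\<Sum>m<d. \<Sum>j<d. \<Sum>l<d. R s x n m * (Hm x n m l * R s x l j * V x j))"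
        by (subst sum.swap) (simp add: sum_distrib_left)
      also have "\<dots> = (\<Sum>j<d. \<Sum>m<d. \<Sum>l<d. R s x n m * (Hm x n m l * R s x l j * V x j))"
        by (rule sum.swap)
      also have "\<dots> = (\<Sum>j<d. mmul d (R s x) (mmul d (Hm x n) (R s x)) n j * V x j)"
        by (simp add: mmul_def sum_distrib_left sum_distrib_right mult_ac)
      finally show "(\<Sum>m<d. R s x n m * (\<Sum>l<d. \<Sum>j<d. Hm x n m l * R s x l j * V x j)) =
          (\<Sum>j<d. mmul d (R s x) (mmul d (Hm x n) (R s x)) n j * V x j)" .
    qed
    finally show ?thesis .
  qed
  \<comment> \<open>In matrix form (I - sA) w = V, because w = R V.\<close>
  have 2: "(\<Sum>l<d. (of_bool (i = l) - s * A x i l) * w s x l) = V x i" if i: "i < d" for i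
  proof -
    have "(\<Sum>l<d. (of_bool (i = l) - s * A x i l) * w s x l) =
        (\<Sum>l<d. \<Sum>j<d. (of_bool (i = l) - s * A x i l) * R s x l j * V x j)"
      by (simp add: w_def sum_distrib_left mult_ac)
    also have "\<dots> = (\<Sum>j<d. (\<Sum>l<d. (of_bool (i = l) - s * A x i l) * R s x l j) * V x j)"
      by (subst sum.swap) (simp add: sum_distrib_right)
    also have "\<dots> = (\<Sum>j<d. of_bool (i = j) * V x j)"
    proof (intro sum.cong refl)
      fix j assume "j \<in> {..<d}"
      then have j: "j < d" by simp
      have "(\<Sum>l<d. (of_bool (i = l) - s * A x i l) * R s x l j) = R s x i j - s * (\<Sum>l<d. A x i l * R s x l j)"
        using sum_mult_of_bool(2)[OF i, of "\<lambda>l. R s x l j"]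
        by (simp add: left_diff_distrib sum_subtractf sum_distrib_left mult.assoc)
      also have "\<dots> = of_bool (i = j)" using R_left[OF i j] by simp
      finally show "(\<Sum>l<d. (of_bool (i = l) - s * A x i l) * R s x l j) * V x j = of_bool (i = j) * V x j" by simp
    qed
    also have "\<dots> = V x i" by (rule sum_mult_of_bool(2)[OF i])
    finally show ?thesis .
  qed
  have 3: "(\<Sum>l<d. (\<Sum>i<d. T s x i * (of_bool (i = l) - s * A x i l)) * w s x l) = (\<Sum>i<d. T s x i * V x i)"
  proof -
    have "(\<Sum>l<d. (\<Sum>i<d. T s x i * (of_bool (i = l) - s * A x i l)) * w s x l) =
      (\<Sum>i<d. T s x i * (\<Sum>l<d. (of_bool (i = l) - s * A x i l) * w s x l))"
      by (simp add: sum_distrib_right, subst sum.swap) (simp add: sum_distrib_left mult.assoc)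
    then show ?thesis using 2 by simp
  qed
  have 4: "(\<Sum>l<d. \<Sum>j<d. R s x l j * A x j l) = mtrace d (mmul d (A x) (R s x))"
    by (subst mtrace_commute) (simp add: mtrace_def mmul_def)
  define a where "a l = mtrace d (mmul d (Hm x l) (R s x)) * w s x l" for l
  define b where "b l = (\<Sum>i<d. T s x i * (of_bool (i = l) - s * A x i l)) * w s x l" for l
  define e where "e l = (\<Sum>j<d. mmul d (R s x) (mmul d (Hm x l) (R s x)) l j * V x j)" for l
  define g where "g l = (\<Sum>j<d. R s x l j * A x j l)" for l
  have "q' l s x = \<phi> s x * (- s * a l - b l + s * e l + g l)" for l
    by (simp add: q'_def a_def b_def e_def g_def sum.distrib sum_distrib_left algebra_simps)
  then have "(\<Sum>l<d. q' l s x) = \<phi> s x * (\<Sum>l<d. - s * a l - b l + s * e l + g l)"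
    by (simp only: sum_distrib_left)
  also have "(\<Sum>l<d. - s * a l - b l + s * e l + g l) =
      - s * (\<Sum>l<d. a l) - (\<Sum>l<d. b l) + s * (\<Sum>l<d. e l) + (\<Sum>l<d. g l)"
    by (simp add: sum.distrib sum_subtractf sum_negf sum_distrib_left)
  finally have "(\<Sum>l<d. q' l s x) =
      \<phi> s x * (- s * (\<Sum>l<d. a l) - (\<Sum>l<d. b l) + s * (\<Sum>l<d. e l) + (\<Sum>l<d. g l))" .
  then show ?thesis using 1 3 4 by (simp add: a_def b_def e_def g_def p_def algebra_simps)
qed


section \<open>Gaussian domination, uniform in the scale\<close>

text \<open>Polynomial growth in \<open>x\<close> with one constant for all admissible
  \<open>s\<close>, so that a single function dominates the whole family when differentiating in
  \<open>s\<close>.\<close>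

definition growth :: "nat \<Rightarrow> (real \<Rightarrow> (nat \<Rightarrow> real) \<Rightarrow> real) \<Rightarrow> bool" where
  "growth n g \<longleftrightarrow> (\<exists>C\<ge>0. \<forall>s x. \<bar>s\<bar> * L \<le> 1 / 2 \<longrightarrow> x \<in> Rd d \<longrightarrow>
     \<bar>g s x\<bar> \<le> C * (1 + euclidean_norm d x) ^ n)"

lemma growthI:
  assumes "\<And>s x. \<bar>s\<bar> * L \<le> 1 / 2 \<Longrightarrow> x \<in> Rd d \<Longrightarrow> \<bar>g s x\<bar> \<le> C * (1 + euclidean_norm d x) ^ n"
  shows "growth n g"
  unfolding growth_def
proof (intro exI[of _ "max 0 C"] conjI allI impI)
  fix s x assume "\<bar>s\<bar> * L \<le> 1 / 2" "x \<in> Rd d"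
  then have "\<bar>g s x\<bar> \<le> C * (1 + euclidean_norm d x) ^ n" by (rule assms)
  also have "\<dots> \<le> max 0 C * (1 + euclidean_norm d x) ^ n" by (intro mult_right_mono) auto
  finally show "\<bar>g s x\<bar> \<le> max 0 C * (1 + euclidean_norm d x) ^ n" .
qed simp

lemma growth_mono:
  assumes "growth m g" "m \<le> n" shows "growth n g"
proof -
  from assms(1) obtain C where C: "C \<ge> 0" "\<And>s x. \<bar>s\<bar> * L \<le> 1 / 2 \<Longrightarrow> x \<in> Rd d \<Longrightarrow>
     \<bar>g s x\<bar> \<le> C * (1 + euclidean_norm d x) ^ m" unfolding growth_def by blast
  show ?thesis
  proof (rule growthI)
    fix s x assume "\<bar>s\<bar> * L \<le> 1 / 2" "x \<in> Rd d"
    then have "\<bar>g s x\<bar> \<le> C * (1 + euclidean_norm d x) ^ m" by (rule C)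
    also have "\<dots> \<le> C * (1 + euclidean_norm d x) ^ n"
      using assms(2) C(1) by (intro mult_left_mono power_increasing) auto
    finally show "\<bar>g s x\<bar> \<le> C * (1 + euclidean_norm d x) ^ n" .
  qed
qed

lemma growth_add:
  assumes "growth n f" "growth n g" shows "growth n (\<lambda>s x. f s x + g s x)"
proof -
  from assms obtain C D where "\<And>s x. \<bar>s\<bar> * L \<le> 1 / 2 \<Longrightarrow> x \<in> Rd d \<Longrightarrow> \<bar>f s x\<bar> \<le> C * (1 + euclidean_norm d x) ^ n"
    "\<And>s x. \<bar>s\<bar> * L \<le> 1 / 2 \<Longrightarrow> x \<in> Rd d \<Longrightarrow> \<bar>g s x\<bar> \<le> D * (1 + euclidean_norm d x) ^ n"
    unfolding growth_def by blast
  then show ?thesis by (intro growthI[where C="C + D"]) (fastforce simp: distrib_right intro: order.trans[OF abs_triangle_ineq add_mono])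
qed

lemma growth_mult:
  assumes "growth m f" "growth n g" shows "growth (m + n) (\<lambda>s x. f s x * g s x)"
proof -
  from assms obtain C D where C: "C \<ge> 0" "\<And>s x. \<bar>s\<bar> * L \<le> 1 / 2 \<Longrightarrow> x \<in> Rd d \<Longrightarrow> \<bar>f s x\<bar> \<le> C * (1 + euclidean_norm d x) ^ m"
    and D: "\<And>s x. \<bar>s\<bar> * L \<le> 1 / 2 \<Longrightarrow> x \<in> Rd d \<Longrightarrow> \<bar>g s x\<bar> \<le> D * (1 + euclidean_norm d x) ^ n"
    unfolding growth_def by blast
  show ?thesis
  proof (rule growthI)
    fix s x assume sx: "\<bar>s\<bar> * L \<le> 1 / 2" "x \<in> Rd d"
    have "\<bar>f s x * g s x\<bar> \<le> (C * (1 + euclidean_norm d x) ^ m) * (D * (1 + euclidean_norm d x) ^ n)"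
      unfolding abs_mult using C by (intro mult_mono C D sx) auto
    then show "\<bar>f s x * g s x\<bar> \<le> (C * D) * (1 + euclidean_norm d x) ^ (m + n)"
      by (simp add: power_add mult_ac)
  qed
qed

lemma growth_minus: "growth n g \<Longrightarrow> growth n (\<lambda>s x. - g s x)"
  by (simp add: growth_def)

lemma growth_diff: "growth n f \<Longrightarrow> growth n g \<Longrightarrow> growth n (\<lambda>s x. f s x - g s x)"
  using growth_add[of n f "\<lambda>s x. - g s x"] growth_minus by simp

lemma growth_const: "growth 0 (\<lambda>s x. c)"
  by (rule growthI[where C="\<bar>c\<bar>"]) simp

lemma growth_sum:
  fixes m :: nat
  shows "(\<And>i. i < m \<Longrightarrow> growth n (g i)) \<Longrightarrow> growth n (\<lambda>s x. \<Sum>i<m. g i s x)"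
proof (induction m)
  case 0
  then show ?case by (auto intro!: growthI[where C=0])
next
  case (Suc m)
  then show ?case using growth_add[of n "\<lambda>s x. \<Sum>i<m. g i s x" "g m"] by simp
qed

lemma growth_s: "growth 0 (\<lambda>s x. s)"
  using L_pos by (intro growthI[where C="1 / (2 * L)"]) (auto simp: field_simps)

lemma growth_A: "i < d \<Longrightarrow> j < d \<Longrightarrow> growth 0 (\<lambda>s x. A x i j)"
  by (intro growthI[where C=L]) (auto intro: order.trans[OF abs_le_HS_norm HS_A])

lemma growth_H: "i < d \<Longrightarrow> j < d \<Longrightarrow> l < d \<Longrightarrow> growth 0 (\<lambda>s x. Hm x l i j)"
  by (intro growthI[where C=B]) (auto simp: Hm_def H_bound)

lemma growth_R: assumes "i < d" "j < d" shows "growth 0 (\<lambda>s x. R s x i j)"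
proof (rule growthI[where C=2])
  fix s x assume sx: "\<bar>s\<bar> * L \<le> 1 / 2" "x \<in> Rd d"
  have "\<bar>R s x i j\<bar> \<le> 1 / (1 - \<bar>s\<bar> * L)"
    by (rule abs_resolvent[OF sL_lt_1[OF sx(1)] L_nonneg HS_A[OF sx(2)] assms])
  also have "\<dots> \<le> 2" using sx(1) by (simp add: divide_simps)
  finally show "\<bar>R s x i j\<bar> \<le> 2 * (1 + euclidean_norm d x) ^ 0" by simp
qed

lemma zero_Rd: "(\<lambda>i\<in>{..<d}. 0) \<in> Rd d"
  by (simp add: Rd_def)

lemma V_linear_growth:
  assumes "x \<in> Rd d"
  shows "euclidean_norm d (V x) \<le> euclidean_norm d (V (\<lambda>i\<in>{..<d}. 0)) + L * euclidean_norm d x"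
proof -
  let ?o = "\<lambda>i\<in>{..<d}. 0 :: real"
  have "euclidean_norm d (V x) \<le> euclidean_norm d (V ?o) + euclidean_norm d (\<lambda>i. V x i - V ?o i)"
    using euclidean_norm_triangle[of d "V ?o" "\<lambda>i. V x i - V ?o i"] by simp
  moreover have "euclidean_norm d (\<lambda>i. V x i - V ?o i) \<le> L * euclidean_norm d (\<lambda>i. x i - ?o i)"
    by (rule V_lipschitz[OF assms zero_Rd])
  moreover have "euclidean_norm d (\<lambda>i. x i - ?o i) = euclidean_norm d x"
    by (rule euclidean_norm_cong) simp
  ultimately show ?thesis by simp
qed

lemma growth_V: assumes "i < d" shows "growth 1 (\<lambda>s x. V x i)"
proof (rule growthI[where C="euclidean_norm d (V (\<lambda>i\<in>{..<d}. 0)) + L"])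
  fix s x assume sx: "\<bar>s\<bar> * L \<le> 1 / 2" "x \<in> Rd d"
  have "\<bar>V x i\<bar> \<le> euclidean_norm d (V (\<lambda>i\<in>{..<d}. 0)) + L * euclidean_norm d x"
    by (rule order.trans[OF abs_le_euclidean_norm[OF assms] V_linear_growth[OF sx(2)]])
  also have "\<dots> \<le> (euclidean_norm d (V (\<lambda>i\<in>{..<d}. 0)) + L) * (1 + euclidean_norm d x) ^ 1"
    using L_nonneg by (simp add: algebra_simps)
  finally show "\<bar>V x i\<bar> \<le> (euclidean_norm d (V (\<lambda>i\<in>{..<d}. 0)) + L) * (1 + euclidean_norm d x) ^ 1" .
qed

lemma growth_x: assumes "i < d" shows "growth 1 (\<lambda>s x. x i)"
proof (rule growthI[where C=1])
  fix s x show "\<bar>x i\<bar> \<le> 1 * (1 + euclidean_norm d x) ^ 1" using abs_le_euclidean_norm[OF assms, of x] by simp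
qed

lemma growth_T: "i < d \<Longrightarrow> growth 1 (\<lambda>s x. T s x i)"
  unfolding T_def using growth_mult[OF growth_s growth_V] by (intro growth_diff growth_x) auto

lemma growth_w: "l < d \<Longrightarrow> growth 1 (\<lambda>s x. w s x l)"
  unfolding w_def using growth_mult[OF growth_R growth_V] by (intro growth_sum) auto

lemma growth_mtrace_mmul:
  assumes "\<And>i j. i < d \<Longrightarrow> j < d \<Longrightarrow> growth 0 (\<lambda>s x. M s x i j)" "\<And>i j. i < d \<Longrightarrow> j < d \<Longrightarrow> growth 0 (\<lambda>s x. N s x i j)"
  shows "growth 0 (\<lambda>s x. mtrace d (mmul d (M s x) (N s x)))"
  unfolding mtrace_def mmul_def using growth_mult[OF assms] by (intro growth_sum) auto

lemma growth_mmul: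
  assumes "\<And>i j. i < d \<Longrightarrow> j < d \<Longrightarrow> growth 0 (\<lambda>s x. M s x i j)" "\<And>i j. i < d \<Longrightarrow> j < d \<Longrightarrow> growth 0 (\<lambda>s x. N s x i j)"
    "i < d" "j < d"
  shows "growth 0 (\<lambda>s x. mmul d (M s x) (N s x) i j)"
  unfolding mmul_def using growth_mult[OF assms(1,2)] assms(3,4) by (intro growth_sum) auto

text \<open>The common majorant. \<open>\<phi>\<close> decays with rate 1/16; half of that rate is
  given up to absorb polynomial factors.\<close>

definition G :: "(nat \<Rightarrow> real) \<Rightarrow> real" where
  "G x = exp (- (euclidean_norm d x)\<^sup>2 / 32)"

text \<open>Since |s| L <= 1/2 and V grows linearly with slope L, |x|/2 <= |T(x)| + K with K
  independent of \<open>s\<close>. Squaring gives |T|^2/2 >= |x|^2/16 - K^2/2, while the Jacobian is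
  bounded.\<close>

lemma phi_bound:
  obtains C where "\<And>s x. \<bar>s\<bar> * L \<le> 1 / 2 \<Longrightarrow> x \<in> Rd d \<Longrightarrow> \<phi> s x \<le> C * exp (- (euclidean_norm d x)\<^sup>2 / 16)"
proof
  fix s x assume s: "\<bar>s\<bar> * L \<le> 1 / 2" and x: "x \<in> Rd d"
  define K where "K = 1 / (2 * L) * euclidean_norm d (V (\<lambda>i\<in>{..<d}. 0))"
  have s': "\<bar>s\<bar> \<le> 1 / (2 * L)" using s L_pos by (simp add: field_simps)
  have "\<bar>mtrace d (A x)\<bar> \<le> (\<Sum>i<d. \<bar>A x i i\<bar>)" unfolding mtrace_def by (rule sum_abs)
  also have "\<dots> \<le> (\<Sum>i<d. L)" by (intro sum_mono order.trans[OF abs_le_HS_norm HS_A[OF x]]) auto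
  finally have tr: "\<bar>mtrace d (A x)\<bar> \<le> real d * L" by simp
  have "\<bar>s * mtrace d (A x)\<bar> \<le> \<bar>s\<bar> * (real d * L)"
    unfolding abs_mult by (intro mult_left_mono tr) simp
  also have "\<dots> = real d * (\<bar>s\<bar> * L)" by simp
  also have "\<dots> \<le> real d * (1 / 2)" by (intro mult_left_mono s) simp
  finally have "logdet d s (A x) \<le> (s * L)\<^sup>2 + real d / 2"
    using abs_logdet_add_trace_le[OF sL_lt_1[OF s] L_nonneg HS_A[OF x] s] by linarith
  also have "(s * L)\<^sup>2 = (\<bar>s\<bar> * L)\<^sup>2" by (simp add: power_mult_distrib)
  also have "(\<bar>s\<bar> * L)\<^sup>2 \<le> (1 / 2)\<^sup>2" by (intro power_mono s) (use L_nonneg in auto)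
  finally have S: "logdet d s (A x) \<le> 1 + real d" by (simp add: power2_eq_square)
  have "euclidean_norm d x \<le> euclidean_norm d (T s x) + euclidean_norm d (\<lambda>i. s * V x i)"
    using euclidean_norm_triangle[of d "T s x" "\<lambda>i. s * V x i"] by (simp add: T_def)
  also have "euclidean_norm d (\<lambda>i. s * V x i) \<le> \<bar>s\<bar> * (euclidean_norm d (V (\<lambda>i\<in>{..<d}. 0)) + L * euclidean_norm d x)"
    unfolding euclidean_norm_scale by (intro mult_left_mono V_linear_growth[OF x]) simp
  also have "\<dots> = \<bar>s\<bar> * euclidean_norm d (V (\<lambda>i\<in>{..<d}. 0)) + (\<bar>s\<bar> * L) * euclidean_norm d x"
    by (simp add: algebra_simps)
  also have "\<dots> \<le> K + 1 / 2 * euclidean_norm d x"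
    unfolding K_def by (intro add_mono mult_right_mono s s') auto
  finally have 1: "euclidean_norm d x / 2 \<le> euclidean_norm d (T s x) + K" by simp
  have "(euclidean_norm d x / 2)\<^sup>2 \<le> (euclidean_norm d (T s x) + K)\<^sup>2"
    using 1 by (rule power_mono) simp
  also have "\<dots> \<le> 2 * (euclidean_norm d (T s x))\<^sup>2 + 2 * K\<^sup>2"
    using sum_squares_bound[of "euclidean_norm d (T s x)" K] by (simp add: power2_sum)
  finally have "- (\<Sum>i<d. (T s x i)\<^sup>2) / 2 \<le> - (euclidean_norm d x)\<^sup>2 / 16 + K\<^sup>2 / 2"
    by (simp add: euclidean_norm_sqr[of d "T s x"] power_divide)
  then have "logdet d s (A x) - (\<Sum>i<d. (T s x i)\<^sup>2) / 2 \<le> (1 + real d + K\<^sup>2 / 2) + - (euclidean_norm d x)\<^sup>2 / 16"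
    using S by linarith
  then show "\<phi> s x \<le> exp (1 + real d + (1 / (2 * L) * euclidean_norm d (V (\<lambda>i\<in>{..<d}. 0)))\<^sup>2 / 2) *
      exp (- (euclidean_norm d x)\<^sup>2 / 16)"
    unfolding \<phi>_def exp_add[symmetric] K_def by simp
qed

text \<open>A quadratic factor costs exp(|x|^2/32), which turns the rate 1/16 into 1/32. Degree 2 is
  the highest that occurs, in \<open>q'\<close>.\<close>

lemma phi_growth_bound:
  assumes "growth 2 g"
  obtains C where "\<And>s x. \<bar>s\<bar> * L \<le> 1 / 2 \<Longrightarrow> x \<in> Rd d \<Longrightarrow> \<bar>\<phi> s x * g s x\<bar> \<le> C * G x"
proof -
  obtain C where C: "\<And>s x. \<bar>s\<bar> * L \<le> 1 / 2 \<Longrightarrow> x \<in> Rd d \<Longrightarrow> \<phi> s x \<le> C * exp (- (euclidean_norm d x)\<^sup>2 / 16)"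
    using phi_bound by blast
  obtain D where D: "D \<ge> 0" "\<And>s x. \<bar>s\<bar> * L \<le> 1 / 2 \<Longrightarrow> x \<in> Rd d \<Longrightarrow> \<bar>g s x\<bar> \<le> D * (1 + euclidean_norm d x) ^ 2"
    using assms unfolding growth_def by blast
  show ?thesis
  proof
    fix s x assume sx: "\<bar>s\<bar> * L \<le> 1 / 2" "x \<in> Rd d"
    define y where "y = euclidean_norm d x"
    have phi: "0 \<le> \<phi> s x" by (simp add: \<phi>_def)
    then have C0: "0 \<le> C * exp (- y\<^sup>2 / 16)" using C[OF sx] unfolding y_def by linarith
    then have "0 \<le> C" by (simp add: zero_le_mult_iff)
    have "(1 + y)\<^sup>2 \<le> 2 + 2 * y\<^sup>2" using sum_squares_bound[of 1 y] by (simp add: power2_sum)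
    also have "\<dots> \<le> 64 * (1 + y\<^sup>2 / 32)" by simp
    also have "\<dots> \<le> 64 * exp (y\<^sup>2 / 32)" by (intro mult_left_mono exp_ge_add_one_self) simp
    finally have y: "(1 + y)\<^sup>2 \<le> 64 * exp (y\<^sup>2 / 32)" .
    have "\<bar>\<phi> s x * g s x\<bar> \<le> (C * exp (- y\<^sup>2 / 16)) * (D * (1 + y)\<^sup>2)"
      unfolding abs_mult y_def using C0 unfolding y_def
      by (intro mult_mono) (use phi C[OF sx] D(2)[OF sx] in auto)
    also have "\<dots> \<le> (C * exp (- y\<^sup>2 / 16)) * (D * (64 * exp (y\<^sup>2 / 32)))"
      by (intro mult_left_mono y D C0)
    also have "\<dots> = (64 * C * D) * (exp (- y\<^sup>2 / 16) * exp (y\<^sup>2 / 32))" by simp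
    also have "exp (- y\<^sup>2 / 16) * exp (y\<^sup>2 / 32) = G x"
      unfolding exp_add[symmetric] G_def y_def by simp
    finally show "\<bar>\<phi> s x * g s x\<bar> \<le> (64 * C * D) * G x" .
  qed
qed

lemma G_eq: "G x = (\<Prod>i<d. exp (- (x i)\<^sup>2 / 32))"
  unfolding G_def euclidean_norm_sqr by (simp add: exp_sum[symmetric] sum_divide_distrib sum_negf)

lemma integrable_G: "integrable (lebesgue_Rd d) G"
proof -
  \<comment> \<open>Up to normalisation, exp(-t^2/32) is the normal density with standard deviation
    4.\<close>
  have "integrable lborel (\<lambda>t. sqrt (2 * pi * 4\<^sup>2) * normal_density 0 4 t)"
    by (intro integrable_mult_right integrable_normal_density) simp
  then have "integrable lborel (\<lambda>t::real. exp (- t\<^sup>2 / 32))"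
    by (simp add: normal_density_def)
  then show ?thesis
    unfolding lebesgue_Rd_def G_eq[abs_def]
    by (intro lborel_product.product_integrable_prod) auto
qed

lemma G_tendsto_0:
  assumes "l < d"
  shows "((\<lambda>t. G (x(l := t))) \<longlongrightarrow> 0) at_top" "((\<lambda>t. G (x(l := t))) \<longlongrightarrow> 0) at_bot"
proof -
  have lim: "((\<lambda>t::real. exp (- t\<^sup>2 / 32)) \<longlongrightarrow> 0) at_top" "((\<lambda>t::real. exp (- t\<^sup>2 / 32)) \<longlongrightarrow> 0) at_bot"
    by real_asymp+
  have bd: "norm (G (x(l := t))) \<le> exp (- t\<^sup>2 / 32)" for t
    using power_mono[OF abs_le_euclidean_norm[OF assms, of "x(l := t)"], of 2] by (simp add: G_def)
  show "((\<lambda>t. G (x(l := t))) \<longlongrightarrow> 0) at_top"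
    by (rule Lim_null_comparison[OF always_eventually lim(1)]) (use bd in blast)
  show "((\<lambda>t. G (x(l := t))) \<longlongrightarrow> 0) at_bot"
    by (rule Lim_null_comparison[OF always_eventually lim(2)]) (use bd in blast)
qed

lemma mpow_meas [measurable]:
  "i < d \<Longrightarrow> j < d \<Longrightarrow> (\<lambda>x. mpow d (A x) k i j) \<in> borel_measurable (lebesgue_Rd d)"
proof (induction k arbitrary: i j)
  case (Suc k)
  then show ?case by (auto simp: mmul_def intro!: borel_measurable_sum borel_measurable_times A_meas)
qed simp

lemma R_meas [measurable]: "i < d \<Longrightarrow> j < d \<Longrightarrow> (\<lambda>x. R s x i j) \<in> borel_measurable (lebesgue_Rd d)"
  unfolding resolvent_def by (intro borel_measurable_suminf borel_measurable_times mpow_meas) auto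

lemma mtrace_mmul_meas:
  assumes "\<And>i j. i < d \<Longrightarrow> j < d \<Longrightarrow> (\<lambda>x. M x i j) \<in> borel_measurable N" "\<And>i j. i < d \<Longrightarrow> j < d \<Longrightarrow> (\<lambda>x. M' x i j) \<in> borel_measurable N"
  shows "(\<lambda>x. mtrace d (mmul d (M x) (M' x))) \<in> borel_measurable N"
  unfolding mtrace_def mmul_def using assms by (intro borel_measurable_sum borel_measurable_times) auto

lemma phi_meas [measurable]: "\<phi> s \<in> borel_measurable (lebesgue_Rd d)"
proof -
  have "(\<lambda>x. logdet d s (A x)) \<in> borel_measurable (lebesgue_Rd d)"
    unfolding logdet_def mtrace_def
    by (intro borel_measurable_uminus borel_measurable_suminf borel_measurable_divide borel_measurable_times
        borel_measurable_sum mpow_meas) auto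
  moreover have "(\<lambda>x. (\<Sum>i<d. (T s x i)\<^sup>2) / 2) \<in> borel_measurable (lebesgue_Rd d)"
    unfolding T_def by (intro borel_measurable_sum borel_measurable_divide borel_measurable_power
       borel_measurable_diff borel_measurable_times measurable_coord V_meas) auto
  ultimately show ?thesis
    unfolding \<phi>_def[abs_def] by (intro measurable_compose[OF _ borel_measurable_exp] borel_measurable_diff)
qed

lemma q'_meas: assumes l: "l < d" shows "q' l s \<in> borel_measurable (lebesgue_Rd d)"
proof -
  have Hm[measurable]: "(\<lambda>x. Hm x l i j) \<in> borel_measurable (lebesgue_Rd d)" if "i < d" "j < d" for i j
    unfolding Hm_def using that l by (rule H_meas)
  have 1: "(\<lambda>x. mtrace d (mmul d (Hm x l) (R s x))) \<in> borel_measurable (lebesgue_Rd d)"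
    by (intro mtrace_mmul_meas Hm R_meas)
  have 2: "(\<lambda>x. mmul d (R s x) (mmul d (Hm x l) (R s x)) i j) \<in> borel_measurable (lebesgue_Rd d)" if "i < d" "j < d" for i j
    unfolding mmul_def using that by (intro borel_measurable_sum borel_measurable_times Hm R_meas) auto
  show ?thesis
    unfolding q'_def[abs_def] w_def T_def
    by (intro borel_measurable_add borel_measurable_times phi_meas borel_measurable_diff borel_measurable_uminus
        borel_measurable_sum 1 2 R_meas V_meas A_meas measurable_coord borel_measurable_const l) (use l in auto)
qed

text \<open>Degree 2 arises from the product of the two linearly growing factors \<open>T\<close>
  and \<open>w\<close>; resolvent and derivatives of \<open>V\<close> are bounded.\<close>

lemma growth_q': assumes l: "l < d"
  shows "\<exists>g. growth 2 g \<and> (\<forall>s x. q' l s x = \<phi> s x * g s x)"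
proof -
  have "growth 1 (\<lambda>s x. - (s * mtrace d (mmul d (Hm x l) (R s x))) - (\<Sum>i<d. T s x i * (of_bool (i = l) - s * A x i l)))"
  proof (intro growth_diff growth_minus growth_sum)
    show "growth 1 (\<lambda>s x. s * mtrace d (mmul d (Hm x l) (R s x)))"
      using growth_mult[OF growth_s growth_mtrace_mmul[of "\<lambda>s x. Hm x l" "\<lambda>s x. R s x"]] growth_R growth_H l
      by (intro growth_mono[where m=0 and n=1]) auto
    fix i assume i: "i < d"
    have "growth 0 (\<lambda>s x. of_bool (i = l) - s * A x i l)"
      using growth_mult[OF growth_s growth_A[OF i l]] by (intro growth_diff growth_const) simp
    from growth_mult[OF growth_T[OF i] this]
    show "growth 1 (\<lambda>s x. T s x i * (of_bool (i = l) - s * A x i l))" by simp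
  qed
  from growth_mult[OF this growth_w[OF l]]
  have 1: "growth 2 (\<lambda>s x. (- (s * mtrace d (mmul d (Hm x l) (R s x))) - (\<Sum>i<d. T s x i * (of_bool (i = l) - s * A x i l))) * w s x l)"
    by (simp add: numeral_2_eq_2)
  have 2: "growth 2 (\<lambda>s x. \<Sum>j<d. s * mmul d (R s x) (mmul d (Hm x l) (R s x)) l j * V x j + R s x l j * A x j l)"
  proof (intro growth_sum growth_add)
    fix j assume j: "j < d"
    have "growth 0 (\<lambda>s x. mmul d (R s x) (mmul d (Hm x l) (R s x)) l j)"
      by (intro growth_mmul growth_R growth_H l j)
    from growth_mono[OF growth_mult[OF growth_mult[OF growth_s this] growth_V[OF j]], of 2]
    show "growth 2 (\<lambda>s x. s * mmul d (R s x) (mmul d (Hm x l) (R s x)) l j * V x j)" by simp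
    from growth_mono[OF growth_mult[OF growth_R[OF l j] growth_A[OF j l]], of 2]
    show "growth 2 (\<lambda>s x. R s x l j * A x j l)" by simp
  qed
  show ?thesis
    by (rule exI, rule conjI[OF growth_add[OF 1 2]]) (simp add: q'_def algebra_simps)
qed

text \<open>The boundary terms vanish because \<open>\<phi> * w\<close> is dominated by a multiple
  of \<open>G\<close>, which tends to 0 along every coordinate line.\<close>

lemma integral_q': assumes l: "l < d" and s: "\<bar>s\<bar> * L \<le> 1 / 2"
  shows "integrable (lebesgue_Rd d) (q' l s)" "(\<integral>x. q' l s x \<partial>lebesgue_Rd d) = 0"
proof -
  obtain g where g: "growth 2 g" "\<And>s x. q' l s x = \<phi> s x * g s x" using growth_q'[OF l] by blast
  obtain C where C: "\<And>s x. \<bar>s\<bar> * L \<le> 1 / 2 \<Longrightarrow> x \<in> Rd d \<Longrightarrow> \<bar>q' l s x\<bar> \<le> C * G x"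
    using phi_growth_bound[OF g(1)] g(2) by metis
  obtain D where D: "\<And>s x. \<bar>s\<bar> * L \<le> 1 / 2 \<Longrightarrow> x \<in> Rd d \<Longrightarrow> \<bar>\<phi> s x * w s x l\<bar> \<le> D * G x"
    using phi_growth_bound[OF growth_mono[OF growth_w[OF l]]] by (metis one_le_numeral)
  show int: "integrable (lebesgue_Rd d) (q' l s)"
    by (rule Bochner_Integration.integrable_bound[OF integrable_mult_right[OF integrable_G, of C]])
      (use C[OF s] q'_meas[OF l] in \<open>auto intro!: AE_I2 intro: order.trans[OF _ abs_ge_self]\<close>)
  show "(\<integral>x. q' l s x \<partial>lebesgue_Rd d) = 0"
  proof (rule integral_partial_derivative_eq_0[OF l int])
    fix x assume x: "x \<in> Rd d"
    show "((\<lambda>t. \<phi> s (x(l := t)) * w s (x(l := t)) l) has_real_derivative q' l s x) (at (x l))"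
      by (rule DERIV_q[OF x s l])
    show "((\<lambda>t. \<phi> s (x(l := t)) * w s (x(l := t)) l) \<longlongrightarrow> 0) at_top"
      by (rule Lim_null_comparison[OF _ tendsto_mult_right_zero[OF G_tendsto_0(1)[OF l, of x], where c=D]])
        (use D[OF s] x l in auto)
    show "((\<lambda>t. \<phi> s (x(l := t)) * w s (x(l := t)) l) \<longlongrightarrow> 0) at_bot"
      by (rule Lim_null_comparison[OF _ tendsto_mult_right_zero[OF G_tendsto_0(2)[OF l, of x], where c=D]])
        (use D[OF s] x l in auto)
  qed
qed

lemma integrable_phi: assumes s: "\<bar>s\<bar> * L \<le> 1 / 2" shows "integrable (lebesgue_Rd d) (\<phi> s)"
proof -
  obtain C where C: "\<And>s x. \<bar>s\<bar> * L \<le> 1 / 2 \<Longrightarrow> x \<in> Rd d \<Longrightarrow> \<bar>\<phi> s x * 1\<bar> \<le> C * G x"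
    using phi_growth_bound[OF growth_mono[OF growth_const[of 1]]] by (metis zero_le)
  show ?thesis
    by (rule Bochner_Integration.integrable_bound[OF integrable_mult_right[OF integrable_G, of C]])
      (use C[OF s] in \<open>auto intro!: AE_I2 intro: order.trans[OF _ abs_ge_self]\<close>)
qed

text \<open>By Piola's identity the derivative of the mass is minus a sum of integrals of partial
  derivatives, hence 0. The inequality on \<open>s\<close> is strict because constancy is derived on
  the open interval of radius 1/(2L) around 0.\<close>

lemma integral_phi:
  assumes s: "\<bar>s\<bar> * L < 1 / 2"
  shows "(\<integral>x. \<phi> s x \<partial>lebesgue_Rd d) = (\<integral>x. exp (- (euclidean_norm d x)\<^sup>2 / 2) \<partial>lebesgue_Rd d)"
proof -
  define r where "r = 1 / (2 * L)"
  have r: "\<bar>u\<bar> * L \<le> 1 / 2" if "u \<in> {-r<..<r}" for u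
    using that L_pos by (cases "0 \<le> u") (auto simp: r_def field_simps)
  have sum_q: "p u x = - (\<Sum>l<d. q' l u x)" if "u \<in> {-r<..<r}" "x \<in> Rd d" for u x
    using sum_q'[OF that(2) r[OF that(1)]] by simp
  obtain g where g: "\<And>l. l < d \<Longrightarrow> growth 2 (g l)" "\<And>l s x. l < d \<Longrightarrow> q' l s x = \<phi> s x * g l s x"
    using growth_q' by metis
  obtain C where C: "\<And>s x. \<bar>s\<bar> * L \<le> 1 / 2 \<Longrightarrow> x \<in> Rd d \<Longrightarrow> \<bar>\<phi> s x * (\<Sum>l<d. g l s x)\<bar> \<le> C * G x"
    using phi_growth_bound[OF growth_sum[of d 2 g]] g(1) by metis
  have "((\<lambda>u. \<integral>x. \<phi> u x \<partial>lebesgue_Rd d) has_real_derivative 0) (at u within {-r<..<r})" if u: "u \<in> {-r<..<r}" for u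
  proof -
    have "((\<lambda>u. \<integral>x. \<phi> u x \<partial>lebesgue_Rd d) has_real_derivative (\<integral>x. - (\<Sum>l<d. q' l u x) \<partial>lebesgue_Rd d)) (at u)"
    proof (rule DERIV_integral_dominated[OF u, where D="\<lambda>x. C * G x"])
      show "integrable (lebesgue_Rd d) (\<phi> u)" if "u \<in> {-r<..<r}" for u by (rule integrable_phi[OF r[OF that]])
      show "((\<lambda>u. \<phi> u x) has_real_derivative - (\<Sum>l<d. q' l u x)) (at u)"
        if "u \<in> {-r<..<r}" "x \<in> space (lebesgue_Rd d)" for u x
        using DERIV_phi[of x u] r that sum_q[of u x] by simp
      show "\<bar>- (\<Sum>l<d. q' l u x)\<bar> \<le> C * G x" if "u \<in> {-r<..<r}" "x \<in> space (lebesgue_Rd d)" for u x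
        using C[of u x] r that by (simp add: g(2) sum_distrib_left)
    qed (use integrable_G q'_meas in auto)
    also have "(\<integral>x. - (\<Sum>l<d. q' l u x) \<partial>lebesgue_Rd d) = 0"
      using integral_q' r[OF u] by (simp add: Bochner_Integration.integral_sum)
    finally show ?thesis by (rule has_field_derivative_at_within)
  qed
  then obtain c where c: "\<And>u. u \<in> {-r<..<r} \<Longrightarrow> (\<integral>x. \<phi> u x \<partial>lebesgue_Rd d) = c"
    using has_field_derivative_zero_constant[of "{-r<..<r}" "\<lambda>u. \<integral>x. \<phi> u x \<partial>lebesgue_Rd d"] by auto
  have "\<bar>s\<bar> < r" using s L_pos by (simp add: r_def field_simps)
  then have "s \<in> {-r<..<r}" by auto
  moreover have "0 \<in> {-r<..<r}" using L_pos by (simp add: r_def)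
  moreover have "\<phi> 0 x = exp (- (euclidean_norm d x)\<^sup>2 / 2)" for x
    by (simp add: \<phi>_def logdet_def T_def euclidean_norm_sqr)
  ultimately show ?thesis using c by (metis (no_types, lifting) Bochner_Integration.integral_cong)
qed

end

subsection \<open>Gaussian integrals\<close>

definition std_gauss :: "real measure" where
  "std_gauss = density lborel (\<lambda>x. ennreal (std_normal_density x))"

lemma gaussian_def': "gaussian d = Pi\<^sub>M {..<d} (\<lambda>_. std_gauss)"
  by (simp add: gaussian_def std_gauss_def)

lemma sets_std_gauss [simp, measurable_cong]: "sets std_gauss = sets borel"
  by (simp add: std_gauss_def)

lemma space_std_gauss [simp]: "space std_gauss = UNIV"
  by (simp add: std_gauss_def)

lemma prob_space_std_gauss: "prob_space std_gauss"
  unfolding std_gauss_def by (rule prob_space_normal_density) simp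

interpretation std_gauss: prob_space std_gauss by (rule prob_space_std_gauss)

interpretation gauss_product: product_sigma_finite "\<lambda>_::nat. std_gauss"
  by standard

lemma prob_space_gaussian: "prob_space (gaussian d)"
  unfolding gaussian_def' by (rule prob_space_PiM) (rule prob_space_std_gauss)

lemma nn_integral_std_gauss:
  assumes [measurable]: "f \<in> borel_measurable borel"
  shows "(\<integral>\<^sup>+x. f x \<partial>std_gauss) = (\<integral>\<^sup>+x. ennreal (std_normal_density x) * f x \<partial>lborel)"
  unfolding std_gauss_def by (rule nn_integral_density) auto

lemma nn_integral_std_gauss_exp: "(\<integral>\<^sup>+x. ennreal (exp (t * x)) \<partial>std_gauss) = ennreal (exp (t\<^sup>2 / 2))"
proof -
  have "std_normal_density x * exp (t * x) = exp (t\<^sup>2 / 2) * normal_density t 1 x" for x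
    by (simp add: normal_density_def exp_add[symmetric] power2_eq_square) (simp add: field_simps)
  then have "(\<integral>\<^sup>+x. ennreal (exp (t * x)) \<partial>std_gauss) = (\<integral>\<^sup>+x. ennreal (exp (t\<^sup>2 / 2)) * ennreal (normal_density t 1 x) \<partial>lborel)"
    by (simp add: nn_integral_std_gauss ennreal_mult'[symmetric])
  also have "\<dots> = ennreal (exp (t\<^sup>2 / 2)) * (\<integral>\<^sup>+x. ennreal (normal_density t 1 x) \<partial>lborel)"
    by (rule nn_integral_cmult) simp
  also have "(\<integral>\<^sup>+x. ennreal (normal_density t 1 x) \<partial>lborel) = 1"
    by (subst nn_integral_eq_integral) (auto simp: integrable_normal_density)
  finally show ?thesis by simp
qed

text \<open>For a <= 1/4 the weighted density is at most sqrt 2 times the normal density of variance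
  2. This is the origin of both the threshold 1/4 and the bound sqrt 2.\<close>

lemma nn_integral_std_gauss_exp_sqr:
  assumes "a \<le> 1 / 4"
  shows "(\<integral>\<^sup>+x. ennreal (exp (a * x\<^sup>2)) \<partial>std_gauss) \<le> ennreal (sqrt 2)"
proof -
  have "std_normal_density x * exp (a * x\<^sup>2) \<le> sqrt 2 * normal_density 0 (sqrt 2) x" for x
  proof -
    have "a * x\<^sup>2 \<le> 1 / 4 * x\<^sup>2" using assms by (rule mult_right_mono) simp
    then have "exp (- x\<^sup>2 / 2) * exp (a * x\<^sup>2) \<le> exp (- x\<^sup>2 / 4)"
      unfolding exp_add[symmetric] by simp
    then have "exp (- x\<^sup>2 / 2) * exp (a * x\<^sup>2) / sqrt (2 * pi) \<le> exp (- x\<^sup>2 / 4) / sqrt (2 * pi)"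
      by (rule divide_right_mono) simp
    also have "\<dots> = sqrt 2 * normal_density 0 (sqrt 2) x"
      by (simp add: normal_density_def real_sqrt_mult field_simps)
    finally show ?thesis by (simp add: normal_density_def)
  qed
  then have "(\<integral>\<^sup>+x. ennreal (exp (a * x\<^sup>2)) \<partial>std_gauss) \<le> (\<integral>\<^sup>+x. ennreal (sqrt 2) * ennreal (normal_density 0 (sqrt 2) x) \<partial>lborel)"
    by (subst nn_integral_std_gauss, simp) (intro nn_integral_mono, simp add: ennreal_mult'[symmetric] ennreal_leI)
  also have "\<dots> = ennreal (sqrt 2) * (\<integral>\<^sup>+x. ennreal (normal_density 0 (sqrt 2) x) \<partial>lborel)"
    by (rule nn_integral_cmult) simp
  also have "(\<integral>\<^sup>+x. ennreal (normal_density 0 (sqrt 2) x) \<partial>lborel) = 1"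
    by (subst nn_integral_eq_integral) (auto simp: integrable_normal_density)
  finally show ?thesis by simp
qed

lemma measurable_coord_gaussian [measurable]: "i < d \<Longrightarrow> (\<lambda>x. x i) \<in> borel_measurable (gaussian d)"
  by (simp add: measurable_gaussian_iff)

lemma nn_integral_gaussian_exp_linear:
  "(\<integral>\<^sup>+x. ennreal (exp (\<Sum>i<d. b i * x i)) \<partial>gaussian d) = ennreal (exp ((euclidean_norm d b)\<^sup>2 / 2))"
proof -
  have "(\<integral>\<^sup>+x. ennreal (exp (\<Sum>i<d. b i * x i)) \<partial>gaussian d) =
      (\<integral>\<^sup>+x. (\<Prod>i<d. ennreal (exp (b i * x i))) \<partial>gaussian d)"
    by (simp add: exp_sum prod_ennreal)
  also have "\<dots> = (\<Prod>i<d. \<integral>\<^sup>+x. ennreal (exp (b i * x)) \<partial>std_gauss)"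
    unfolding gaussian_def'
    by (rule gauss_product.product_nn_integral_prod)
      (auto intro!: borel_measurable_continuous_onI continuous_intros simp: measurable_cong_sets[OF sets_std_gauss refl])
  also have "\<dots> = ennreal (exp ((euclidean_norm d b)\<^sup>2 / 2))"
    by (simp add: nn_integral_std_gauss_exp prod_ennreal euclidean_norm_sqr sum_divide_distrib flip: exp_sum)
  finally show ?thesis .
qed

text \<open>Linearise the square: $\exp(a r^2) = E \exp(\sqrt{2a}\,r g)$ for a standard Gaussian $g$.\<close>

lemma nn_integral_gaussian_exp_linear_sqr:
  assumes a: "0 \<le> a" "a * (euclidean_norm d b)\<^sup>2 \<le> 1 / 4"
  shows "(\<integral>\<^sup>+x. ennreal (exp (a * (\<Sum>i<d. b i * x i)\<^sup>2)) \<partial>gaussian d) \<le> ennreal (sqrt 2)"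
proof -
  interpret G: prob_space "gaussian d" by (rule prob_space_gaussian)
  interpret P: pair_sigma_finite std_gauss "gaussian d" ..
  have "(\<integral>\<^sup>+x. ennreal (exp (a * (\<Sum>i<d. b i * x i)\<^sup>2)) \<partial>gaussian d) =
      (\<integral>\<^sup>+x. (\<integral>\<^sup>+g. ennreal (exp ((sqrt (2 * a) * (\<Sum>i<d. b i * x i)) * g)) \<partial>std_gauss) \<partial>gaussian d)"
    unfolding nn_integral_std_gauss_exp using a by (simp add: power_mult_distrib)
  also have "\<dots> = (\<integral>\<^sup>+g. (\<integral>\<^sup>+x. ennreal (exp ((sqrt (2 * a) * (\<Sum>i<d. b i * x i)) * g)) \<partial>gaussian d) \<partial>std_gauss)"
    by (rule P.Fubini') measurable
  also have "\<dots> = (\<integral>\<^sup>+g. (\<integral>\<^sup>+x. ennreal (exp (\<Sum>i<d. (g * sqrt (2 * a) * b i) * x i)) \<partial>gaussian d) \<partial>std_gauss)"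
    by (simp add: sum_distrib_left sum_distrib_right mult_ac)
  also have "\<dots> = (\<integral>\<^sup>+g. ennreal (exp ((a * (euclidean_norm d b)\<^sup>2) * g\<^sup>2)) \<partial>std_gauss)"
    unfolding nn_integral_gaussian_exp_linear euclidean_norm_scale
    using a by (simp add: power_mult_distrib mult_ac)
  also have "\<dots> \<le> ennreal (sqrt 2)" by (rule nn_integral_std_gauss_exp_sqr[OF a(2)])
  finally show ?thesis .
qed

text \<open>Jensen's inequality over the rows of \<open>A\<close>, weighted by their squared lengths, reduces the
  matrix case to a single linear form of length \<open>HS_norm d A\<close>.\<close>

lemma nn_integral_gaussian_exp_matrix:
  assumes a: "0 \<le> a" "a * (HS_norm d A)\<^sup>2 \<le> 1 / 4"
  shows "(\<integral>\<^sup>+y. ennreal (exp (a * (euclidean_norm d (\<lambda>i. \<Sum>j<d. A i j * y j))\<^sup>2)) \<partial>gaussian d) \<le> ennreal (sqrt 2)"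
proof (cases "HS_norm d A = 0")
  interpret G: prob_space "gaussian d" by (rule prob_space_gaussian)
  case True
  then have "euclidean_norm d (\<lambda>i. \<Sum>j<d. A i j * y j) = 0" for y
    using euclidean_norm_matrix_vector[of d A y] euclidean_norm_nonneg by (simp add: antisym)
  then show ?thesis using G.emeasure_space_1 by simp
next
  case False
  define h where "h = HS_norm d A"
  have h: "h > 0" using False HS_norm_nonneg[of d A] unfolding h_def by linarith
  define r where "r i = (euclidean_norm d (A i))\<^sup>2 / h\<^sup>2" for i
  have r0: "0 \<le> r i" for i by (simp add: r_def)
  have "h\<^sup>2 = (\<Sum>i<d. (euclidean_norm d (A i))\<^sup>2)" by (simp add: h_def HS_norm_sqr euclidean_norm_sqr)
  then have "(\<Sum>i<d. r i) = h\<^sup>2 / h\<^sup>2" unfolding r_def sum_divide_distrib[symmetric] by (simp only:)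
  then have r1: "(\<Sum>i<d. r i) = 1" using h by simp
  have le: "exp (a * (euclidean_norm d (\<lambda>i. \<Sum>j<d. A i j * y j))\<^sup>2) \<le>
      (\<Sum>i<d. r i * exp (a / r i * (\<Sum>j<d. A i j * y j)\<^sup>2))" for y
  proof -
    \<comment> \<open>For a row of weight 0 the quotient \<open>a / r i\<close> is 0 by convention;
      the equation survives because the linear form of that row vanishes too.\<close>
    have *: "a * (\<Sum>j<d. A i j * y j)\<^sup>2 = r i * (a / r i * (\<Sum>j<d. A i j * y j)\<^sup>2)" if "i < d" for i
    proof (cases "r i = 0")
      case True
      then have "euclidean_norm d (A i) = 0" using h by (simp add: r_def)
      then have "(\<Sum>j<d. A i j * y j) = 0" using abs_sum_mult_le[of "A i" y d] by simp
      then show ?thesis by simp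
    qed simp
    have "exp (a * (euclidean_norm d (\<lambda>i. \<Sum>j<d. A i j * y j))\<^sup>2) =
        exp (\<Sum>i<d. r i *\<^sub>R (a / r i * (\<Sum>j<d. A i j * y j)\<^sup>2))"
      using * by (simp add: euclidean_norm_sqr sum_distrib_left)
    also have "\<dots> \<le> (\<Sum>i<d. r i * exp (a / r i * (\<Sum>j<d. A i j * y j)\<^sup>2))"
      by (rule convex_on_sum[OF _ _ exp_convex]) (use r0 r1 in auto)
    finally show ?thesis .
  qed
  have "(\<integral>\<^sup>+y. ennreal (exp (a * (euclidean_norm d (\<lambda>i. \<Sum>j<d. A i j * y j))\<^sup>2)) \<partial>gaussian d) \<le>
      (\<integral>\<^sup>+y. (\<Sum>i<d. ennreal (r i) * ennreal (exp (a / r i * (\<Sum>j<d. A i j * y j)\<^sup>2))) \<partial>gaussian d)"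
    using le r0 by (intro nn_integral_mono) (simp add: ennreal_mult'[symmetric] sum_ennreal ennreal_leI)
  also have "\<dots> = (\<Sum>i<d. ennreal (r i) * (\<integral>\<^sup>+y. ennreal (exp (a / r i * (\<Sum>j<d. A i j * y j)\<^sup>2)) \<partial>gaussian d))"
    by (subst nn_integral_sum, measurable) (intro sum.cong refl nn_integral_cmult, measurable)
  also have "\<dots> \<le> (\<Sum>i<d. ennreal (r i) * ennreal (sqrt 2))"
  proof (rule sum_mono)
    fix i
    show "ennreal (r i) * (\<integral>\<^sup>+y. ennreal (exp (a / r i * (\<Sum>j<d. A i j * y j)\<^sup>2)) \<partial>gaussian d) \<le> ennreal (r i) * ennreal (sqrt 2)"
    proof (cases "r i = 0")
      case False
      then have "a / r i * (euclidean_norm d (A i))\<^sup>2 = a * h\<^sup>2" by (simp add: r_def)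
      then show ?thesis
        using a r0 h_def by (intro mult_left_mono nn_integral_gaussian_exp_linear_sqr) auto
    qed simp
  qed
  also have "\<dots> = ennreal (\<Sum>i<d. r i) * ennreal (sqrt 2)"
    using r0 by (simp add: sum_ennreal flip: sum_distrib_right)
  finally show ?thesis by (simp add: r1)
qed

text \<open>Jensen's inequality through the tangent line of exp at the mean. The right side is a
  nonnegative integral, so exp of \<open>Z\<close> may fail to be integrable.\<close>

lemma exp_integral_le_nn_integral_exp:
  assumes "prob_space M" and Z: "integrable M Z"
  shows "ennreal (exp (\<integral>x. Z x \<partial>M)) \<le> (\<integral>\<^sup>+x. ennreal (exp (Z x)) \<partial>M)"
proof -
  interpret prob_space M by fact
  define m where "m = (\<integral>x. Z x \<partial>M)"
  have "exp m = (\<integral>x. exp m * (1 + (Z x - m)) \<partial>M)"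
    using Z by (simp add: m_def prob_space)
  also have "ennreal \<dots> \<le> (\<integral>\<^sup>+x. ennreal (exp m * (1 + (Z x - m))) \<partial>M)"
  proof -
    have int: "integrable M (\<lambda>x. exp m * (1 + (Z x - m)))" using Z by simp
    have "(\<integral>x. exp m * (1 + (Z x - m)) \<partial>M) \<le> (\<integral>x. max 0 (exp m * (1 + (Z x - m))) \<partial>M)"
      by (intro integral_mono int integrable_max) auto
    also have "ennreal \<dots> = (\<integral>\<^sup>+x. ennreal (max 0 (exp m * (1 + (Z x - m)))) \<partial>M)"
      by (intro nn_integral_eq_integral[symmetric] integrable_max int) auto
    finally show ?thesis by (simp add: ennreal_max_0 ennreal_leI)
  qed
  also have "\<dots> \<le> (\<integral>\<^sup>+x. ennreal (exp (Z x)) \<partial>M)"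
  proof (intro nn_integral_mono ennreal_leI)
    fix x
    have "exp m * (1 + (Z x - m)) \<le> exp m * exp (Z x - m)" by (intro mult_left_mono exp_ge_add_one_self) simp
    then show "exp m * (1 + (Z x - m)) \<le> exp (Z x)" by (simp add: exp_diff)
  qed
  finally show ?thesis by (simp add: m_def)
qed

subsection \<open>Rotation invariance\<close>

text \<open>Two affine substitutions in one variable each: u = c a + s b for fixed b, then v = (b -
  s u)/c for fixed u. The factors 1/c and c cancel. Division by c is the reason for requiring 0 <
  c.\<close>

lemma nn_integral_lborel_rotate:
  fixes F :: "real \<times> real \<Rightarrow> ennreal"
  assumes [measurable]: "F \<in> borel_measurable (lborel \<Otimes>\<^sub>M lborel)" and c: "0 < c" "c\<^sup>2 + s\<^sup>2 = 1"
  shows "(\<integral>\<^sup>+a. \<integral>\<^sup>+b. F (c * a + s * b, c * b - s * a) \<partial>lborel \<partial>lborel) = (\<integral>\<^sup>+a. \<integral>\<^sup>+b. F (a, b) \<partial>lborel \<partial>lborel)"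
proof -
  have "(\<integral>\<^sup>+a. \<integral>\<^sup>+b. F (c * a + s * b, c * b - s * a) \<partial>lborel \<partial>lborel) =
      (\<integral>\<^sup>+b. \<integral>\<^sup>+a. F (c * a + s * b, c * b - s * a) \<partial>lborel \<partial>lborel)"
    by (rule lborel_pair.Fubini') measurable
  also have "\<dots> = (\<integral>\<^sup>+b. ennreal (1 / c) * (\<integral>\<^sup>+u. F (u, (- s * u + b) / c) \<partial>lborel) \<partial>lborel)"
  proof (rule nn_integral_cong)
    fix b :: real
    have "(\<integral>\<^sup>+a. F (c * a + s * b, c * b - s * a) \<partial>lborel) =
        ennreal \<bar>1 / c\<bar> * (\<integral>\<^sup>+u. F (c * (- s * b / c + 1 / c * u) + s * b, c * b - s * (- s * b / c + 1 / c * u)) \<partial>lborel)"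
      by (rule nn_integral_real_affine) (use c in auto)
    moreover have "(c * (- s * b / c + 1 / c * u) + s * b, c * b - s * (- s * b / c + 1 / c * u)) = (u, (- s * u + b) / c)" for u
    proof -
      have "c * b + s * s * b / c = b / c"
        using c by (simp add: field_simps power2_eq_square) (metis distrib_left mult.commute mult.right_neutral)
      then show ?thesis using c by (simp add: field_simps)
    qed
    ultimately show "(\<integral>\<^sup>+a. F (c * a + s * b, c * b - s * a) \<partial>lborel) = ennreal (1 / c) * (\<integral>\<^sup>+u. F (u, (- s * u + b) / c) \<partial>lborel)"
      using c by simp
  qed
  also have "\<dots> = ennreal (1 / c) * (\<integral>\<^sup>+b. \<integral>\<^sup>+u. F (u, (- s * u + b) / c) \<partial>lborel \<partial>lborel)"
    by (rule nn_integral_cmult) measurable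
  also have "\<dots> = ennreal (1 / c) * (\<integral>\<^sup>+u. \<integral>\<^sup>+b. F (u, (- s * u + b) / c) \<partial>lborel \<partial>lborel)"
    by (subst lborel_pair.Fubini') measurable
  also have "\<dots> = (\<integral>\<^sup>+u. ennreal (1 / c) * (\<integral>\<^sup>+b. F (u, (- s * u + b) / c) \<partial>lborel) \<partial>lborel)"
    by (rule nn_integral_cmult[symmetric]) measurable
  also have "\<dots> = (\<integral>\<^sup>+u. \<integral>\<^sup>+v. F (u, v) \<partial>lborel \<partial>lborel)"
  proof (rule nn_integral_cong)
    fix u :: real
    have "(\<integral>\<^sup>+v. F (u, v) \<partial>lborel) = ennreal \<bar>1 / c\<bar> * (\<integral>\<^sup>+b. F (u, - s * u / c + 1 / c * b) \<partial>lborel)"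
      by (rule nn_integral_real_affine) (use c in auto)
    then show "ennreal (1 / c) * (\<integral>\<^sup>+b. F (u, (- s * u + b) / c) \<partial>lborel) = (\<integral>\<^sup>+v. F (u, v) \<partial>lborel)"
      using c by (simp add: diff_divide_distrib)
  qed
  finally show ?thesis .
qed

text \<open>The product density depends only on a^2 + b^2, so it can be absorbed into the integrand
  of the Lebesgue statement.\<close>

lemma nn_integral_std_gauss_rotate:
  fixes h :: "real \<times> real \<Rightarrow> ennreal"
  assumes [measurable]: "h \<in> borel_measurable (borel \<Otimes>\<^sub>M borel)" and c: "0 < c" "c\<^sup>2 + s\<^sup>2 = 1"
  shows "(\<integral>\<^sup>+a. \<integral>\<^sup>+b. h (c * a + s * b, c * b - s * a) \<partial>std_gauss \<partial>std_gauss) = (\<integral>\<^sup>+a. \<integral>\<^sup>+b. h (a, b) \<partial>std_gauss \<partial>std_gauss)"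
proof -
  have eq: "(\<integral>\<^sup>+a. \<integral>\<^sup>+b. h (c * a + s * b, c * b - s * a) \<partial>std_gauss \<partial>std_gauss) =
      (\<integral>\<^sup>+a. \<integral>\<^sup>+b. ennreal (std_normal_density a * std_normal_density b) * h (c * a + s * b, c * b - s * a) \<partial>lborel \<partial>lborel)" for c s
    by (subst nn_integral_std_gauss, measurable, subst nn_integral_std_gauss, measurable)
      (simp add: ennreal_mult' mult.assoc nn_integral_cmult)
  define F where "F z = ennreal (std_normal_density (fst z) * std_normal_density (snd z)) * h z" for z
  have [measurable]: "F \<in> borel_measurable (lborel \<Otimes>\<^sub>M lborel)" unfolding F_def by measurable
  have rot: "std_normal_density (c * a + s * b) * std_normal_density (c * b - s * a) = std_normal_density a * std_normal_density b" for a b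
  proof -
    have "(c * a + s * b)\<^sup>2 + (c * b - s * a)\<^sup>2 = (c\<^sup>2 + s\<^sup>2) * (a\<^sup>2 + b\<^sup>2)" by algebra
    then have "- (c * a + s * b)\<^sup>2 / 2 + - (c * b - s * a)\<^sup>2 / 2 = - a\<^sup>2 / 2 + - b\<^sup>2 / 2" using c by simp
    then show ?thesis by (simp add: normal_density_def exp_add[symmetric])
  qed
  have "(\<integral>\<^sup>+a. \<integral>\<^sup>+b. h (c * a + s * b, c * b - s * a) \<partial>std_gauss \<partial>std_gauss) =
      (\<integral>\<^sup>+a. \<integral>\<^sup>+b. F (c * a + s * b, c * b - s * a) \<partial>lborel \<partial>lborel)"
    unfolding eq by (simp add: F_def rot)
  also have "\<dots> = (\<integral>\<^sup>+a. \<integral>\<^sup>+b. F (a, b) \<partial>lborel \<partial>lborel)"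
    by (rule nn_integral_lborel_rotate) (use c in auto)
  also have "\<dots> = (\<integral>\<^sup>+a. \<integral>\<^sup>+b. h (a, b) \<partial>std_gauss \<partial>std_gauss)"
    using eq[of 1 0] by (simp add: F_def)
  finally show ?thesis .
qed


text \<open>The integrals over \<open>x\<close> and \<open>y\<close> are nested rather than taken over a product measure, so that
  the coordinates can be rotated one pair at a time.\<close>

lemma nn_integral_PiM_rotate:
  assumes "finite I" and g: "g \<in> borel_measurable (Pi\<^sub>M I (\<lambda>_. std_gauss) \<Otimes>\<^sub>M Pi\<^sub>M I (\<lambda>_. std_gauss))"
    and c: "0 < c" "c\<^sup>2 + s\<^sup>2 = 1"
  shows "(\<integral>\<^sup>+x. \<integral>\<^sup>+y. g (\<lambda>i\<in>I. c * x i + s * y i, \<lambda>i\<in>I. c * y i - s * x i) \<partial>Pi\<^sub>M I (\<lambda>_. std_gauss) \<partial>Pi\<^sub>M I (\<lambda>_::nat. std_gauss))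
       = (\<integral>\<^sup>+x. \<integral>\<^sup>+y. g (x, y) \<partial>Pi\<^sub>M I (\<lambda>_. std_gauss) \<partial>Pi\<^sub>M I (\<lambda>_. std_gauss))"
  using assms(1) g
proof (induction I arbitrary: g)
  case empty
  then show ?case by (simp add: PiM_empty nn_integral_count_space_finite)
next
  case (insert i I)
  define N where "N = (\<lambda>_::nat. std_gauss)"
  note [measurable] = insert.prems[folded N_def]
  have [measurable_cong]: "sets (N i) = sets borel" for i by (simp add: N_def)
  have Ni: "N i = std_gauss" by (simp add: N_def)
  interpret N: product_sigma_finite N unfolding N_def by standard
  interpret NI: finite_product_sigma_finite N I by standard (rule insert)
  interpret P: pair_sigma_finite std_gauss "Pi\<^sub>M I N" ..
  have split: "(\<integral>\<^sup>+x. \<integral>\<^sup>+y. f (x, y) \<partial>Pi\<^sub>M (insert i I) N \<partial>Pi\<^sub>M (insert i I) N) =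
      (\<integral>\<^sup>+x. \<integral>\<^sup>+y. \<integral>\<^sup>+a. \<integral>\<^sup>+b. f (x(i := a), y(i := b)) \<partial>std_gauss \<partial>std_gauss \<partial>Pi\<^sub>M I N \<partial>Pi\<^sub>M I N)"
    if [measurable]: "f \<in> borel_measurable (Pi\<^sub>M (insert i I) N \<Otimes>\<^sub>M Pi\<^sub>M (insert i I) N)" for f
  proof -
    interpret NI': finite_product_sigma_finite N "insert i I" by standard (use insert in simp)
    have "(\<integral>\<^sup>+x. \<integral>\<^sup>+y. f (x, y) \<partial>Pi\<^sub>M (insert i I) N \<partial>Pi\<^sub>M (insert i I) N) =
        (\<integral>\<^sup>+x. \<integral>\<^sup>+a. \<integral>\<^sup>+y. f (x(i := a), y) \<partial>Pi\<^sub>M (insert i I) N \<partial>N i \<partial>Pi\<^sub>M I N)"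
      by (rule N.product_nn_integral_insert) (use insert in \<open>simp, simp, measurable\<close>)
    also have "\<dots> = (\<integral>\<^sup>+x. \<integral>\<^sup>+a. \<integral>\<^sup>+y. \<integral>\<^sup>+b. f (x(i := a), y(i := b)) \<partial>N i \<partial>Pi\<^sub>M I N \<partial>N i \<partial>Pi\<^sub>M I N)"
    proof (intro nn_integral_cong N.product_nn_integral_insert insert)
      fix x a assume "x \<in> space (Pi\<^sub>M I N)" "a \<in> space (N i)"
      then have [measurable]: "x(i := a) \<in> space (Pi\<^sub>M (insert i I) N)"
        by (auto simp: space_PiM PiE_def extensional_def)
      show "(\<lambda>y. f (x(i := a), y)) \<in> borel_measurable (Pi\<^sub>M (insert i I) N)" by measurable
    qed
    also have "\<dots> = (\<integral>\<^sup>+x. \<integral>\<^sup>+y. \<integral>\<^sup>+a. \<integral>\<^sup>+b. f (x(i := a), y(i := b)) \<partial>std_gauss \<partial>std_gauss \<partial>Pi\<^sub>M I N \<partial>Pi\<^sub>M I N)"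
      unfolding Ni
    proof (rule nn_integral_cong)
      fix x assume [measurable]: "x \<in> space (Pi\<^sub>M I N)"
      have [measurable]: "(\<lambda>(a, y). x(i := a)) \<in> std_gauss \<Otimes>\<^sub>M Pi\<^sub>M I N \<rightarrow>\<^sub>M Pi\<^sub>M (insert i I) N" by measurable
      show "(\<integral>\<^sup>+a. \<integral>\<^sup>+y. \<integral>\<^sup>+b. f (x(i := a), y(i := b)) \<partial>std_gauss \<partial>Pi\<^sub>M I N \<partial>std_gauss) =
        (\<integral>\<^sup>+y. \<integral>\<^sup>+a. \<integral>\<^sup>+b. f (x(i := a), y(i := b)) \<partial>std_gauss \<partial>std_gauss \<partial>Pi\<^sub>M I N)"
        by (rule P.Fubini'[symmetric]) measurable
    qed
    finally show ?thesis .
  qed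
  \<comment> \<open>Integrate out the pair of coordinates with index \<open>i\<close>; the induction
    hypothesis is applied to what remains.\<close>
  define g' where "g' z = (\<integral>\<^sup>+a. \<integral>\<^sup>+b. g ((fst z)(i := a), (snd z)(i := b)) \<partial>std_gauss \<partial>std_gauss)" for z
  have [measurable]: "g' \<in> borel_measurable (Pi\<^sub>M I N \<Otimes>\<^sub>M Pi\<^sub>M I N)"
    unfolding g'_def by measurable
  have restr: "(\<lambda>k\<in>insert i I. c * (x(i := a)) k + s * (y(i := b)) k) = (\<lambda>k\<in>I. c * x k + s * y k)(i := c * a + s * b)"
    "(\<lambda>k\<in>insert i I. c * (y(i := b)) k - s * (x(i := a)) k) = (\<lambda>k\<in>I. c * y k - s * x k)(i := c * b - s * a)" for x y a b
    using insert by (auto simp: fun_eq_iff)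
  have "(\<integral>\<^sup>+x. \<integral>\<^sup>+y. g (\<lambda>k\<in>insert i I. c * x k + s * y k, \<lambda>k\<in>insert i I. c * y k - s * x k) \<partial>Pi\<^sub>M (insert i I) N \<partial>Pi\<^sub>M (insert i I) N) =
    (\<integral>\<^sup>+x. \<integral>\<^sup>+y. \<integral>\<^sup>+a. \<integral>\<^sup>+b. g ((\<lambda>k\<in>I. c * x k + s * y k)(i := c * a + s * b), (\<lambda>k\<in>I. c * y k - s * x k)(i := c * b - s * a))
       \<partial>std_gauss \<partial>std_gauss \<partial>Pi\<^sub>M I N \<partial>Pi\<^sub>M I N)"
    using split[of "\<lambda>(x, y). g (\<lambda>k\<in>insert i I. c * x k + s * y k, \<lambda>k\<in>insert i I. c * y k - s * x k)"]
    unfolding prod.case restr by measurable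
  also have "\<dots> = (\<integral>\<^sup>+x. \<integral>\<^sup>+y. g' (\<lambda>k\<in>I. c * x k + s * y k, \<lambda>k\<in>I. c * y k - s * x k) \<partial>Pi\<^sub>M I N \<partial>Pi\<^sub>M I N)"
  proof (intro nn_integral_cong)
    fix x y assume xy: "x \<in> space (Pi\<^sub>M I N)" "y \<in> space (Pi\<^sub>M I N)"
    define x' y' where "x' = (\<lambda>k\<in>I. c * x k + s * y k)" and "y' = (\<lambda>k\<in>I. c * y k - s * x k)"
    have [measurable]: "x' \<in> space (Pi\<^sub>M I N)" "y' \<in> space (Pi\<^sub>M I N)"
      by (auto simp: x'_def y'_def space_PiM N_def)
    show "(\<integral>\<^sup>+a. \<integral>\<^sup>+b. g ((\<lambda>k\<in>I. c * x k + s * y k)(i := c * a + s * b), (\<lambda>k\<in>I. c * y k - s * x k)(i := c * b - s * a))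
       \<partial>std_gauss \<partial>std_gauss) = g' (\<lambda>k\<in>I. c * x k + s * y k, \<lambda>k\<in>I. c * y k - s * x k)"
      unfolding g'_def x'_def[symmetric] y'_def[symmetric] fst_conv snd_conv
      using nn_integral_std_gauss_rotate[of "\<lambda>z. g (x'(i := fst z), y'(i := snd z))" c s] c by simp
  qed
  also have "\<dots> = (\<integral>\<^sup>+x. \<integral>\<^sup>+y. g' (x, y) \<partial>Pi\<^sub>M I N \<partial>Pi\<^sub>M I N)"
    by (rule insert.IH[folded N_def]) measurable
  also have "\<dots> = (\<integral>\<^sup>+x. \<integral>\<^sup>+y. g (x, y) \<partial>Pi\<^sub>M (insert i I) N \<partial>Pi\<^sub>M (insert i I) N)"
    by (subst split) (measurable, simp add: g'_def)
  finally show ?case unfolding N_def .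
qed

lemma nn_integral_gaussian_rotate:
  assumes "g \<in> borel_measurable (gaussian d \<Otimes>\<^sub>M gaussian d)" and c: "0 < c" "c\<^sup>2 + s\<^sup>2 = 1"
  shows "(\<integral>\<^sup>+x. \<integral>\<^sup>+y. g (\<lambda>i\<in>{..<d}. c * x i + s * y i, \<lambda>i\<in>{..<d}. c * y i - s * x i) \<partial>gaussian d \<partial>gaussian d)
       = (\<integral>\<^sup>+x. \<integral>\<^sup>+y. g (x, y) \<partial>gaussian d \<partial>gaussian d)"
  using nn_integral_PiM_rotate[of "{..<d}" g c s] assms unfolding gaussian_def' by simp

subsection \<open>Exponential integrability for smooth fields\<close>

definition gauss_density :: "nat \<Rightarrow> (nat \<Rightarrow> real) \<Rightarrow> real" where
  "gauss_density d x = (\<Prod>i<d. std_normal_density (x i))"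

lemma gauss_density_pos: "0 < gauss_density d x"
  by (simp add: gauss_density_def normal_density_pos prod_pos)

lemma gauss_density_meas [measurable]: "gauss_density d \<in> borel_measurable (lebesgue_Rd d)"
  unfolding gauss_density_def[abs_def]
  by (intro borel_measurable_prod measurable_compose[OF measurable_coord borel_measurable_normal_density]) simp

lemma gauss_density_eq: "gauss_density d x = (1 / sqrt (2 * pi)) ^ d * exp (- (euclidean_norm d x)\<^sup>2 / 2)"
proof -
  have "exp (- (euclidean_norm d x)\<^sup>2 / 2) = (\<Prod>i<d. exp (- (x i)\<^sup>2 / 2))"
    by (simp add: euclidean_norm_sqr exp_sum[symmetric] sum_divide_distrib sum_negf)
  then show ?thesis
    unfolding gauss_density_def normal_density_def by (simp only: prod.distrib) simp
qed

lemma gaussian_eq_density: "gaussian d = density (lebesgue_Rd d) (\<lambda>x. ennreal (gauss_density d x))"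
proof -
  have "density (lebesgue_Rd d) (\<lambda>x. ennreal (gauss_density d x)) = Pi\<^sub>M {..<d} (\<lambda>_. std_gauss)"
  proof (rule gauss_product.PiM_eqI)
    show "sets (density (lebesgue_Rd d) (\<lambda>x. ennreal (gauss_density d x))) = sets (Pi\<^sub>M {..<d} (\<lambda>_. std_gauss))"
      using sets_gaussian[of d] by (simp add: gaussian_def')
    fix A assume A: "\<And>i. i \<in> {..<d} \<Longrightarrow> A i \<in> sets std_gauss"
    then have AE: "Pi\<^sub>E {..<d} A \<in> sets (lebesgue_Rd d)"
      unfolding lebesgue_Rd_def by (intro sets_PiM_I_finite) auto
    have "emeasure (density (lebesgue_Rd d) (\<lambda>x. ennreal (gauss_density d x))) (Pi\<^sub>E {..<d} A) =
        (\<integral>\<^sup>+x. ennreal (gauss_density d x) * indicator (Pi\<^sub>E {..<d} A) x \<partial>lebesgue_Rd d)"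
      by (rule emeasure_density) (use AE in auto)
    also have "\<dots> = (\<integral>\<^sup>+x. (\<Prod>i<d. ennreal (std_normal_density (x i)) * indicator (A i) (x i)) \<partial>lebesgue_Rd d)"
    proof (rule nn_integral_cong)
      fix x assume "x \<in> space (lebesgue_Rd d)"
      then have "indicator (Pi\<^sub>E {..<d} A) x = (\<Prod>i<d. indicator (A i) (x i) :: ennreal)"
        by (auto simp: Rd_def indicator_def PiE_def Pi_def)
      then show "ennreal (gauss_density d x) * indicator (Pi\<^sub>E {..<d} A) x =
          (\<Prod>i<d. ennreal (std_normal_density (x i)) * indicator (A i) (x i))"
        by (simp add: gauss_density_def prod.distrib prod_ennreal)
    qed
    also have "\<dots> = (\<Prod>i<d. \<integral>\<^sup>+x. ennreal (std_normal_density x) * indicator (A i) x \<partial>lborel)"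
      unfolding lebesgue_Rd_def using A by (intro lborel_product.product_nn_integral_prod) auto
    also have "\<dots> = (\<Prod>i<d. emeasure std_gauss (A i))"
      using A by (intro prod.cong refl) (auto simp: std_gauss_def emeasure_density)
    finally show "emeasure (density (lebesgue_Rd d) (\<lambda>x. ennreal (gauss_density d x))) (Pi\<^sub>E {..<d} A) =
        (\<Prod>i<d. emeasure std_gauss (A i))" .
  qed simp
  then show ?thesis by (simp add: gaussian_def')
qed

lemma integrable_gaussian_exp_linear: "integrable (gaussian d) (\<lambda>x. exp (\<Sum>i<d. b i * x i))"
  by (rule integrableI_nonneg)
    (auto simp: nn_integral_gaussian_exp_linear intro!: measurable_compose[OF _ borel_measurable_exp] borel_measurable_sum borel_measurable_times measurable_coord_gaussian)

text \<open>z^2 <= 2 exp |z| <= 2 (exp z + exp(-z)) reduces the second moment to exponentials of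
  linear forms.\<close>

lemma integrable_gaussian_coord_sqr:
  assumes "i < d" shows "integrable (gaussian d) (\<lambda>x. (x i)\<^sup>2)"
proof (rule Bochner_Integration.integrable_bound)
  have eq: "(\<Sum>j<d. (c * of_bool (j = i)) * x j) = c * x i" for c :: real and x
    using assms by (simp add: of_bool_def if_distrib[where f="\<lambda>a. a * _"] if_distrib[where f="\<lambda>a. _ * a"] cong: if_cong)
  show "integrable (gaussian d) (\<lambda>x. 2 * (exp (\<Sum>j<d. (1 * of_bool (j = i)) * x j) + exp (\<Sum>j<d. (-1 * of_bool (j = i)) * x j)))"
    by (intro integrable_mult_right Bochner_Integration.integrable_add integrable_gaussian_exp_linear)
  show "(\<lambda>x. (x i)\<^sup>2) \<in> borel_measurable (gaussian d)"
    using assms by (intro borel_measurable_power measurable_coord_gaussian)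
  show "AE x in gaussian d. norm ((x i)\<^sup>2) \<le> norm (2 * (exp (\<Sum>j<d. (1 * of_bool (j = i)) * x j) + exp (\<Sum>j<d. (-1 * of_bool (j = i)) * x j)))"
  proof (rule AE_I2)
    fix x :: "nat \<Rightarrow> real"
    have "(x i)\<^sup>2 \<le> 2 * exp \<bar>x i\<bar>" using exp_lower_Taylor_quadratic[of "\<bar>x i\<bar>"] by simp
    also have "exp \<bar>x i\<bar> \<le> exp (x i) + exp (- x i)" by (cases "0 \<le> x i") auto
    finally show "norm ((x i)\<^sup>2) \<le> norm (2 * (exp (\<Sum>j<d. (1 * of_bool (j = i)) * x j) + exp (\<Sum>j<d. (-1 * of_bool (j = i)) * x j)))"
      unfolding eq by simp
  qed
qed

lemma (in prob_space) sqr_expectation_le: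
  assumes "integrable M X" "integrable M (\<lambda>x. (X x)\<^sup>2 :: real)"
  shows "(expectation X)\<^sup>2 \<le> expectation (\<lambda>x. (X x)\<^sup>2)"
  using variance_eq[OF assms] variance_positive[of X] by simp

text \<open>Uniform distribution of the rotation angle. As a probability measure it makes the
  integral along the path an average, to which Jensen's inequality applies.\<close>

definition unif :: "real measure" where
  "unif = density lborel (\<lambda>t. ennreal (indicator {0..pi / 2} t * (2 / pi)))"

lemma sets_unif [simp, measurable_cong]: "sets unif = sets borel"
  by (simp add: unif_def)

lemma space_unif [simp]: "space unif = UNIV"
  by (simp add: unif_def)

lemma prob_space_unif: "prob_space unif"
proof
  have "emeasure unif (space unif) = (\<integral>\<^sup>+t. ennreal (2 / pi) * indicator {0..pi / 2} t \<partial>lborel)"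
    unfolding unif_def by (subst emeasure_density) (auto simp: ennreal_mult'' indicator_def intro!: nn_integral_cong)
  also have "\<dots> = 1"
    by (subst nn_integral_cmult_indicator) (auto simp flip: ennreal_mult')
  finally show "emeasure unif (space unif) = 1" .
qed

lemma
  fixes f :: "real \<Rightarrow> real"
  assumes "\<And>t. isCont f t"
  shows integrable_unif: "integrable unif f"
    and integral_unif: "(\<integral>t. f t \<partial>unif) = 2 / pi * integral {0..pi / 2} f"
proof -
  have [measurable]: "f \<in> borel_measurable borel"
    using assms by (intro borel_measurable_continuous_onI) (simp add: continuous_at_imp_continuous_on)
  have int: "set_integrable lborel {0..pi / 2} f"
    using assms by (intro borel_integrable_atLeastAtMost') (simp add: continuous_at_imp_continuous_on)
  have int': "integrable lborel (\<lambda>t. (indicator {0..pi / 2} t * (2 / pi)) * f t)"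
    using integrable_mult_right[OF int[unfolded set_integrable_def], of "2 / pi"] by (simp add: mult_ac)
  then show "integrable unif f"
    unfolding unif_def by (subst integrable_density) auto
  have "(\<integral>t. f t \<partial>unif) = (\<integral>t. (indicator {0..pi / 2} t * (2 / pi)) * f t \<partial>lborel)"
    unfolding unif_def by (subst integral_density) auto
  also have "\<dots> = 2 / pi * (LINT t:{0..pi / 2}|lborel. f t)"
    unfolding set_lebesgue_integral_def by (subst integral_mult_right_zero[symmetric]) (simp add: mult_ac)
  finally show "(\<integral>t. f t \<partial>unif) = 2 / pi * integral {0..pi / 2} f"
    using set_borel_integral_eq_integral(2)[OF int] by simp
qed

text \<open>Rotation invariance was proved only for a positive cosine; this excludes just the
  endpoint pi/2, a null set.\<close>

lemma AE_unif_cos_pos: "AE t in unif. 0 < cos t"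
proof -
  have "AE t in lborel. 0 < ennreal (indicator {0..pi / 2} t * (2 / pi)) \<longrightarrow> 0 < cos t"
    using AE_lborel_singleton[of "pi / 2"]
    by eventually_elim (auto simp: indicator_def intro!: cos_gt_zero_pi split: if_splits)
  then show ?thesis unfolding unif_def by (subst AE_density) auto
qed

context smooth_field
begin

definition divergence :: "(nat \<Rightarrow> real) \<Rightarrow> real" where
  "divergence x = (\<Sum>i<d. x i * V x i) - (\<Sum>i<d. A x i i)"

text \<open>Expanding |x - s V|^2 yields s x.V - s^2 |V|^2/2, and the lower bound on
  \<open>logdet\<close> supplies -s tr A at the cost (sL)^2. So the integrand times the Gaussian
  density is at most exp((sL)^2) times the normalised \<open>\<phi> s\<close>, whose mass is
  1.\<close>

lemma nn_integral_exp_divergence: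
  assumes s: "\<bar>s\<bar> * L < 1 / 2"
  shows "(\<integral>\<^sup>+x. ennreal (exp (s * divergence x - s\<^sup>2 / 2 * (euclidean_norm d (V x))\<^sup>2)) \<partial>gaussian d) \<le> ennreal (exp ((s * L)\<^sup>2))"
proof -
  interpret G: prob_space "gaussian d" by (rule prob_space_gaussian)
  define \<kappa> where "\<kappa> = (1 / sqrt (2 * pi)) ^ d"
  have \<kappa>: "0 \<le> \<kappa>" by (simp add: \<kappa>_def)
  have s': "\<bar>s\<bar> * L \<le> 1 / 2" using s by simp
  have meas: "(\<lambda>x. ennreal (exp (s * divergence x - s\<^sup>2 / 2 * (euclidean_norm d (V x))\<^sup>2))) \<in> borel_measurable (lebesgue_Rd d)"
    unfolding divergence_def euclidean_norm_sqr
    by (intro measurable_compose[OF _ measurable_ennreal] measurable_compose[OF _ borel_measurable_exp]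
       borel_measurable_diff borel_measurable_times borel_measurable_sum borel_measurable_power measurable_coord V_meas A_meas
       borel_measurable_const) auto
  have le: "gauss_density d x * exp (s * divergence x - s\<^sup>2 / 2 * (euclidean_norm d (V x))\<^sup>2) \<le> exp ((s * L)\<^sup>2) * (\<kappa> * \<phi> s x)"
    if x: "x \<in> Rd d" for x
  proof -
    have "(\<Sum>i<d. (T s x i)\<^sup>2) = (euclidean_norm d x)\<^sup>2 - 2 * s * (\<Sum>i<d. x i * V x i) + s\<^sup>2 * (euclidean_norm d (V x))\<^sup>2"
      unfolding euclidean_norm_sqr T_def
      by (simp add: power2_diff sum.distrib sum_subtractf sum_distrib_left power_mult_distrib mult_ac)
    moreover have "- s * (\<Sum>i<d. A x i i) \<le> (s * L)\<^sup>2 + logdet d s (A x)"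
      using abs_logdet_add_trace_le[OF sL_lt_1[OF s'] L_nonneg HS_A[OF x] s'] by (simp add: mtrace_def)
    ultimately have "- (euclidean_norm d x)\<^sup>2 / 2 + (s * divergence x - s\<^sup>2 / 2 * (euclidean_norm d (V x))\<^sup>2) \<le>
        (s * L)\<^sup>2 + (logdet d s (A x) - (\<Sum>i<d. (T s x i)\<^sup>2) / 2)"
      by (simp add: divergence_def right_diff_distrib field_simps)
    then have "exp (- (euclidean_norm d x)\<^sup>2 / 2) * exp (s * divergence x - s\<^sup>2 / 2 * (euclidean_norm d (V x))\<^sup>2) \<le>
        exp ((s * L)\<^sup>2) * \<phi> s x"
      unfolding \<phi>_def exp_add[symmetric] by simp
    then have "\<kappa> * (exp (- (euclidean_norm d x)\<^sup>2 / 2) * exp (s * divergence x - s\<^sup>2 / 2 * (euclidean_norm d (V x))\<^sup>2)) \<le>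
        \<kappa> * (exp ((s * L)\<^sup>2) * \<phi> s x)" by (rule mult_left_mono[OF _ \<kappa>])
    then show ?thesis by (simp add: gauss_density_eq \<kappa>_def mult_ac)
  qed
  have "(\<integral>\<^sup>+x. ennreal (exp (s * divergence x - s\<^sup>2 / 2 * (euclidean_norm d (V x))\<^sup>2)) \<partial>gaussian d) =
      (\<integral>\<^sup>+x. ennreal (gauss_density d x) * ennreal (exp (s * divergence x - s\<^sup>2 / 2 * (euclidean_norm d (V x))\<^sup>2)) \<partial>lebesgue_Rd d)"
    unfolding gaussian_eq_density by (rule nn_integral_density) (use meas in auto)
  also have "\<dots> \<le> (\<integral>\<^sup>+x. ennreal (exp ((s * L)\<^sup>2) * (\<kappa> * \<phi> s x)) \<partial>lebesgue_Rd d)"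
    using le by (intro nn_integral_mono) (simp add: ennreal_mult'[symmetric] gauss_density_pos less_imp_le ennreal_leI)
  also have "\<dots> = ennreal (\<integral>x. exp ((s * L)\<^sup>2) * (\<kappa> * \<phi> s x) \<partial>lebesgue_Rd d)"
    using \<kappa> by (intro nn_integral_eq_integral integrable_mult_right integrable_phi[OF s']) (auto simp: \<phi>_def)
  also have "(\<integral>x. exp ((s * L)\<^sup>2) * (\<kappa> * \<phi> s x) \<partial>lebesgue_Rd d) = exp ((s * L)\<^sup>2) * (\<kappa> * (\<integral>x. exp (- (euclidean_norm d x)\<^sup>2 / 2) \<partial>lebesgue_Rd d))"
    using integral_phi[OF s] by simp
  also have "\<kappa> * (\<integral>x. exp (- (euclidean_norm d x)\<^sup>2 / 2) \<partial>lebesgue_Rd d) = 1"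
  proof -
    have "\<kappa> * (\<integral>x. exp (- (euclidean_norm d x)\<^sup>2 / 2) \<partial>lebesgue_Rd d) = (\<integral>x. gauss_density d x * 1 \<partial>lebesgue_Rd d)"
      by (simp add: gauss_density_eq \<kappa>_def)
    also have "\<dots> = (\<integral>x. 1 \<partial>gaussian d)"
      unfolding gaussian_eq_density by (subst integral_density) (auto simp: gauss_density_pos less_imp_le)
    finally show ?thesis using G.prob_space by simp
  qed
  finally show ?thesis by simp
qed

section \<open>Exponential moments of |V|^2 for a centred field\<close>

lemma integrable_V_sqr: assumes "i < d" shows "integrable (gaussian d) (\<lambda>x. (V x i)\<^sup>2)"
proof -
  define c where "c = euclidean_norm d (V (\<lambda>i\<in>{..<d}. 0))"
  interpret G: prob_space "gaussian d" by (rule prob_space_gaussian)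
  show ?thesis
  proof (rule Bochner_Integration.integrable_bound)
    show "integrable (gaussian d) (\<lambda>x. 2 * c\<^sup>2 + 2 * L\<^sup>2 * (\<Sum>i<d. (x i)\<^sup>2))"
      by (intro Bochner_Integration.integrable_add integrable_mult_right Bochner_Integration.integrable_sum integrable_gaussian_coord_sqr) auto
    show "(\<lambda>x. (V x i)\<^sup>2) \<in> borel_measurable (gaussian d)"
      unfolding measurable_gaussian_iff using V_meas[OF assms] by simp
    show "AE x in gaussian d. norm ((V x i)\<^sup>2) \<le> norm (2 * c\<^sup>2 + 2 * L\<^sup>2 * (\<Sum>i<d. (x i)\<^sup>2))"
    proof (rule AE_I2)
      fix x assume "x \<in> space (gaussian d)"
      then have "\<bar>V x i\<bar> \<le> c + L * euclidean_norm d x"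
        unfolding c_def by (intro order.trans[OF abs_le_euclidean_norm[OF assms] V_linear_growth]) simp
      then have "\<bar>V x i\<bar>\<^sup>2 \<le> (c + L * euclidean_norm d x)\<^sup>2" by (rule power_mono) simp
      also have "\<dots> \<le> 2 * c\<^sup>2 + 2 * (L * euclidean_norm d x)\<^sup>2"
        using sum_squares_bound[of c "L * euclidean_norm d x"] by (simp add: power2_sum)
      finally have "(V x i)\<^sup>2 \<le> 2 * c\<^sup>2 + 2 * L\<^sup>2 * (\<Sum>i<d. (x i)\<^sup>2)" by (simp add: power_mult_distrib euclidean_norm_sqr)
      then show "norm ((V x i)\<^sup>2) \<le> norm (2 * c\<^sup>2 + 2 * L\<^sup>2 * (\<Sum>i<d. (x i)\<^sup>2))" by simp
    qed
  qed
qed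

lemma integrable_V: assumes "i < d" shows "integrable (gaussian d) (\<lambda>x. V x i)"
proof -
  interpret G: prob_space "gaussian d" by (rule prob_space_gaussian)
  show ?thesis
    by (rule G.square_integrable_imp_integrable[OF _ integrable_V_sqr[OF assms]])
      (use V_meas[OF assms] in \<open>simp add: measurable_gaussian_iff\<close>)
qed

definition rot :: "real \<Rightarrow> (nat \<Rightarrow> real) \<Rightarrow> (nat \<Rightarrow> real) \<Rightarrow> nat \<Rightarrow> real" where
  "rot t x y = (\<lambda>i\<in>{..<d}. cos t * x i + sin t * y i)"

text \<open>The derivative of \<open>rot\<close> in the angle. For each fixed angle the map from (x,
  y) to (rot, rot') is again a rotation, so for independent Gaussian x, y the velocity is a Gaussian
  vector independent of the position.\<close>

definition rot' :: "real \<Rightarrow> (nat \<Rightarrow> real) \<Rightarrow> (nat \<Rightarrow> real) \<Rightarrow> nat \<Rightarrow> real" where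
  "rot' t x y = (\<lambda>i\<in>{..<d}. cos t * y i - sin t * x i)"

definition AV :: "(nat \<Rightarrow> real) \<Rightarrow> (nat \<Rightarrow> real) \<Rightarrow> nat \<Rightarrow> real" where
  "AV x y i = (\<Sum>j<d. A x i j * y j)"

lemma smooth_path_rot: "smooth_path d (\<lambda>t. rot t x y) (\<lambda>t. rot' t x y)"
  by (auto simp: smooth_path_def rot_def rot'_def Rd_def intro!: derivative_eq_intros continuous_intros)

lemma isCont_AV_rot: assumes "i < d" shows "isCont (\<lambda>t. AV (rot t x y) (rot' t x y) i) t"
  unfolding AV_def using DERIV_A[OF smooth_path_rot assms, of _ x y t]
  by (intro continuous_sum continuous_mult) (auto simp: rot'_def intro: DERIV_isCont continuous_intros)

text \<open>V y - V x is the integral of the derivative along the quarter circle from x to y, that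
  is pi/2 times an average over \<open>unif\<close>. Jensen's inequality is used twice, first for
  the square of each component and then for exp.\<close>

lemma exp_increment_le:
  assumes a: "0 \<le> a" and xy: "x \<in> Rd d" "y \<in> Rd d"
  shows "ennreal (exp (a * (euclidean_norm d (\<lambda>i. V y i - V x i))\<^sup>2)) \<le>
    (\<integral>\<^sup>+t. ennreal (exp (a * (pi / 2)\<^sup>2 * (euclidean_norm d (AV (rot t x y) (rot' t x y)))\<^sup>2)) \<partial>unif)"
proof -
  interpret U: prob_space unif by (rule prob_space_unif)
  define f where "f i t = AV (rot t x y) (rot' t x y) i" for i t
  have cf: "isCont (f i) t" if "i < d" for i t unfolding f_def by (rule isCont_AV_rot[OF that])
  have r0: "rot 0 x y = x" "rot (pi / 2) x y = y"
    using xy by (auto simp: rot_def Rd_def PiE_def extensional_def fun_eq_iff)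
  have "(f i has_integral V (rot (pi / 2) x y) i - V (rot 0 x y) i) {0..pi / 2}" if i: "i < d" for i
    using DERIV_V[OF smooth_path_rot i, of x y]
    by (intro fundamental_theorem_of_calculus)
      (auto simp: has_real_derivative_iff_has_vector_derivative[symmetric] f_def AV_def intro: has_field_derivative_at_within)
  then have "integral {0..pi / 2} (f i) = V y i - V x i" if "i < d" for i
    using that unfolding r0 by (intro integral_unique) auto
  then have m: "V y i - V x i = (pi / 2) * U.expectation (f i)" if "i < d" for i
    using integral_unif[OF cf] that by (simp add: field_simps)
  have if1: "integrable unif (f i)" "integrable unif (\<lambda>t. (f i t)\<^sup>2)" if "i < d" for i
    using cf[OF that] by (auto intro!: integrable_unif continuous_intros)
  have "(euclidean_norm d (\<lambda>i. V y i - V x i))\<^sup>2 = (\<Sum>i<d. (pi / 2)\<^sup>2 * (U.expectation (f i))\<^sup>2)"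
    unfolding euclidean_norm_sqr by (intro sum.cong refl) (simp only: lessThan_iff m power_mult_distrib)
  also have "\<dots> \<le> (\<Sum>i<d. (pi / 2)\<^sup>2 * U.expectation (\<lambda>t. (f i t)\<^sup>2))"
    using U.sqr_expectation_le[OF if1] by (intro sum_mono mult_left_mono) auto
  also have "\<dots> = (pi / 2)\<^sup>2 * U.expectation (\<lambda>t. \<Sum>i<d. (f i t)\<^sup>2)"
    using if1 by (simp add: Bochner_Integration.integral_sum sum_distrib_left)
  finally have "a * (euclidean_norm d (\<lambda>i. V y i - V x i))\<^sup>2 \<le> U.expectation (\<lambda>t. a * (pi / 2)\<^sup>2 * (\<Sum>i<d. (f i t)\<^sup>2))"
    using a by (simp add: mult.assoc mult_left_mono)
  then have "ennreal (exp (a * (euclidean_norm d (\<lambda>i. V y i - V x i))\<^sup>2)) \<le>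
      ennreal (exp (U.expectation (\<lambda>t. a * (pi / 2)\<^sup>2 * (\<Sum>i<d. (f i t)\<^sup>2))))"
    by (simp add: ennreal_leI)
  also have "\<dots> \<le> (\<integral>\<^sup>+t. ennreal (exp (a * (pi / 2)\<^sup>2 * (\<Sum>i<d. (f i t)\<^sup>2))) \<partial>unif)"
    using if1 by (intro exp_integral_le_nn_integral_exp prob_space_unif integrable_mult_right Bochner_Integration.integrable_sum) auto
  finally show ?thesis by (simp add: euclidean_norm_sqr f_def)
qed

text \<open>Since the mean vanishes, |V x|^2 is at most the average of |V y - V x|^2 over y; the
  discarded term is the average of |V y|^2. Then Jensen's inequality for exp.\<close>

lemma exp_V_sqr_le:
  assumes mean: "\<And>i. i < d \<Longrightarrow> (\<integral>x. V x i \<partial>gaussian d) = 0" and a: "0 \<le> a"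
  shows "ennreal (exp (a * (euclidean_norm d (V x))\<^sup>2)) \<le>
    (\<integral>\<^sup>+y. ennreal (exp (a * (euclidean_norm d (\<lambda>i. V y i - V x i))\<^sup>2)) \<partial>gaussian d)"
proof -
  interpret G: prob_space "gaussian d" by (rule prob_space_gaussian)
  have eq: "a * (V y i - V x i)\<^sup>2 = a * (V y i)\<^sup>2 - 2 * a * V x i * V y i + a * (V x i)\<^sup>2" for y i
    by (simp add: power2_diff algebra_simps)
  have int: "integrable (gaussian d) (\<lambda>y. a * (V y i - V x i)\<^sup>2)" if "i < d" for i
    unfolding eq using integrable_V_sqr[OF that] integrable_V[OF that] by auto
  have "(\<integral>y. a * (V y i - V x i)\<^sup>2 \<partial>gaussian d) = a * (\<integral>y. (V y i)\<^sup>2 \<partial>gaussian d) + a * (V x i)\<^sup>2" if "i < d" for i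
    unfolding eq using integrable_V_sqr[OF that] integrable_V[OF that] mean[OF that] G.prob_space by simp
  then have le: "a * (V x i)\<^sup>2 \<le> (\<integral>y. a * (V y i - V x i)\<^sup>2 \<partial>gaussian d)" if "i < d" for i
    using that a by (simp add: integral_nonneg_AE)
  have "a * (euclidean_norm d (V x))\<^sup>2 = (\<Sum>i<d. a * (V x i)\<^sup>2)" by (simp add: euclidean_norm_sqr sum_distrib_left)
  also have "\<dots> \<le> (\<Sum>i<d. \<integral>y. a * (V y i - V x i)\<^sup>2 \<partial>gaussian d)" using le by (intro sum_mono) auto
  also have "\<dots> = (\<integral>y. (\<Sum>i<d. a * (V y i - V x i)\<^sup>2) \<partial>gaussian d)"
    using int by (subst Bochner_Integration.integral_sum) auto
  finally have "ennreal (exp (a * (euclidean_norm d (V x))\<^sup>2)) \<le> ennreal (exp (\<integral>y. (\<Sum>i<d. a * (V y i - V x i)\<^sup>2) \<partial>gaussian d))"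
    by (simp add: ennreal_leI)
  also have "\<dots> \<le> (\<integral>\<^sup>+y. ennreal (exp (\<Sum>i<d. a * (V y i - V x i)\<^sup>2)) \<partial>gaussian d)"
    using int by (intro exp_integral_le_nn_integral_exp prob_space_gaussian Bochner_Integration.integrable_sum) auto
  finally show ?thesis by (simp add: euclidean_norm_sqr sum_distrib_left)
qed

text \<open>With the angle integral moved outside, rotation invariance replaces (rot, rot') by (x,
  y). For fixed x the exponent is quadratic in the linear Gaussian vector A(x) y, so the matrix
  estimate applies with coefficient a (pi/2)^2.\<close>

lemma nn_integral_exp_V_sqr:
  assumes mean: "\<And>i. i < d \<Longrightarrow> (\<integral>x. V x i \<partial>gaussian d) = 0" and a: "0 \<le> a" "a * (pi / 2)\<^sup>2 * L\<^sup>2 \<le> 1 / 4"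
  shows "(\<integral>\<^sup>+x. ennreal (exp (a * (euclidean_norm d (V x))\<^sup>2)) \<partial>gaussian d) \<le> ennreal (sqrt 2)"
proof -
  interpret G: prob_space "gaussian d" by (rule prob_space_gaussian)
  interpret U: prob_space unif by (rule prob_space_unif)
  interpret P: pair_sigma_finite unif "gaussian d" ..
  define c where "c = a * (pi / 2)\<^sup>2"
  define E where "E z = ennreal (exp (c * (euclidean_norm d (AV (fst z) (snd z)))\<^sup>2))" for z
  have A': "(\<lambda>x. A x i j) \<in> borel_measurable (gaussian d)" if "i < d" "j < d" for i j
    using A_meas[OF that] by (simp add: measurable_gaussian_iff)
  have E[measurable]: "E \<in> borel_measurable (gaussian d \<Otimes>\<^sub>M gaussian d)"
    unfolding E_def euclidean_norm_sqr AV_def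
    by (intro measurable_compose[OF _ measurable_ennreal] measurable_compose[OF _ borel_measurable_exp] borel_measurable_times
        borel_measurable_sum borel_measurable_power borel_measurable_const measurable_compose[OF measurable_fst A']
        measurable_compose[OF measurable_snd measurable_coord_gaussian]) auto
  have rot: "(\<lambda>p. rot (f p) (g p) (h p)) \<in> N \<rightarrow>\<^sub>M gaussian d" "(\<lambda>p. rot' (f p) (g p) (h p)) \<in> N \<rightarrow>\<^sub>M gaussian d"
    if [measurable]: "f \<in> borel_measurable N" "g \<in> N \<rightarrow>\<^sub>M gaussian d" "h \<in> N \<rightarrow>\<^sub>M gaussian d" for f g h and N :: "'z measure"
  proof -
    have [measurable]: "(\<lambda>p. g p i) \<in> borel_measurable N" "(\<lambda>p. h p i) \<in> borel_measurable N" if "i < d" for i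
      using measurable_compose[OF \<open>g \<in> _\<close> measurable_coord_gaussian[OF that]]
        measurable_compose[OF \<open>h \<in> _\<close> measurable_coord_gaussian[OF that]] by simp_all
    show "(\<lambda>p. rot (f p) (g p) (h p)) \<in> N \<rightarrow>\<^sub>M gaussian d" "(\<lambda>p. rot' (f p) (g p) (h p)) \<in> N \<rightarrow>\<^sub>M gaussian d"
      unfolding rot_def rot'_def gaussian_def' by (rule measurable_restrict, simp)+
  qed
  note rot[measurable]
  have "(\<integral>\<^sup>+x. ennreal (exp (a * (euclidean_norm d (V x))\<^sup>2)) \<partial>gaussian d) \<le>
    (\<integral>\<^sup>+x. \<integral>\<^sup>+y. ennreal (exp (a * (euclidean_norm d (\<lambda>i. V y i - V x i))\<^sup>2)) \<partial>gaussian d \<partial>gaussian d)"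
    by (intro nn_integral_mono exp_V_sqr_le mean a)
  also have "\<dots> \<le> (\<integral>\<^sup>+x. \<integral>\<^sup>+y. \<integral>\<^sup>+t. E (rot t x y, rot' t x y) \<partial>unif \<partial>gaussian d \<partial>gaussian d)"
    using exp_increment_le[OF a(1)] by (intro nn_integral_mono) (simp add: E_def c_def)
  also have "\<dots> = (\<integral>\<^sup>+x. \<integral>\<^sup>+t. \<integral>\<^sup>+y. E (rot t x y, rot' t x y) \<partial>gaussian d \<partial>unif \<partial>gaussian d)"
    by (intro nn_integral_cong P.Fubini') measurable
  also have "\<dots> = (\<integral>\<^sup>+t. \<integral>\<^sup>+x. \<integral>\<^sup>+y. E (rot t x y, rot' t x y) \<partial>gaussian d \<partial>gaussian d \<partial>unif)"
    by (rule P.Fubini') measurable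
  also have "\<dots> \<le> (\<integral>\<^sup>+t. ennreal (sqrt 2) \<partial>unif)"
  proof (rule nn_integral_mono_AE, use AE_unif_cos_pos in eventually_elim)
    fix t :: real assume t: "0 < cos t"
    have "(\<integral>\<^sup>+x. \<integral>\<^sup>+y. E (rot t x y, rot' t x y) \<partial>gaussian d \<partial>gaussian d) = (\<integral>\<^sup>+x. \<integral>\<^sup>+y. E (x, y) \<partial>gaussian d \<partial>gaussian d)"
      unfolding rot_def rot'_def by (rule nn_integral_gaussian_rotate) (use t in auto)
    also have "\<dots> \<le> (\<integral>\<^sup>+x. ennreal (sqrt 2) \<partial>gaussian d)"
    proof (rule nn_integral_mono)
      fix x assume "x \<in> space (gaussian d)"
      then have "(HS_norm d (A x))\<^sup>2 \<le> L\<^sup>2" using HS_A by (intro power_mono) auto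
      then have "c * (HS_norm d (A x))\<^sup>2 \<le> c * L\<^sup>2" using a by (intro mult_left_mono) (auto simp: c_def)
      then have "c * (HS_norm d (A x))\<^sup>2 \<le> 1 / 4" using a by (simp add: c_def)
      then show "(\<integral>\<^sup>+y. E (x, y) \<partial>gaussian d) \<le> ennreal (sqrt 2)"
        unfolding E_def fst_conv snd_conv AV_def[abs_def]
        by (intro nn_integral_gaussian_exp_matrix) (use a in \<open>auto simp: c_def\<close>)
    qed
    also have "\<dots> = ennreal (sqrt 2)" using G.emeasure_space_1 by simp
    finally show "(\<integral>\<^sup>+x. \<integral>\<^sup>+y. E (rot t x y, rot' t x y) \<partial>gaussian d \<partial>gaussian d) \<le> ennreal (sqrt 2)" .
  qed
  also have "\<dots> = ennreal (sqrt 2)" using U.emeasure_space_1 by simp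
  finally show ?thesis .
qed

lemma nn_integral_exp_abs_divergence:
  assumes mean: "\<And>i. i < d \<Longrightarrow> (\<integral>x. V x i \<partial>gaussian d) = 0"
  shows "(\<integral>\<^sup>+x. ennreal (exp (\<bar>divergence x\<bar> / (5 * L))) \<partial>gaussian d) \<le> 3"
proof -
  \<comment> \<open>sL = 2/5 is below 1/2, and (sL)^2 pi^2/8 = pi^2/50 is below 1/4, so both
    exponential estimates are available.\<close>
  define s where "s = 2 / (5 * L)"
  have sL: "s * L = 2 / 5" "0 < s" using L_pos by (auto simp: s_def)
  define g where "g u x = exp (u * divergence x - u\<^sup>2 / 2 * (euclidean_norm d (V x))\<^sup>2)" for u x
  define h where "h x = exp (s\<^sup>2 / 2 * (euclidean_norm d (V x))\<^sup>2)" for x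
  \<comment> \<open>Cauchy-Schwarz in pointwise form: exp(u \<delta>/2) is the product of the square
    roots of \<open>g u\<close> and \<open>h\<close>, since the loss in \<open>g\<close> is exactly
    compensated by \<open>h\<close>.\<close>
  have half: "exp (u / 2 * divergence x) \<le> (g u x + h x) / 2" if "u\<^sup>2 = s\<^sup>2" for u x
  proof -
    define P where "P = exp ((u * divergence x - u\<^sup>2 / 2 * (euclidean_norm d (V x))\<^sup>2) / 2)"
    define Q where "Q = exp (s\<^sup>2 / 2 * (euclidean_norm d (V x))\<^sup>2 / 2)"
    have "exp (u / 2 * divergence x) = P * Q"
      unfolding P_def Q_def exp_add[symmetric] that by (simp add: field_simps)
    moreover have "\<dots> \<le> (P\<^sup>2 + Q\<^sup>2) / 2"
      using sum_squares_bound[of P Q] by simp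
    moreover have "(exp (z / 2))\<^sup>2 = exp z" for z :: real by (simp add: power2_eq_square exp_add[symmetric])
    then have "P\<^sup>2 = g u x" "Q\<^sup>2 = h x" by (simp_all only: P_def Q_def g_def h_def)
    ultimately show ?thesis by simp
  qed
  have le: "exp (\<bar>divergence x\<bar> / (5 * L)) \<le> (g s x + g (- s) x) / 2 + h x" for x
  proof -
    have "\<bar>divergence x\<bar> / (5 * L) = s / 2 * \<bar>divergence x\<bar>" by (simp add: s_def)
    then have "exp (\<bar>divergence x\<bar> / (5 * L)) \<le> exp (s / 2 * divergence x) + exp (- s / 2 * divergence x)"
      by (cases "0 \<le> divergence x") (auto simp: add_increasing add_increasing2)
    also have "\<dots> \<le> (g s x + h x) / 2 + (g (- s) x + h x) / 2"
      by (intro add_mono half) auto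
    finally show ?thesis by (simp add: field_simps)
  qed
  have Vm: "(\<lambda>x. V x i) \<in> borel_measurable (gaussian d)" "(\<lambda>x. A x i j) \<in> borel_measurable (gaussian d)" if "i < d" "j < d" for i j
    using V_meas A_meas that by (simp_all add: measurable_gaussian_iff)
  have [measurable]: "divergence \<in> borel_measurable (gaussian d)"
    unfolding divergence_def[abs_def]
    by (intro borel_measurable_diff borel_measurable_sum borel_measurable_times measurable_coord_gaussian Vm) auto
  have nm[measurable]: "(\<lambda>x. (euclidean_norm d (V x))\<^sup>2) \<in> borel_measurable (gaussian d)"
    unfolding euclidean_norm_sqr by (intro borel_measurable_sum borel_measurable_power Vm) auto
  have gm[measurable]: "g u \<in> borel_measurable (gaussian d)" for u unfolding g_def by measurable
  have hm[measurable]: "h \<in> borel_measurable (gaussian d)" unfolding h_def by measurable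
  have g: "(\<integral>\<^sup>+x. ennreal (g u x) \<partial>gaussian d) \<le> ennreal (3 / 2)" if "\<bar>u\<bar> = s" for u
  proof -
    have u: "\<bar>u\<bar> * L = 2 / 5" using that sL by simp
    have "(\<integral>\<^sup>+x. ennreal (g u x) \<partial>gaussian d) \<le> ennreal (exp ((u * L)\<^sup>2))"
      unfolding g_def by (rule nn_integral_exp_divergence) (use u in simp)
    also have "(u * L)\<^sup>2 = (\<bar>u\<bar> * L)\<^sup>2" by (simp add: power_mult_distrib)
    also have "exp ((\<bar>u\<bar> * L)\<^sup>2) \<le> 1 + (2 / 5)\<^sup>2 + ((2 / 5)\<^sup>2)\<^sup>2"
      unfolding u by (rule exp_bound) (auto simp: power2_eq_square)
    also have "\<dots> \<le> 3 / 2" by (simp add: power2_eq_square)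
    finally show ?thesis by (simp add: ennreal_leI)
  qed
  have "s\<^sup>2 / 2 * (pi / 2)\<^sup>2 * L\<^sup>2 = (s * L)\<^sup>2 * pi\<^sup>2 / 8" by (simp add: power_mult_distrib power_divide)
  also have "\<dots> \<le> 1 / 4"
  proof -
    have "pi\<^sup>2 \<le> (32 / 10)\<^sup>2" using pi_approx pi_gt_zero by (intro power_mono) auto
    then show ?thesis unfolding sL by (simp add: power2_eq_square)
  qed
  finally have h: "(\<integral>\<^sup>+x. ennreal (h x) \<partial>gaussian d) \<le> ennreal (sqrt 2)"
    unfolding h_def by (intro nn_integral_exp_V_sqr mean) auto
  have lin: "ennreal (1 / 2 * (a + b) + c) = ennreal (1 / 2) * (ennreal a + ennreal b) + ennreal c"
    if "0 \<le> a" "0 \<le> b" "0 \<le> c" for a b c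
    using that by (subst ennreal_plus, simp, simp, subst ennreal_mult', simp, subst ennreal_plus) auto
  have "(\<integral>\<^sup>+x. ennreal (exp (\<bar>divergence x\<bar> / (5 * L))) \<partial>gaussian d) \<le>
      (\<integral>\<^sup>+x. ennreal (1 / 2) * (ennreal (g s x) + ennreal (g (- s) x)) + ennreal (h x) \<partial>gaussian d)"
  proof (rule nn_integral_mono)
    fix x
    have "ennreal (1 / 2) * (ennreal (g s x) + ennreal (g (- s) x)) + ennreal (h x) = ennreal ((g s x + g (- s) x) / 2 + h x)"
    proof -
      from lin[of "g s x" "g (- s) x" "h x"] show ?thesis by (simp add: g_def h_def)
    qed
    then show "ennreal (exp (\<bar>divergence x\<bar> / (5 * L))) \<le> ennreal (1 / 2) * (ennreal (g s x) + ennreal (g (- s) x)) + ennreal (h x)"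
      using le[of x] by (simp add: ennreal_leI)
  qed
  also have "\<dots> = ennreal (1 / 2) * ((\<integral>\<^sup>+x. ennreal (g s x) \<partial>gaussian d) + (\<integral>\<^sup>+x. ennreal (g (- s) x) \<partial>gaussian d)) + (\<integral>\<^sup>+x. ennreal (h x) \<partial>gaussian d)"
    by (simp add: nn_integral_add nn_integral_cmult)
  also have "\<dots> \<le> ennreal (1 / 2) * (ennreal (3 / 2) + ennreal (3 / 2)) + ennreal (sqrt 2)"
    using sL by (intro add_mono mult_left_mono g h) auto
  also have "\<dots> = ennreal (1 / 2 * (3 / 2 + 3 / 2) + sqrt 2)"
    by (rule lin[symmetric]) auto
  also have "\<dots> \<le> ennreal 3"
  proof (rule ennreal_leI)
    have "sqrt 2 \<le> 3 / 2" by (rule real_le_lsqrt) (auto simp: power2_eq_square)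
    then show "1 / 2 * (3 / 2 + 3 / 2) + sqrt 2 \<le> (3 :: real)" by simp
  qed
  finally show ?thesis by simp
qed

end

subsection \<open>Smooth functions of one variable\<close>

text \<open>A smooth function of one variable carried together with all its derivatives, so that
  explicit formulas replace iterated \<open>deriv\<close>.\<close>

definition deriv_chain :: "(nat \<Rightarrow> real \<Rightarrow> real) \<Rightarrow> bool" where
  "deriv_chain D \<longleftrightarrow> (\<forall>n t. (D n has_real_derivative D (Suc n) t) (at t))"

lemma deriv_chainD: "deriv_chain D \<Longrightarrow> (D n has_real_derivative D (Suc n) t) (at t)"
  by (simp add: deriv_chain_def)

text \<open>Any class of functions closed under differentiation consists of smooth functions;
  dependent choice assembles the derivatives.\<close>

lemma deriv_chain_exists:
  assumes "P h" and step: "\<And>h. P h \<Longrightarrow> \<exists>h'. P h' \<and> (\<forall>t. (h has_real_derivative h' t) (at t))"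
  obtains D where "deriv_chain D" "D 0 = h"
proof -
  have "\<exists>D. (\<forall>n. P (D n)) \<and> (\<forall>n. \<forall>t. (D n has_real_derivative D (Suc n) t) (at t)) \<and> D 0 = h"
    using dependent_nat_choice[of "\<lambda>n f. P f \<and> (n = 0 \<longrightarrow> f = h)" "\<lambda>n f g. \<forall>t. (f has_real_derivative g t) (at t)"]
      assms by (metis Zero_not_Suc)
  then show ?thesis using that by (auto simp: deriv_chain_def)
qed

text \<open>The class used for products: it is closed under differentiation by the product rule, so
  the binomial form of Leibniz' rule is avoided.\<close>

inductive prodsum :: "(nat \<Rightarrow> real \<Rightarrow> real) \<Rightarrow> (nat \<Rightarrow> real \<Rightarrow> real) \<Rightarrow> (real \<Rightarrow> real) \<Rightarrow> bool" for D E where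
  prod: "prodsum D E (\<lambda>t. D m t * E n t)"
| add: "prodsum D E f \<Longrightarrow> prodsum D E g \<Longrightarrow> prodsum D E (\<lambda>t. f t + g t)"

lemma prodsum_step:
  assumes "deriv_chain D" "deriv_chain E" "prodsum D E h"
  shows "\<exists>h'. prodsum D E h' \<and> (\<forall>t. (h has_real_derivative h' t) (at t))"
  using assms(3)
proof induction
  case (prod m n)
  have "((\<lambda>t. D m t * E n t) has_real_derivative D (Suc m) t * E n t + D m t * E (Suc n) t) (at t)" for t
    by (rule derivative_eq_intros deriv_chainD assms refl | simp add: mult.commute)+
  then show ?case
    by (intro exI[of _ "\<lambda>t. D (Suc m) t * E n t + D m t * E (Suc n) t"]) (auto intro: prodsum.intros)
next
  case (add f g)
  then show ?case by (blast intro: prodsum.add DERIV_add)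
qed

lemma deriv_chain_mult:
  assumes "deriv_chain D" "deriv_chain E"
  obtains P where "deriv_chain P" "P 0 = (\<lambda>t. D 0 t * E 0 t)"
  by (rule deriv_chain_exists[of "prodsum D E", OF prodsum.prod[of D E 0 0] prodsum_step[OF assms]])

lemma deriv_chain_affine:
  assumes "deriv_chain D"
  shows "deriv_chain (\<lambda>n t. c * a ^ n * D (m + n) (b + a * t))"
  unfolding deriv_chain_def
proof (intro allI)
  fix n t
  have "((\<lambda>t. D (m + n) (b + a * t)) has_real_derivative D (Suc (m + n)) (b + a * t) * a) (at t)"
    by (rule DERIV_chain2[where f="D (m + n)" and g="\<lambda>t. b + a * t", OF deriv_chainD[OF assms]])
      (auto intro!: derivative_eq_intros)
  from DERIV_cmult[OF this, of "c * a ^ n"]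
  show "((\<lambda>t. c * a ^ n * D (m + n) (b + a * t)) has_real_derivative c * a ^ Suc n * D (m + Suc n) (b + a * t)) (at t)"
    by (simp add: mult_ac)
qed

lemma poly_times_exp_tendsto_0: "((\<lambda>x::real. poly p x * exp (- x)) \<longlongrightarrow> 0) at_top"
proof -
  have "((\<lambda>x::real. \<Sum>i\<le>degree p. coeff p i * (x ^ i / exp x)) \<longlongrightarrow> (\<Sum>i\<le>degree p. coeff p i * 0)) at_top"
    by (intro tendsto_intros tendsto_power_div_exp_0)
  then show ?thesis by (simp add: poly_altdef sum_distrib_right exp_minus divide_inverse mult.assoc)
qed

text \<open>The derivative of P(1/t) exp(-1/t) is (1/t)^2 (P - P')(1/t) exp(-1/t); this is the
  recursion for P.\<close>

primrec flat_poly :: "nat \<Rightarrow> real poly" where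
  "flat_poly 0 = 1"
| "flat_poly (Suc n) = [:0, 0, 1:] * (flat_poly n - pderiv (flat_poly n))"

text \<open>The successive derivatives of the function $e^{-1/t}$ on the positive half line.\<close>

definition flat :: "nat \<Rightarrow> real \<Rightarrow> real" where
  "flat n t = (if 0 < t then poly (flat_poly n) (1 / t) * exp (- (1 / t)) else 0)"

lemma deriv_chain_flat: "deriv_chain flat"
  unfolding deriv_chain_def
proof (intro allI)
  fix n :: nat and t :: real
  consider "0 < t" | "t < 0" | "t = 0" by linarith
  then show "(flat n has_real_derivative flat (Suc n) t) (at t)"
  proof cases
    case 1
    have p: "((\<lambda>t. poly (flat_poly n) (1 / t)) has_real_derivative poly (pderiv (flat_poly n)) (1 / t) * (- 1 / t\<^sup>2)) (at t)"
      by (rule DERIV_chain2[OF poly_DERIV]) (use 1 in \<open>auto intro!: derivative_eq_intros simp: power2_eq_square\<close>)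
    have "((\<lambda>t. poly (flat_poly n) (1 / t) * exp (- (1 / t))) has_real_derivative flat (Suc n) t) (at t)"
      by (rule derivative_eq_intros p refl | use 1 in \<open>simp add: flat_def field_simps power2_eq_square\<close>)+
    then show ?thesis
      by (rule has_field_derivative_transform_within_open[where S="{0<..}"]) (use 1 in \<open>auto simp: flat_def\<close>)
  next
    case 2
    have "((\<lambda>t. 0) has_real_derivative flat (Suc n) t) (at t)" using 2 by (simp add: flat_def)
    then show ?thesis
      by (rule has_field_derivative_transform_within_open[where S="{..<0}"]) (use 2 in \<open>auto simp: flat_def\<close>)
  next
    case 3
    \<comment> \<open>The right difference quotient at 0 is again a polynomial in 1/h, with one
      extra factor 1/h, times exp(-1/h). With 1/h tending to infinity the exponential wins.\<close>
    have "((\<lambda>h. (flat n (0 + h) - flat n 0) / h) \<longlongrightarrow> 0) (at_right 0)"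
    proof (rule Lim_transform_eventually)
      have "((\<lambda>h::real. poly ([:0, 1:] * flat_poly n) (1 / h) * exp (- (1 / h))) \<longlongrightarrow> 0) (at_right 0)"
        by (rule filterlim_compose[OF poly_times_exp_tendsto_0])
          (simp add: filterlim_inverse_at_top_right divide_inverse)
      then show "((\<lambda>h::real. poly ([:0, 1:] * flat_poly n) (1 / h) * exp (- (1 / h))) \<longlongrightarrow> 0) (at_right 0)" .
      show "\<forall>\<^sub>F h in at_right 0. poly ([:0, 1:] * flat_poly n) (1 / h) * exp (- (1 / h)) = (flat n (0 + h) - flat n 0) / h"
        using eventually_at_right_less[of "0::real"] by eventually_elim (simp add: flat_def)
    qed
    moreover have "((\<lambda>h. (flat n (0 + h) - flat n 0) / h) \<longlongrightarrow> 0) (at_left 0)"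
      by (rule tendsto_eventually) (auto simp: flat_def eventually_at_filter intro!: always_eventually)
    ultimately have "((\<lambda>h. (flat n (0 + h) - flat n 0) / h) \<longlongrightarrow> 0) (at 0)"
      by (simp add: filterlim_split_at)
    then show ?thesis using 3 by (simp add: DERIV_def flat_def)
  qed
qed

definition mollifier :: "real \<Rightarrow> (nat \<Rightarrow> real \<Rightarrow> real) \<Rightarrow> bool" where
  "mollifier \<epsilon> D \<longleftrightarrow> deriv_chain D \<and> (\<forall>t. 0 \<le> D 0 t) \<and> (\<forall>n t. \<epsilon> < \<bar>t\<bar> \<longrightarrow> D n t = 0) \<and>
     integrable lborel (D 0) \<and> (\<integral>t. D 0 t \<partial>lborel) = 1"

lemma deriv_chain_isCont: "deriv_chain D \<Longrightarrow> isCont (D n) t"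
  by (meson DERIV_isCont deriv_chainD)

lemma deriv_chain_continuous: "deriv_chain D \<Longrightarrow> continuous_on S (D n)"
  by (simp add: continuous_at_imp_continuous_on deriv_chain_isCont)

lemma deriv_chain_measurable: "deriv_chain D \<Longrightarrow> D n \<in> borel_measurable borel"
  by (intro borel_measurable_continuous_onI deriv_chain_continuous)

text \<open>The set |t| > \<epsilon> is open, so vanishing there passes to every derivative.\<close>

lemma deriv_chain_support:
  assumes D: "deriv_chain D" and "\<And>t. \<epsilon> < \<bar>t\<bar> \<Longrightarrow> D 0 t = 0" and t: "\<epsilon> < \<bar>t\<bar>"
  shows "D n t = 0"
  using t
proof (induction n arbitrary: t)
  case 0
  then show ?case using assms by simp
next
  case (Suc n)
  have "((\<lambda>t. 0) has_real_derivative D (Suc n) t) (at t)"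
  proof (rule has_field_derivative_transform_within_open[OF deriv_chainD[OF D, of n t]])
    have "{t. \<epsilon> < \<bar>t\<bar>} = - cball 0 \<epsilon>" by auto
    then show "open {t. \<epsilon> < \<bar>t\<bar>}" by (metis closed_cball open_Compl)
  qed (use Suc in auto)
  then show ?case using DERIV_unique[OF DERIV_const] by metis
qed

text \<open>The product of the flat function at \<epsilon> + t and at \<epsilon> - t is positive
  exactly on the open interval; dividing by its integral normalises it.\<close>

lemma mollifier_exists:
  assumes "0 < \<epsilon>" obtains D where "mollifier \<epsilon> D"
proof -
  have "deriv_chain (\<lambda>n t. flat n (\<epsilon> + t))"
    using deriv_chain_affine[OF deriv_chain_flat, of 1 1 0 \<epsilon>] by simp
  moreover have "deriv_chain (\<lambda>n t. (-1) ^ n * flat n (\<epsilon> - t))"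
    using deriv_chain_affine[OF deriv_chain_flat, of 1 "-1" 0 \<epsilon>] by simp
  ultimately obtain P where P: "deriv_chain P" "P 0 = (\<lambda>t. flat 0 (\<epsilon> + t) * ((-1) ^ 0 * flat 0 (\<epsilon> - t)))"
    by (rule deriv_chain_mult)
  have P0: "0 \<le> P 0 t" for t by (simp add: P flat_def)
  have Ps: "P 0 t = 0" if "\<epsilon> < \<bar>t\<bar>" for t using that assms by (auto simp: P flat_def)
  have Pp: "0 < P 0 t" if "t \<in> {-\<epsilon><..<\<epsilon>}" for t using that by (auto simp: P flat_def)
  have int: "integrable lborel (P 0)"
  proof -
    have "set_integrable lborel {-\<epsilon>..\<epsilon>} (P 0)"
      by (intro borel_integrable_atLeastAtMost' deriv_chain_continuous P)
    moreover have "indicator {-\<epsilon>..\<epsilon>} t *\<^sub>R P 0 t = P 0 t" for t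
      using Ps[of t] by (cases "\<epsilon> < \<bar>t\<bar>") (auto simp: indicator_def)
    ultimately show ?thesis unfolding set_integrable_def by (simp only:)
  qed
  define c where "c = (\<integral>t. P 0 t \<partial>lborel)"
  have "c \<noteq> 0"
  proof
    assume "c = 0"
    then have "AE t in lborel. P 0 t = 0"
      using integral_nonneg_eq_0_iff_AE[OF int] P0 by (simp add: c_def)
    then have "AE t in lborel. t \<notin> {-\<epsilon><..<\<epsilon>}" by eventually_elim (use Pp in force)
    then have "emeasure lborel {-\<epsilon><..<\<epsilon>} = 0" by (subst (asm) AE_iff_null_sets[symmetric]) (auto simp: null_sets_def)
    then show False using assms by simp
  qed
  moreover have "0 \<le> c" unfolding c_def by (rule integral_nonneg_AE) (simp add: P0)
  ultimately have c: "0 < c" by simp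
  \<comment> \<open>This is P n t / c, spelled as an instance of
    \<open>deriv_chain_affine\<close>.\<close>
  have "mollifier \<epsilon> (\<lambda>n t. 1 / c * 1 ^ n * P (0 + n) (0 + 1 * t))"
    unfolding mollifier_def
  proof (intro conjI deriv_chain_affine P allI impI)
    show "1 / c * 1 ^ n * P (0 + n) (0 + 1 * t) = 0" if "\<epsilon> < \<bar>t\<bar>" for n t
      using deriv_chain_support[OF P(1) Ps that] by simp
  qed (use int c P0 in \<open>auto simp: c_def\<close>)
  then show ?thesis by (rule that)
qed

subsection \<open>Test functions\<close>

text \<open>\<open>smooth\<close> speaks of all iterated partial derivatives, so a direct proof for
  products would need a multivariate Leibniz rule. An algebra closed under partial derivatives
  suffices instead; it contains arbitrary smooth functions so that test functions can be multiplied
  by explicit ones.\<close>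

inductive smooth_alg :: "nat \<Rightarrow> ((nat \<Rightarrow> real) \<Rightarrow> real) \<Rightarrow> bool" for d where
  base: "smooth d F \<Longrightarrow> smooth_alg d F"
| coord: "i < d \<Longrightarrow> deriv_chain D \<Longrightarrow> smooth_alg d (\<lambda>x. D n (x i))"
| const: "smooth_alg d (\<lambda>x. c)"
| add: "smooth_alg d F \<Longrightarrow> smooth_alg d G \<Longrightarrow> smooth_alg d (\<lambda>x. F x + G x)"
| mult: "smooth_alg d F \<Longrightarrow> smooth_alg d G \<Longrightarrow> smooth_alg d (\<lambda>x. F x * G x)"

lemma smooth_DERIV:
  assumes "smooth d F" "x \<in> Rd d" "i < d"
  shows "((\<lambda>t. F (x(i := t))) has_real_derivative partial_deriv i F x) (at (x i))"
  using assms(1)[unfolded smooth_def, rule_format, of "[]"] assms(2,3)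
  by (simp add: partial_deriv_def DERIV_deriv_iff_field_differentiable)

lemma smooth_partial_deriv:
  assumes "smooth d F" "i < d" shows "smooth d (partial_deriv i F)"
  unfolding smooth_def
proof (intro allI impI)
  fix "is" assume "set is \<subseteq> {..<d}"
  then have "set (is @ [i]) \<subseteq> {..<d}" using assms by auto
  then show "continuous_on (Rd d) (foldr partial_deriv is (partial_deriv i F)) \<and>
     (\<forall>j<d. \<forall>x\<in>Rd d. (\<lambda>t. foldr partial_deriv is (partial_deriv i F) (x(j := t))) field_differentiable at (x j))"
    using assms(1)[unfolded smooth_def, rule_format, of "is @ [i]"] by simp
qed

lemma smooth_continuous:
  assumes "smooth d F" shows "continuous_on (Rd d) F"
  using assms[unfolded smooth_def, rule_format, of "[]"] by simp

lemma smooth_alg_continuous: "smooth_alg d F \<Longrightarrow> continuous_on (Rd d) F"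
proof (induction rule: smooth_alg.induct)
  case (coord i D n)
  then show ?case
    by (intro continuous_on_compose2[OF deriv_chain_continuous[of D UNIV n]] continuous_on_subset[OF continuous_on_product_coordinates]) auto
qed (auto intro!: continuous_intros intro: smooth_continuous)

lemma smooth_alg_DERIV:
  assumes "smooth_alg d F" "i < d"
  shows "\<exists>G. smooth_alg d G \<and> (\<forall>x\<in>Rd d. ((\<lambda>t. F (x(i := t))) has_real_derivative G x) (at (x i)))"
  using assms(1)
proof induction
  case (base F)
  then show ?case using smooth_DERIV smooth_partial_deriv assms(2) by (blast intro: smooth_alg.base)
next
  case (coord j D n)
  show ?case
  proof (cases "i = j")
    case True
    then show ?thesis
      by (intro exI[of _ "\<lambda>x. D (Suc n) (x j)"]) (use coord in \<open>auto intro: smooth_alg.coord deriv_chainD\<close>)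
  next
    case False
    then show ?thesis by (intro exI[of _ "\<lambda>x. 0"]) (auto intro: smooth_alg.const)
  qed
next
  case (const c)
  then show ?case by (intro exI[of _ "\<lambda>x. 0"]) (auto intro: smooth_alg.const)
next
  case (add F G)
  then obtain F' G' where FG: "smooth_alg d F'" "smooth_alg d G'"
    "\<And>x. x \<in> Rd d \<Longrightarrow> ((\<lambda>t. F (x(i := t))) has_real_derivative F' x) (at (x i))"
    "\<And>x. x \<in> Rd d \<Longrightarrow> ((\<lambda>t. G (x(i := t))) has_real_derivative G' x) (at (x i))" by blast
  show ?case
    by (intro exI[of _ "\<lambda>x. F' x + G' x"] conjI ballI smooth_alg.add FG DERIV_add)
next
  case (mult F G)
  then obtain F' G' where FG: "smooth_alg d F'" "smooth_alg d G'"
    "\<And>x. x \<in> Rd d \<Longrightarrow> ((\<lambda>t. F (x(i := t))) has_real_derivative F' x) (at (x i))"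
    "\<And>x. x \<in> Rd d \<Longrightarrow> ((\<lambda>t. G (x(i := t))) has_real_derivative G' x) (at (x i))" by blast
  have "((\<lambda>t. F (x(i := t)) * G (x(i := t))) has_real_derivative F' x * G x + G' x * F x) (at (x i))" if "x \<in> Rd d" for x
    using DERIV_mult[OF FG(3,4)[OF that]] by simp
  then show ?case using FG(1,2) mult
    by (intro exI[of _ "\<lambda>x. F' x * G x + G' x * F x"] conjI ballI smooth_alg.add smooth_alg.mult) blast+
qed

lemma partial_deriv_cong:
  assumes "\<And>x. x \<in> Rd d \<Longrightarrow> F x = G x" "x \<in> Rd d" "i < d"
  shows "partial_deriv i F x = partial_deriv i G x"
  unfolding partial_deriv_def using assms by simp

lemma partial_deriv_eq:
  "((\<lambda>t. F (x(i := t))) has_real_derivative D) (at (x i)) \<Longrightarrow> partial_deriv i F x = D"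
  unfolding partial_deriv_def by (rule DERIV_imp_deriv)

text \<open>The equality is claimed only on \<open>Rd d\<close>, which is enough because moving one
  coordinate below \<open>d\<close> stays inside \<open>Rd d\<close>.\<close>

lemma smooth_alg_foldr:
  assumes "smooth_alg d F" "set is \<subseteq> {..<d}"
  shows "\<exists>G. smooth_alg d G \<and> (\<forall>x\<in>Rd d. foldr partial_deriv is F x = G x)"
  using assms(2)
proof (induction "is")
  case Nil
  then show ?case using assms(1) by auto
next
  case (Cons i "is")
  then obtain G where G: "smooth_alg d G" "\<And>x. x \<in> Rd d \<Longrightarrow> foldr partial_deriv is F x = G x" by auto
  obtain G' where G': "smooth_alg d G'" "\<And>x. x \<in> Rd d \<Longrightarrow> ((\<lambda>t. G (x(i := t))) has_real_derivative G' x) (at (x i))"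
    using smooth_alg_DERIV[OF G(1), of i] Cons by auto
  have "foldr partial_deriv (i # is) F x = G' x" if "x \<in> Rd d" for x
    using partial_deriv_cong[OF G(2) that, where i=i] partial_deriv_eq[OF G'(2)[OF that]] Cons by simp
  then show ?case using G' by blast
qed

lemma smooth_alg_imp_smooth:
  assumes "smooth_alg d F" shows "smooth d F"
  unfolding smooth_def
proof (intro allI impI conjI ballI)
  fix "is" assume "set is \<subseteq> {..<d}"
  from smooth_alg_foldr[OF assms this]
  obtain G where G: "smooth_alg d G" "\<And>x. x \<in> Rd d \<Longrightarrow> foldr partial_deriv is F x = G x" by blast
  show "continuous_on (Rd d) (foldr partial_deriv is F)"
    using smooth_alg_continuous[OF G(1)] G(2) by (simp cong: continuous_on_cong)
  fix i x assume i: "i < d" and x: "x \<in> Rd d"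
  show "(\<lambda>t. foldr partial_deriv is F (x(i := t))) field_differentiable at (x i)"
    using smooth_alg_DERIV[OF G(1) i] x i unfolding field_differentiable_def by (simp add: G(2)) blast
qed

lemma smooth_alg_prod:
  assumes "\<And>i. i < d \<Longrightarrow> deriv_chain (D i)" "k \<le> d"
  shows "smooth_alg d (\<lambda>x. \<Prod>i<k. D i (n i) (x i))"
  using assms(2)
proof (induction k)
  case (Suc k)
  then show ?case using assms(1)[of k] by (auto intro!: smooth_alg.mult smooth_alg.coord)
qed (auto intro: smooth_alg.const)

lemma closed_Rd: "closed (Rd d)"
proof -
  have "Rd d = (\<Inter>i\<in>{d..}. {x. x i = undefined})"
    by (auto simp: Rd_def PiE_def extensional_def)
  also have "closed \<dots>"
    by (intro closed_INT ballI closed_Collect_eq continuous_on_product_coordinates continuous_on_const)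
  finally show ?thesis .
qed

text \<open>Tychonoff's theorem: in the full product over \<open>nat\<close> the box has a compact
  interval in each coordinate below \<open>d\<close> and the single point \<open>undefined\<close>
  in all others.\<close>

lemma compact_box: "compact {x \<in> Rd d. \<forall>i<d. a i \<le> x i \<and> x i \<le> b i}"
proof -
  have "{x \<in> Rd d. \<forall>i<d. a i \<le> x i \<and> x i \<le> b i} = (\<Pi>\<^sub>E i\<in>UNIV. if i < d then {a i..b i} else {undefined})"
    by (fastforce simp: Rd_def PiE_def Pi_def extensional_def split: if_splits)
  moreover have "compactin (product_topology (\<lambda>i. euclidean) UNIV) (\<Pi>\<^sub>E i\<in>UNIV. if i < d then {a i..b i} else {undefined})"
    by (subst compactin_PiE) auto
  ultimately show ?thesis by (simp add: euclidean_product_topology)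
qed

lemma test_functionI:
  assumes "smooth_alg d F" and S: "compact S" "\<And>x. x \<in> Rd d \<Longrightarrow> F x \<noteq> 0 \<Longrightarrow> x \<in> S"
  shows "test_function d F"
proof -
  have "closure {x \<in> Rd d. F x \<noteq> 0} \<subseteq> S"
    using S by (intro closure_minimal compact_imp_closed) auto
  then have eq: "S \<inter> closure {x \<in> Rd d. F x \<noteq> 0} = closure {x \<in> Rd d. F x \<noteq> 0}" by blast
  have "compact (closure {x \<in> Rd d. F x \<noteq> 0})"
    using compact_Int_closed[OF S(1) closed_closure[of "{x \<in> Rd d. F x \<noteq> 0}"]] unfolding eq .
  then show ?thesis using smooth_alg_imp_smooth[OF assms(1)] by (simp add: test_function_def)
qed

text \<open>The Borel sets of the countable product \<open>nat \<Rightarrow> real\<close> are its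
  product sigma-algebra, and the inclusion of \<open>Rd d\<close> is measurable because the
  coordinates from \<open>d\<close> on are constant.\<close>

lemma continuous_on_Rd_measurable:
  assumes "continuous_on (Rd d) F" shows "F \<in> borel_measurable (lebesgue_Rd d)"
proof -
  have "(\<lambda>x i. x i) \<in> lebesgue_Rd d \<rightarrow>\<^sub>M Pi\<^sub>M UNIV (\<lambda>_. borel)"
  proof (rule measurable_PiM_single')
    fix i :: nat
    show "(\<lambda>x. x i) \<in> borel_measurable (lebesgue_Rd d)"
    proof (cases "i < d")
      case False
      then have "x i = undefined" if "x \<in> space (lebesgue_Rd d)" for x
        using that by (auto simp: Rd_def PiE_def extensional_def)
      then show ?thesis
        by (subst measurable_cong[where g="\<lambda>_. undefined"]) auto
    qed simp
  qed auto
  then have id: "(\<lambda>x. x) \<in> lebesgue_Rd d \<rightarrow>\<^sub>M borel"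
    using measurable_cong_sets[OF refl sets_PiM_equal_borel] by blast
  have "(\<lambda>x. x) \<in> lebesgue_Rd d \<rightarrow>\<^sub>M restrict_space borel (Rd d)"
    by (rule measurable_restrict_space2) (use id in auto)
  from measurable_compose[OF this borel_measurable_continuous_on_restrict[OF assms]]
  show ?thesis .
qed

lemma test_functionD:
  assumes "test_function d F"
  shows "smooth_alg d F" "compact (closure {x \<in> Rd d. F x \<noteq> 0})" "closure {x \<in> Rd d. F x \<noteq> 0} \<subseteq> Rd d"
    "F \<in> borel_measurable (lebesgue_Rd d)"
proof -
  show "smooth_alg d F" "compact (closure {x \<in> Rd d. F x \<noteq> 0})"
    using assms by (auto simp: test_function_def intro: smooth_alg.base)
  show "closure {x \<in> Rd d. F x \<noteq> 0} \<subseteq> Rd d"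
    by (rule closure_minimal[OF _ closed_Rd]) auto
  show "F \<in> borel_measurable (lebesgue_Rd d)"
    using assms by (intro continuous_on_Rd_measurable smooth_continuous) (simp add: test_function_def)
qed

lemma test_function_bounded:
  assumes "test_function d F" obtains C where "\<And>x. x \<in> Rd d \<Longrightarrow> \<bar>F x\<bar> \<le> C"
proof -
  let ?K = "closure {x \<in> Rd d. F x \<noteq> 0}"
  have "compact (F ` ?K)"
    by (intro compact_continuous_image continuous_on_subset[OF smooth_alg_continuous[OF test_functionD(1)[OF assms]]]
        test_functionD(2,3)[OF assms])
  then obtain C where C: "\<And>x. x \<in> ?K \<Longrightarrow> \<bar>F x\<bar> \<le> C"
    using compact_imp_bounded[of "F ` ?K"] by (auto simp: bounded_iff)
  have "\<bar>F x\<bar> \<le> max 0 C" if "x \<in> Rd d" for x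
    using C[of x] closure_subset[of "{x \<in> Rd d. F x \<noteq> 0}"] that by (cases "F x = 0") force+
  then show ?thesis by (rule that)
qed

lemma test_function_mult:
  assumes "test_function d F" "smooth_alg d g" shows "test_function d (\<lambda>x. F x * g x)"
  by (rule test_functionI[OF smooth_alg.mult[OF test_functionD(1)[OF assms(1)] assms(2)] test_functionD(2)[OF assms(1)]])
    (use closure_subset[of "{x \<in> Rd d. F x \<noteq> 0}"] in auto)

lemma continuous_on_fun_upd: "continuous_on UNIV (\<lambda>t. x(j := t) :: nat \<Rightarrow> real)"
proof (rule continuous_on_coordinatewise_then_product)
  show "continuous_on UNIV (\<lambda>t. (x(j := t)) i)" for i by (cases "i = j") auto
qed

text \<open>The complement of the closed support is open, so near such a point \<open>F\<close>
  vanishes along the coordinate line and its derivative is 0. Differentiation therefore does not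
  enlarge the support.\<close>

lemma test_function_partial_deriv:
  assumes F: "test_function d F" and j: "j < d"
  shows "test_function d (partial_deriv j F)"
proof (rule test_functionI[OF _ test_functionD(2)[OF F]])
  let ?K = "closure {x \<in> Rd d. F x \<noteq> 0}"
  show "smooth_alg d (partial_deriv j F)"
    using F j by (intro smooth_alg.base smooth_partial_deriv) (auto simp: test_function_def)
  fix x assume x: "x \<in> Rd d" and nz: "partial_deriv j F x \<noteq> 0"
  show "x \<in> ?K"
  proof (rule ccontr)
    assume "x \<notin> ?K"
    have "open ((\<lambda>t. x(j := t)) -` (- ?K))"
      by (rule open_vimage[OF _ continuous_on_fun_upd]) auto
    moreover have "0 = F (x(j := t))" if "t \<in> (\<lambda>t. x(j := t)) -` (- ?K)" for t
    proof (rule ccontr)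
      assume "0 \<noteq> F (x(j := t))"
      then have "x(j := t) \<in> ?K" using x j closure_subset[of "{x \<in> Rd d. F x \<noteq> 0}"] by auto
      then show False using that by simp
    qed
    ultimately have "((\<lambda>t. F (x(j := t))) has_real_derivative 0) (at (x j))"
      using \<open>x \<notin> ?K\<close> by (intro has_field_derivative_transform_within_open[OF DERIV_const[of 0]]) auto
    then show False using nz partial_deriv_eq by blast
  qed
qed

section \<open>Integration by parts against the Gaussian measure\<close>

text \<open>The polynomial factor of the n-th derivative of the standard normal density: the
  probabilists' Hermite polynomial times (-1)^n.\<close>

primrec hermite_poly :: "nat \<Rightarrow> real poly" where
  "hermite_poly 0 = 1"
| "hermite_poly (Suc n) = pderiv (hermite_poly n) - [:0, 1:] * hermite_poly n"

lemma DERIV_std_normal_density: "(std_normal_density has_real_derivative - t * std_normal_density t) (at t)"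
proof -
  have "((\<lambda>t. exp (- t\<^sup>2 / 2)) has_real_derivative exp (- t\<^sup>2 / 2) * - t) (at t)"
    by (auto intro!: derivative_eq_intros)
  from DERIV_cmult[OF this, of "1 / sqrt (2 * pi)"] show ?thesis
    by (simp add: normal_density_def[abs_def] mult_ac)
qed

lemma deriv_chain_std_normal: "deriv_chain (\<lambda>n t. poly (hermite_poly n) t * std_normal_density t)"
  unfolding deriv_chain_def
proof (intro allI)
  fix n t
  from DERIV_mult[OF poly_DERIV[of "hermite_poly n" t] DERIV_std_normal_density[of t]]
  show "((\<lambda>t. poly (hermite_poly n) t * std_normal_density t) has_real_derivative
      poly (hermite_poly (Suc n)) t * std_normal_density t) (at t)"
    by (simp add: algebra_simps)
qed

lemma smooth_alg_gauss_density: "smooth_alg d (gauss_density d)"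
  using smooth_alg_prod[of d "\<lambda>_ n t. poly (hermite_poly n) t * std_normal_density t" d "\<lambda>_. 0"]
    deriv_chain_std_normal by (simp add: gauss_density_def[abs_def])

lemma smooth_alg_coord: "i < d \<Longrightarrow> smooth_alg d (\<lambda>x. x i)"
proof -
  assume i: "i < d"
  have "deriv_chain (\<lambda>n t. if n = 0 then t else if n = 1 then 1 else 0)"
    by (auto simp: deriv_chain_def)
  from smooth_alg.coord[OF i this, of 0] show ?thesis by simp
qed

lemma DERIV_gauss_density:
  assumes "j < d"
  shows "((\<lambda>t. gauss_density d (x(j := t))) has_real_derivative - x j * gauss_density d x) (at (x j))"
proof -
  define c where "c = (\<Prod>i\<in>{..<d} - {j}. std_normal_density (x i))"
  have eq: "gauss_density d (x(j := t)) = std_normal_density t * c" for t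
    unfolding gauss_density_def c_def using assms
    by (subst prod.remove[of _ j]) (auto intro!: arg_cong2[where f="(*)"] prod.cong)
  have "((\<lambda>t. std_normal_density t * c) has_real_derivative - x j * std_normal_density (x j) * c) (at (x j))"
    by (rule DERIV_cmult_right) (rule DERIV_std_normal_density)
  moreover have "gauss_density d x = std_normal_density (x j) * c" using eq[of "x j"] by simp
  ultimately show ?thesis unfolding eq by (simp add: mult.assoc)
qed

lemma integral_gaussian:
  assumes "f \<in> borel_measurable (lebesgue_Rd d)"
  shows "(\<integral>x. f x \<partial>gaussian d) = (\<integral>x. gauss_density d x * f x \<partial>lebesgue_Rd d)"
  unfolding gaussian_eq_density using assms
  by (subst integral_density) (auto intro!: AE_I2 less_imp_le gauss_density_pos)

lemma integrable_gaussian_iff: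
  assumes "f \<in> borel_measurable (lebesgue_Rd d)"
  shows "integrable (gaussian d) f \<longleftrightarrow> integrable (lebesgue_Rd d) (\<lambda>x. gauss_density d x * f x)"
  unfolding gaussian_eq_density using assms
  by (subst integrable_density) (auto intro!: AE_I2 less_imp_le gauss_density_pos)

lemma integrable_mult_test_function:
  assumes u: "integrable (gaussian d) u" and F: "test_function d F"
  shows "integrable (gaussian d) (\<lambda>x. u x * F x)"
proof -
  obtain C where C: "\<And>x. x \<in> Rd d \<Longrightarrow> \<bar>F x\<bar> \<le> C" using test_function_bounded[OF F] by blast
  have [measurable]: "F \<in> borel_measurable (gaussian d)"
    using test_functionD(4)[OF F] by (simp add: measurable_gaussian_iff)
  note u[THEN borel_measurable_integrable, measurable]
  show ?thesis
  proof (rule Bochner_Integration.integrable_bound[OF integrable_mult_right[OF u, of C]])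
    show "AE x in gaussian d. norm (u x * F x) \<le> norm (C * u x)"
    proof (rule AE_I2)
      fix x assume "x \<in> space (gaussian d)"
      then have "\<bar>F x\<bar> \<le> \<bar>C\<bar>" using C[of x] by simp
      then show "norm (u x * F x) \<le> norm (C * u x)"
        by (simp add: abs_mult mult.commute mult_right_mono)
    qed
  qed measurable
qed

text \<open>Test the distributional derivative against \<open>F\<close> times the Gaussian density.\<close>

lemma gaussian_integration_by_parts:
  assumes u: "integrable (gaussian d) u" and g: "integrable (gaussian d) g"
    and D: "distributional_deriv d j u g" and j: "j < d" and F: "test_function d F"
  shows "(\<integral>x. u x * partial_deriv j F x \<partial>gaussian d) = (\<integral>x. (x j * u x - g x) * F x \<partial>gaussian d)"
    and "integrable (gaussian d) (\<lambda>x. (x j * u x - g x) * F x)"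
    and "integrable (gaussian d) (\<lambda>x. u x * partial_deriv j F x)"
proof -
  define W where "W x = F x * gauss_density d x" for x
  have W: "test_function d W"
    unfolding W_def by (rule test_function_mult[OF F smooth_alg_gauss_density])
  have xF: "test_function d (\<lambda>x. F x * x j)" by (rule test_function_mult[OF F smooth_alg_coord[OF j]])
  have pW: "partial_deriv j W x = gauss_density d x * (partial_deriv j F x - x j * F x)" if x: "x \<in> Rd d" for x
  proof (rule partial_deriv_eq)
    have "smooth d F" using F by (simp add: test_function_def)
    from DERIV_mult[OF smooth_DERIV[OF this x j] DERIV_gauss_density[OF j, of x]]
    show "((\<lambda>t. W (x(j := t))) has_real_derivative gauss_density d x * (partial_deriv j F x - x j * F x)) (at (x j))"
      unfolding W_def by (simp add: algebra_simps)
  qed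
  have meas: "u \<in> borel_measurable (lebesgue_Rd d)" "g \<in> borel_measurable (lebesgue_Rd d)"
    using u g by (auto simp flip: measurable_gaussian_iff)
  note Fm = test_functionD(4)[OF F] test_functionD(4)[OF test_function_partial_deriv[OF F j]] measurable_coord[OF j]
  show 1: "integrable (gaussian d) (\<lambda>x. u x * partial_deriv j F x)"
    by (rule integrable_mult_test_function[OF u test_function_partial_deriv[OF F j]])
  have 2: "integrable (gaussian d) (\<lambda>x. u x * (F x * x j))" by (rule integrable_mult_test_function[OF u xF])
  have 3: "integrable (gaussian d) (\<lambda>x. g x * F x)" by (rule integrable_mult_test_function[OF g F])
  have eq: "(x j * u x - g x) * F x = u x * (F x * x j) - g x * F x" for x by (simp add: algebra_simps)
  show "integrable (gaussian d) (\<lambda>x. (x j * u x - g x) * F x)"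
    unfolding eq using 2 3 by (rule Bochner_Integration.integrable_diff)
  have "(\<integral>x. u x * partial_deriv j F x \<partial>gaussian d) - (\<integral>x. u x * (F x * x j) \<partial>gaussian d) =
      (\<integral>x. u x * (partial_deriv j F x - x j * F x) \<partial>gaussian d)"
    using Bochner_Integration.integral_diff[OF 1 2] by (simp add: algebra_simps)
  also have "\<dots> = (\<integral>x. gauss_density d x * (u x * (partial_deriv j F x - x j * F x)) \<partial>lebesgue_Rd d)"
    by (rule integral_gaussian) (intro borel_measurable_times borel_measurable_diff meas Fm)
  also have "\<dots> = (\<integral>x. u x * partial_deriv j W x \<partial>lebesgue_Rd d)"
    by (rule Bochner_Integration.integral_cong) (auto simp: pW)
  also have "\<dots> = - (\<integral>x. g x * W x \<partial>lebesgue_Rd d)"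
    using D W by (auto simp: distributional_deriv_def)
  also have "(\<integral>x. g x * W x \<partial>lebesgue_Rd d) = (\<integral>x. gauss_density d x * (g x * F x) \<partial>lebesgue_Rd d)"
    by (simp add: W_def mult_ac)
  also have "\<dots> = (\<integral>x. g x * F x \<partial>gaussian d)"
    by (rule integral_gaussian[symmetric]) (intro borel_measurable_times meas Fm)
  finally show "(\<integral>x. u x * partial_deriv j F x \<partial>gaussian d) = (\<integral>x. (x j * u x - g x) * F x \<partial>gaussian d)"
    unfolding eq using Bochner_Integration.integral_diff[OF 2 3] by simp
qed

text \<open>On a probability space |f| <= 1 + |f|^p, so every exponent p >= 1 gives
  integrability.\<close>

lemma in_Lp_integrable:
  assumes M: "prob_space M" and p: "1 \<le> p" and f: "in_Lp M p f" and g: "g \<in> borel_measurable M"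
    and le: "\<And>x. \<bar>g x\<bar> \<le> f x"
  shows "integrable M g"
proof -
  interpret prob_space M by fact
  have "integrable M (\<lambda>x. 1 + \<bar>f x\<bar> powr p)" using f by (auto simp: in_Lp_def)
  then show ?thesis
  proof (rule Bochner_Integration.integrable_bound[OF _ g], intro AE_I2)
    fix x
    have "\<bar>f x\<bar> \<le> 1 + \<bar>f x\<bar> powr p"
    proof (cases "\<bar>f x\<bar> \<le> 1")
      case False
      then have "\<bar>f x\<bar> powr 1 \<le> \<bar>f x\<bar> powr p" using p by (intro powr_mono) auto
      then show ?thesis using False by simp
    qed (simp add: add_increasing2)
    then show "norm (g x) \<le> norm (1 + \<bar>f x\<bar> powr p)" using le[of x] by simp
  qed
qed

lemma gaussian_sobolev_integrable:
  assumes "gaussian_sobolev d p V DV" "1 \<le> p"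
  shows "i < d \<Longrightarrow> integrable (gaussian d) (\<lambda>x. V x i)"
    and "i < d \<Longrightarrow> j < d \<Longrightarrow> integrable (gaussian d) (\<lambda>x. DV x i j)"
proof -
  assume i: "i < d"
  then show "integrable (gaussian d) (\<lambda>x. V x i)"
    using assms unfolding gaussian_sobolev_def
    by (intro in_Lp_integrable[OF prob_space_gaussian assms(2), where f="\<lambda>x. euclidean_norm d (V x)"])
      (auto intro: abs_le_euclidean_norm)
  assume "j < d"
  with i show "integrable (gaussian d) (\<lambda>x. DV x i j)"
    using assms unfolding gaussian_sobolev_def
    by (intro in_Lp_integrable[OF prob_space_gaussian assms(2), where f="\<lambda>x. HS_norm d (DV x)"])
      (auto intro: abs_le_HS_norm)
qed

text \<open>Integration by parts in direction i for the i-th component, summed over i. It identifies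
  the distributional divergence with the explicit function.\<close>

lemma gaussian_divergence_divergence_fun:
  assumes V: "gaussian_sobolev d p V DV" and p: "1 \<le> p"
  shows "gaussian_divergence d V (divergence_fun d V DV)"
  unfolding gaussian_divergence_def
proof (intro allI impI)
  fix F assume F: "test_function d F"
  note int = gaussian_sobolev_integrable[OF V p]
  have D: "distributional_deriv d i (\<lambda>x. V x i) (\<lambda>x. DV x i i)" if "i < d" for i
    using V that by (simp add: gaussian_sobolev_def)
  note ibp = gaussian_integration_by_parts[OF int(1) int(2) D _ F]
  have eq: "divergence_fun d V DV x * F x = (\<Sum>i<d. (x i * V x i - DV x i i) * F x)" for x
    by (simp add: divergence_fun_def sum_subtractf flip: sum_distrib_right)
  show "integrable (gaussian d) (\<lambda>x. divergence_fun d V DV x * F x) \<and>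
        (\<integral>x. divergence_fun d V DV x * F x \<partial>gaussian d) =
        (\<integral>x. (\<Sum>i<d. V x i * partial_deriv i F x) \<partial>gaussian d)"
    unfolding eq using ibp by (auto simp: Bochner_Integration.integral_sum intro!: Bochner_Integration.integrable_sum)
qed

subsection \<open>Mollification\<close>

text \<open>A tensor product of one-dimensional mollifiers; \<open>m\<close> is a multi-index
  telling how often each factor is differentiated.\<close>

definition kernel :: "nat \<Rightarrow> (nat \<Rightarrow> real \<Rightarrow> real) \<Rightarrow> (nat \<Rightarrow> nat) \<Rightarrow> (nat \<Rightarrow> real) \<Rightarrow> (nat \<Rightarrow> real) \<Rightarrow> real" where
  "kernel d D m x y = (\<Prod>i<d. D (m i) (x i - y i))"

text \<open>The partial derivative with multi-index \<open>m\<close> of the mollification of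
  \<open>u\<close>, with all differentiations placed on the kernel.\<close>

definition conv :: "nat \<Rightarrow> (nat \<Rightarrow> real \<Rightarrow> real) \<Rightarrow> (nat \<Rightarrow> nat) \<Rightarrow> ((nat \<Rightarrow> real) \<Rightarrow> real) \<Rightarrow> (nat \<Rightarrow> real) \<Rightarrow> real" where
  "conv d D m u x = (\<integral>y. u y * kernel d D m x y \<partial>lebesgue_Rd d)"

abbreviation bump_index :: "(nat \<Rightarrow> nat) \<Rightarrow> nat \<Rightarrow> nat \<Rightarrow> nat" where
  "bump_index m j \<equiv> m(j := Suc (m j))"

lemma sigma_finite_lebesgue_Rd: "sigma_finite_measure (lebesgue_Rd d)"
  unfolding lebesgue_Rd_def by (rule lborel_product.sigma_finite) simp

interpretation lebesgue_Rd: sigma_finite_measure "lebesgue_Rd d" for d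
  by (rule sigma_finite_lebesgue_Rd)

interpretation lebesgue_pair: pair_sigma_finite "lebesgue_Rd d" "lebesgue_Rd d" for d ..

locale mollify =
  fixes d :: nat and \<epsilon> :: real and D :: "nat \<Rightarrow> real \<Rightarrow> real"
  assumes eps: "0 < \<epsilon>" and D: "mollifier \<epsilon> D"
begin

abbreviation "K \<equiv> kernel d D"

lemma D_chain: "deriv_chain D" and D_nonneg: "0 \<le> D 0 t" and D_support: "\<epsilon> < \<bar>t\<bar> \<Longrightarrow> D n t = 0"
  and D_integrable: "integrable lborel (D 0)" and D_integral: "(\<integral>t. D 0 t \<partial>lborel) = 1"
  using D by (auto simp: mollifier_def)

lemma D_measurable [measurable]: "D n \<in> borel_measurable borel"
  by (rule deriv_chain_measurable[OF D_chain])

lemma D_bounded: obtains C where "\<And>t. \<bar>D n t\<bar> \<le> C" "1 \<le> C"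
proof -
  have "compact (D n ` {-\<epsilon>..\<epsilon>})"
    by (intro compact_continuous_image deriv_chain_continuous D_chain) simp
  then obtain C where "\<forall>z\<in>D n ` {-\<epsilon>..\<epsilon>}. norm z \<le> C"
    using compact_imp_bounded[of "D n ` {-\<epsilon>..\<epsilon>}"] unfolding bounded_iff by blast
  then have C: "\<And>t. t \<in> {-\<epsilon>..\<epsilon>} \<Longrightarrow> \<bar>D n t\<bar> \<le> C" by simp
  have "\<bar>D n t\<bar> \<le> max 1 C" for t
  proof (cases "\<epsilon> < \<bar>t\<bar>")
    case False
    then have "t \<in> {-\<epsilon>..\<epsilon>}" by (cases "0 \<le> t") auto
    then have "\<bar>D n t\<bar> \<le> C" by (rule C)
    then show ?thesis by simp
  qed (simp add: D_support)
  then show ?thesis using that[of "max 1 C"] by auto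
qed

lemma K_bounded: obtains C where "\<And>x y. \<bar>K m x y\<bar> \<le> C"
proof -
  have "\<exists>C. \<forall>i. 1 \<le> C i \<and> (\<forall>t. \<bar>D (m i) t\<bar> \<le> C i)"
    by (intro choice allI) (metis D_bounded)
  then obtain C where C: "\<And>i t. \<bar>D (m i) t\<bar> \<le> C i" by blast
  have "\<bar>K m x y\<bar> \<le> (\<Prod>i<d. C i)" for x y
    unfolding kernel_def abs_prod using C by (intro prod_mono) auto
  then show ?thesis by (rule that)
qed

lemma K_support: "K m x y \<noteq> 0 \<Longrightarrow> i < d \<Longrightarrow> \<bar>x i - y i\<bar> \<le> \<epsilon>"
  unfolding kernel_def using D_support[of "x i - y i" "m i"] by (force simp: prod_zero_iff)

lemma K_meas:
  assumes "\<And>i. i < d \<Longrightarrow> (\<lambda>z. f z i) \<in> borel_measurable N" "\<And>i. i < d \<Longrightarrow> (\<lambda>z. g z i) \<in> borel_measurable N"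
  shows "(\<lambda>z. K m (f z) (g z)) \<in> borel_measurable N"
  unfolding kernel_def
  by (intro borel_measurable_prod measurable_compose[OF _ D_measurable] borel_measurable_diff assms) auto

lemma K_meas_right [measurable]: "K m x \<in> borel_measurable (lebesgue_Rd d)"
  using K_meas[of "\<lambda>_. x" "lebesgue_Rd d" "\<lambda>y. y" m] by simp

lemma K_remove: "j < d \<Longrightarrow> K m x y = D (m j) (x j - y j) * (\<Prod>i\<in>{..<d} - {j}. D (m i) (x i - y i))"
  unfolding kernel_def by (subst prod.remove[of _ j]) auto

lemma DERIV_K_left:
  assumes "smooth_path d c c'"
  shows "((\<lambda>t. K m (c t) y) has_real_derivative (\<Sum>j<d. c' t j * K (bump_index m j) (c t) y)) (at t)"
proof -
  have "((\<lambda>t. D (m i) (c t i - y i)) has_real_derivative D (Suc (m i)) (c t i - y i) * (c' t i - 0)) (at t)" if "i < d" for i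
    by (rule DERIV_chain2[OF deriv_chainD[OF D_chain]], rule DERIV_diff[OF _ DERIV_const])
      (use assms that in \<open>auto simp: smooth_path_def\<close>)
  then have "((\<lambda>t. K m (c t) y) has_real_derivative
      (\<Sum>i<d. D (Suc (m i)) (c t i - y i) * (c' t i - 0) * (\<Prod>j\<in>{..<d} - {i}. D (m j) (c t j - y j)))) (at t)"
    unfolding kernel_def by (intro has_field_derivative_prod) auto
  also have "(\<Sum>i<d. D (Suc (m i)) (c t i - y i) * (c' t i - 0) * (\<Prod>j\<in>{..<d} - {i}. D (m j) (c t j - y j))) =
      (\<Sum>j<d. c' t j * K (bump_index m j) (c t) y)"
  proof (intro sum.cong refl)
    fix i assume "i \<in> {..<d}"
    then show "D (Suc (m i)) (c t i - y i) * (c' t i - 0) * (\<Prod>j\<in>{..<d} - {i}. D (m j) (c t j - y j)) =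
        c' t i * K (bump_index m i) (c t) y"
      by (subst K_remove[of i]) (auto simp: mult_ac intro!: arg_cong2[where f="(*)"] prod.cong)
  qed
  finally show ?thesis .
qed

text \<open>As a function of the integration variable the kernel is a test function, so it may be
  inserted into the definition of the distributional derivative.\<close>

lemma test_function_K: "test_function d (K m x)"
proof (rule test_functionI[OF _ compact_box])
  have "deriv_chain (\<lambda>n t. 1 * (-1) ^ n * D (m i + n) (x i + (-1) * t))" for i
    by (rule deriv_chain_affine[OF D_chain])
  from smooth_alg_prod[OF this, of d d "\<lambda>_. 0"]
  show "smooth_alg d (K m x)" by (simp add: kernel_def[abs_def])
  show "y \<in> {y \<in> Rd d. \<forall>i<d. x i - \<epsilon> \<le> y i \<and> y i \<le> x i + \<epsilon>}" if "y \<in> Rd d" "K m x y \<noteq> 0" for y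
    using K_support[OF that(2)] that(1) by (auto simp: abs_le_iff) (smt (verit))+
qed

lemma partial_deriv_K:
  assumes "j < d" shows "partial_deriv j (K m x) y = - K (bump_index m j) x y"
proof (rule partial_deriv_eq)
  have "((\<lambda>t. D (m j) (x j - t)) has_real_derivative D (Suc (m j)) (x j - y j) * (0 - 1)) (at (y j))"
    by (rule DERIV_chain2[OF deriv_chainD[OF D_chain]], rule DERIV_diff[OF DERIV_const DERIV_ident])
  from DERIV_cmult_right[OF this, of "\<Prod>i\<in>{..<d} - {j}. D (m i) (x i - y i)"]
  have "((\<lambda>t. D (m j) (x j - t) * (\<Prod>i\<in>{..<d} - {j}. D (m i) (x i - y i))) has_real_derivative - K (bump_index m j) x y) (at (y j))"
    by (subst K_remove[OF assms]) (simp add: mult_ac cong: prod.cong_simp)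
  moreover have "K m x (y(j := t)) = D (m j) (x j - t) * (\<Prod>i\<in>{..<d} - {j}. D (m i) (x i - y i))" for t
    by (subst K_remove[OF assms]) (auto intro!: arg_cong2[where f="(*)"] prod.cong)
  ultimately show "((\<lambda>t. K m x (y(j := t))) has_real_derivative - K (bump_index m j) x y) (at (y j))" by simp
qed

text \<open>On bounded sets the Gaussian density is bounded below, so Gaussian integrability of \<open>u\<close>
  gives local Lebesgue integrability.\<close>

lemma mult_K_dominated:
  obtains C where "0 \<le> C" "\<And>x y u. (\<And>i. i < d \<Longrightarrow> \<bar>x i\<bar> \<le> r) \<Longrightarrow> \<bar>u * K m x y\<bar> \<le> C * \<bar>gauss_density d y * u\<bar>"
proof -
  obtain C where C: "\<And>x y. \<bar>K m x y\<bar> \<le> C" using K_bounded by blast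
  have C0: "0 \<le> C" using C[of "\<lambda>_. 0" "\<lambda>_. 0"] by linarith
  define b where "b = std_normal_density (\<bar>r\<bar> + \<epsilon>) ^ d"
  have b: "0 < b" by (simp add: b_def normal_density_pos)
  show ?thesis
  proof (rule that)
    show "0 \<le> C / b" using C0 b by simp
    fix x y :: "nat \<Rightarrow> real" and u :: real assume x: "\<And>i. i < d \<Longrightarrow> \<bar>x i\<bar> \<le> r"
    show "\<bar>u * K m x y\<bar> \<le> C / b * \<bar>gauss_density d y * u\<bar>"
    proof (cases "K m x y = 0")
      case False
      have "(\<Prod>i<d. std_normal_density (\<bar>r\<bar> + \<epsilon>)) \<le> gauss_density d y"
        unfolding gauss_density_def
      proof (intro prod_mono conjI)
        fix i assume "i \<in> {..<d}"
        then have "\<bar>y i\<bar> \<le> \<bar>r\<bar> + \<epsilon>" using K_support[OF False, of i] x[of i] by simp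
        then have "(y i)\<^sup>2 \<le> (\<bar>r\<bar> + \<epsilon>)\<^sup>2" by (simp add: abs_le_square_iff[symmetric])
        then show "std_normal_density (\<bar>r\<bar> + \<epsilon>) \<le> std_normal_density (y i)"
          by (simp add: normal_density_def divide_right_mono)
      qed simp
      then have "b \<le> gauss_density d y" by (simp add: b_def)
      then have "\<bar>u\<bar> * \<bar>K m x y\<bar> * b \<le> \<bar>u\<bar> * C * gauss_density d y"
        using C0 b by (intro mult_mono mult_left_mono C) auto
      then show ?thesis using b gauss_density_pos[of d y] by (simp add: abs_mult field_simps)
    qed (use C0 b in simp)
  qed
qed

context
  fixes u :: "(nat \<Rightarrow> real) \<Rightarrow> real"
  assumes u: "integrable (gaussian d) u"
begin

lemma u_meas [measurable]: "u \<in> borel_measurable (lebesgue_Rd d)"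
  using u by (auto simp flip: measurable_gaussian_iff)

lemma u_int: "integrable (lebesgue_Rd d) (\<lambda>x. gauss_density d x * u x)"
  using u u_meas by (simp add: integrable_gaussian_iff)

lemma integrable_conv: "integrable (lebesgue_Rd d) (\<lambda>y. u y * K m x y)"
proof -
  define r where "r = (\<Sum>i<d. \<bar>x i\<bar>)"
  have r: "\<And>i. i < d \<Longrightarrow> \<bar>x i\<bar> \<le> r"
    unfolding r_def by (rule member_le_sum[of _ _ "\<lambda>i. \<bar>x i\<bar>"]) auto
  obtain C where "\<And>y u. \<bar>u * K m x y\<bar> \<le> C * \<bar>gauss_density d y * u\<bar>"
    using mult_K_dominated[of r m] r by metis
  then show ?thesis
    by (intro Bochner_Integration.integrable_bound[OF integrable_mult_right[OF integrable_abs[OF u_int], of C]])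
      (auto intro!: AE_I2 intro: order.trans[OF _ abs_ge_self])
qed

text \<open>Differentiation under the integral on the interval (t - 1, t + 1): there the path and
  its velocity are bounded by compactness, so one multiple of the Gaussian-weighted |u|
  dominates.\<close>

lemma DERIV_conv:
  assumes c: "smooth_path d c c'"
  shows "((\<lambda>t. conv d D m u (c t)) has_real_derivative (\<Sum>j<d. conv d D (bump_index m j) u (c t) * c' t j)) (at t)"
proof -
  have c1: "\<And>t j. j < d \<Longrightarrow> ((\<lambda>t. c t j) has_real_derivative c' t j) (at t)"
    and c2: "\<And>j. j < d \<Longrightarrow> continuous_on UNIV (\<lambda>t. c' t j)"
    using c unfolding smooth_path_def by blast+
  have cont1: "continuous_on S (\<lambda>t. c t j)" if "j < d" for S j
    by (rule DERIV_continuous_on) (rule has_field_derivative_at_within[OF c1[OF that]])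
  have cont2: "continuous_on S (\<lambda>t. c' t j)" if "j < d" for S j
    by (rule continuous_on_subset[OF c2[OF that]]) simp
  have bdd: "\<exists>r. \<forall>j<d. \<forall>s\<in>{t - 1..t + 1}. \<bar>f s j\<bar> \<le> r" if f: "\<And>j. j < d \<Longrightarrow> continuous_on {t - 1..t + 1} (\<lambda>t. f t j)" for f :: "real \<Rightarrow> nat \<Rightarrow> real"
  proof -
    have "compact (\<Union>j<d. (\<lambda>s. f s j) ` {t - 1..t + 1})"
      by (intro compact_UN compact_continuous_image f) auto
    from compact_imp_bounded[OF this]
    obtain r where r: "\<forall>z\<in>(\<Union>j<d. (\<lambda>s. f s j) ` {t - 1..t + 1}). norm z \<le> r"
      unfolding bounded_iff by (elim exE)
    have "\<bar>f s j\<bar> \<le> r" if "j < d" "s \<in> {t - 1..t + 1}" for j s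
    proof -
      have "f s j \<in> (\<Union>j<d. (\<lambda>s. f s j) ` {t - 1..t + 1})"
        by (rule UN_I[of j], use that in simp, rule imageI, rule that)
      then have "norm (f s j) \<le> r" by (rule bspec[OF r])
      then show ?thesis by simp
    qed
    then show ?thesis by blast
  qed
  obtain r where r: "\<And>j s. j < d \<Longrightarrow> s \<in> {t - 1..t + 1} \<Longrightarrow> \<bar>c s j\<bar> \<le> r" using bdd[of c, OF cont1] by blast
  obtain r' where r': "\<And>j s. j < d \<Longrightarrow> s \<in> {t - 1..t + 1} \<Longrightarrow> \<bar>c' s j\<bar> \<le> r'" using bdd[of c', OF cont2] by blast
  have "\<exists>C. \<forall>j. 0 \<le> C j \<and> (\<forall>x y u. (\<forall>i<d. \<bar>x i\<bar> \<le> r) \<longrightarrow> \<bar>u * K (bump_index m j) x y\<bar> \<le> C j * \<bar>gauss_density d y * u\<bar>)"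
  proof (intro choice allI)
    fix j
    obtain C where "0 \<le> C" "\<And>x y u. (\<And>i. i < d \<Longrightarrow> \<bar>x i\<bar> \<le> r) \<Longrightarrow> \<bar>u * K (bump_index m j) x y\<bar> \<le> C * \<bar>gauss_density d y * u\<bar>"
      using mult_K_dominated[of r "bump_index m j"] by blast
    then show "\<exists>C. 0 \<le> C \<and> (\<forall>x y u. (\<forall>i<d. \<bar>x i\<bar> \<le> r) \<longrightarrow> \<bar>u * K (bump_index m j) x y\<bar> \<le> C * \<bar>gauss_density d y * u\<bar>)"
      by blast
  qed
  then obtain C where C0: "\<And>j. 0 \<le> C j"
    and C: "\<And>j x y u. (\<And>i. i < d \<Longrightarrow> \<bar>x i\<bar> \<le> r) \<Longrightarrow> \<bar>u * K (bump_index m j) x y\<bar> \<le> C j * \<bar>gauss_density d y * u\<bar>" by blast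
  have "((\<lambda>t. \<integral>y. u y * K m (c t) y \<partial>lebesgue_Rd d) has_real_derivative
      (\<integral>y. (\<Sum>j<d. c' t j * (u y * K (bump_index m j) (c t) y)) \<partial>lebesgue_Rd d)) (at t)"
  proof (rule DERIV_integral_dominated[where a="t - 1" and b="t + 1"
        and D="\<lambda>y. (\<Sum>j<d. r' * C j) * \<bar>gauss_density d y * u y\<bar>"])
    fix s y assume s: "s \<in> {t - 1<..<t + 1}"
    show "((\<lambda>s. u y * K m (c s) y) has_real_derivative (\<Sum>j<d. c' s j * (u y * K (bump_index m j) (c s) y))) (at s)"
      using DERIV_cmult[OF DERIV_K_left[OF c, of m y s], of "u y"] by (simp add: sum_distrib_left mult_ac)
    have "\<bar>\<Sum>j<d. c' s j * (u y * K (bump_index m j) (c s) y)\<bar> \<le> (\<Sum>j<d. \<bar>c' s j * (u y * K (bump_index m j) (c s) y)\<bar>)"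
      by (rule sum_abs)
    also have "\<dots> \<le> (\<Sum>j<d. r' * (C j * \<bar>gauss_density d y * u y\<bar>))"
    proof (rule sum_mono)
      fix j assume "j \<in> {..<d}"
      then have "\<bar>c' s j\<bar> \<le> r'" using r' s by simp
      moreover have "\<bar>u y * K (bump_index m j) (c s) y\<bar> \<le> C j * \<bar>gauss_density d y * u y\<bar>"
        by (rule C) (use r s in simp)
      ultimately show "\<bar>c' s j * (u y * K (bump_index m j) (c s) y)\<bar> \<le> r' * (C j * \<bar>gauss_density d y * u y\<bar>)"
        unfolding abs_mult[of "c' s j"] by (intro mult_mono) auto
    qed
    finally show "\<bar>\<Sum>j<d. c' s j * (u y * K (bump_index m j) (c s) y)\<bar> \<le> (\<Sum>j<d. r' * C j) * \<bar>gauss_density d y * u y\<bar>"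
      by (simp add: sum_distrib_right mult.assoc)
  qed (use integrable_conv in \<open>auto intro!: integrable_mult_right integrable_abs u_int\<close>)
  also have "(\<integral>y. (\<Sum>j<d. c' t j * (u y * K (bump_index m j) (c t) y)) \<partial>lebesgue_Rd d) =
      (\<Sum>j<d. conv d D (bump_index m j) u (c t) * c' t j)"
    unfolding conv_def
    by (subst Bochner_Integration.integral_sum) (auto intro!: integrable_mult_right integrable_conv simp: mult.commute)
  finally show ?thesis unfolding conv_def .
qed

lemma conv_meas: "conv d D m u \<in> borel_measurable (lebesgue_Rd d)"
proof -
  have "(\<lambda>(x, y). u y * K m x y) \<in> borel_measurable (lebesgue_Rd d \<Otimes>\<^sub>M lebesgue_Rd d)"
    unfolding case_prod_unfold
    by (intro borel_measurable_times K_meas measurable_compose[OF measurable_snd u_meas]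
        measurable_compose[OF measurable_fst measurable_coord] measurable_compose[OF measurable_snd measurable_coord])
  then show ?thesis
    unfolding conv_def[abs_def] by (rule lebesgue_Rd.borel_measurable_lebesgue_integral)
qed

text \<open>Two signs cancel: one from the definition of the distributional derivative, one from
  differentiating the kernel in its second argument.\<close>

lemma conv_distributional_deriv:
  assumes g: "distributional_deriv d j u g" and j: "j < d"
  shows "conv d D m g x = conv d D (bump_index m j) u x"
proof -
  have "(\<integral>y. u y * - K (bump_index m j) x y \<partial>lebesgue_Rd d) = - (\<integral>y. g y * K m x y \<partial>lebesgue_Rd d)"
    using g test_function_K[of m x] unfolding distributional_deriv_def by (auto simp: partial_deriv_K[OF j])
  then show ?thesis by (simp add: conv_def)
qed

end

lemma D_abs_integrable: "integrable lborel (\<lambda>t. \<bar>D n t\<bar>)"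
proof -
  have "set_integrable lborel {-\<epsilon>..\<epsilon>} (D n)"
    by (intro borel_integrable_atLeastAtMost' deriv_chain_continuous D_chain)
  moreover have "indicator {-\<epsilon>..\<epsilon>} t *\<^sub>R D n t = D n t" for t
    using D_support[of t n] by (cases "\<epsilon> < \<bar>t\<bar>") (auto simp: indicator_def)
  ultimately have "integrable lborel (D n)" unfolding set_integrable_def by (simp only:)
  then show ?thesis by (rule integrable_abs)
qed

lemma
  shows integrable_abs_K: "integrable (lebesgue_Rd d) (\<lambda>y. \<bar>K m x y\<bar>)"
    and integral_abs_K: "(\<integral>y. \<bar>K m x y\<bar> \<partial>lebesgue_Rd d) = (\<Prod>i<d. \<integral>t. \<bar>D (m i) t\<bar> \<partial>lborel)"
proof -
  have int: "integrable lborel (\<lambda>t. \<bar>D n (a - t)\<bar>)" for n a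
    using lborel_integrable_real_affine[OF D_abs_integrable[of n], of "-1" a] by simp
  have "(\<integral>t. \<bar>D n (a - t)\<bar> \<partial>lborel) = (\<integral>t. \<bar>D n t\<bar> \<partial>lborel)" for n a
    using lborel_integral_real_affine[of "-1" "\<lambda>t. \<bar>D n t\<bar>" a] by simp
  then show "integrable (lebesgue_Rd d) (\<lambda>y. \<bar>K m x y\<bar>)"
    "(\<integral>y. \<bar>K m x y\<bar> \<partial>lebesgue_Rd d) = (\<Prod>i<d. \<integral>t. \<bar>D (m i) t\<bar> \<partial>lborel)"
    unfolding kernel_def abs_prod lebesgue_Rd_def
    using lborel_product.product_integrable_prod[of "{..<d}" "\<lambda>i t. \<bar>D (m i) (x i - t)\<bar>"]
      lborel_product.product_integral_prod[of "{..<d}" "\<lambda>i t. \<bar>D (m i) (x i - t)\<bar>"] int by simp_all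
qed

lemma K_0_nonneg: "0 \<le> K (\<lambda>_. 0) x y"
  by (simp add: kernel_def prod_nonneg D_nonneg)

lemma
  shows integrable_K_0: "integrable (lebesgue_Rd d) (K (\<lambda>_. 0) x)"
    and integral_K_0: "(\<integral>y. K (\<lambda>_. 0) x y \<partial>lebesgue_Rd d) = 1"
  using integrable_abs_K[of "\<lambda>_. 0" x] integral_abs_K[of "\<lambda>_. 0" x] K_0_nonneg
  by (simp_all add: D_nonneg D_integral)

lemma conv_bound:
  assumes g: "integrable (gaussian d) g" and "AE y in lebesgue_Rd d. \<bar>g y\<bar> \<le> L"
  shows "\<bar>conv d D m g x\<bar> \<le> L * (\<Prod>i<d. \<integral>t. \<bar>D (m i) t\<bar> \<partial>lborel)"
proof -
  have "\<bar>conv d D m g x\<bar> \<le> (\<integral>y. \<bar>g y * K m x y\<bar> \<partial>lebesgue_Rd d)"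
    unfolding conv_def using integral_abs_bound by blast
  also have "\<dots> \<le> (\<integral>y. L * \<bar>K m x y\<bar> \<partial>lebesgue_Rd d)"
  proof (rule integral_mono_AE)
    show "AE y in lebesgue_Rd d. \<bar>g y * K m x y\<bar> \<le> L * \<bar>K m x y\<bar>"
      using assms(2) by eventually_elim (simp add: abs_mult mult_right_mono)
  qed (intro integrable_abs integrable_conv[OF g] integrable_mult_right integrable_abs_K)+
  finally show ?thesis using integral_abs_K by simp
qed

end

lemma AE_lebesgue_Rd_iff: "(AE x in gaussian d. P x) \<longleftrightarrow> (AE x in lebesgue_Rd d. P x)"
  unfolding gaussian_eq_density by (subst AE_density) (auto simp: gauss_density_pos)

text \<open>Averaging with a probability kernel does not increase the Hilbert-Schmidt norm. By
  duality, pairing the averaged matrix with itself gives h^2 <= h L; thus the constant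
  \<open>L\<close> is preserved exactly.\<close>

lemma (in mollify) HS_norm_conv_le:
  assumes int: "\<And>i j. i < d \<Longrightarrow> j < d \<Longrightarrow> integrable (gaussian d) (\<lambda>x. M x i j)"
    and L: "AE x in lebesgue_Rd d. HS_norm d (M x) \<le> L"
  shows "HS_norm d (\<lambda>i j. conv d D (\<lambda>_. 0) (\<lambda>y. M y i j) x) \<le> L"
proof -
  let ?K = "K (\<lambda>_. 0) x"
  define A where "A = (\<lambda>i j. conv d D (\<lambda>_. 0) (\<lambda>y. M y i j) x)"
  define h where "h = HS_norm d A"
  have intK: "integrable (lebesgue_Rd d) (\<lambda>y. A i j * (M y i j * ?K y))" if "i < d" "j < d" for i j
    using integrable_conv[OF int[OF that]] by (rule integrable_mult_right)
  have "h\<^sup>2 = (\<Sum>i<d. \<Sum>j<d. A i j * A i j)" unfolding h_def HS_norm_sqr by (simp add: power2_eq_square)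
  also have "\<dots> = (\<Sum>i<d. \<Sum>j<d. \<integral>y. A i j * (M y i j * ?K y) \<partial>lebesgue_Rd d)"
    by (intro sum.cong refl) (simp add: A_def conv_def)
  also have "\<dots> = (\<integral>y. (\<Sum>i<d. \<Sum>j<d. A i j * (M y i j * ?K y)) \<partial>lebesgue_Rd d)"
  proof -
    have "(\<Sum>i<d. \<Sum>j<d. \<integral>y. A i j * (M y i j * ?K y) \<partial>lebesgue_Rd d) =
        (\<Sum>i<d. \<integral>y. (\<Sum>j<d. A i j * (M y i j * ?K y)) \<partial>lebesgue_Rd d)"
      by (rule sum.cong[OF refl], rule Bochner_Integration.integral_sum[symmetric]) (rule intK, simp_all only: lessThan_iff)
    then show ?thesis
      by (simp only:) (rule Bochner_Integration.integral_sum[symmetric], rule Bochner_Integration.integrable_sum, rule intK, simp_all only: lessThan_iff)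
  qed
  also have "\<dots> \<le> (\<integral>y. h * L * ?K y \<partial>lebesgue_Rd d)"
  proof (rule integral_mono_AE)
    show "AE y in lebesgue_Rd d. (\<Sum>i<d. \<Sum>j<d. A i j * (M y i j * ?K y)) \<le> h * L * ?K y"
      using L
    proof eventually_elim
      case (elim y)
      have "(\<Sum>i<d. \<Sum>j<d. A i j * M y i j) = (\<Sum>(i, j)\<in>{..<d}\<times>{..<d}. A i j * M y i j)"
        by (rule sum.cartesian_product)
      also have "\<dots> \<le> (\<Sum>z\<in>{..<d}\<times>{..<d}. \<bar>case_prod A z\<bar> * \<bar>case_prod (M y) z\<bar>)"
        by (intro sum_mono) (auto simp: abs_mult[symmetric])
      also have "\<dots> \<le> h * HS_norm d (M y)"
        unfolding h_def HS_norm_def by (rule L2_set_mult_ineq)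
      also have "\<dots> \<le> h * L" using elim by (intro mult_left_mono) (auto simp: h_def)
      finally have "(\<Sum>i<d. \<Sum>j<d. A i j * M y i j) * ?K y \<le> h * L * ?K y"
        by (intro mult_right_mono K_0_nonneg)
      then show ?case by (simp add: sum_distrib_right mult.assoc)
    qed
    show "integrable (lebesgue_Rd d) (\<lambda>y. \<Sum>i<d. \<Sum>j<d. A i j * (M y i j * ?K y))"
      using intK by (intro Bochner_Integration.integrable_sum) auto
    show "integrable (lebesgue_Rd d) (\<lambda>y. h * L * ?K y)" by (intro integrable_mult_right integrable_K_0)
  qed
  also have "\<dots> = h * L" by (simp add: integral_K_0)
  finally have le: "h * h \<le> h * L" by (simp add: power2_eq_square)
  have "0 \<le> h" by (simp add: h_def)
  then consider "h = 0" | "0 < h" by linarith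
  then have "h \<le> L"
  proof cases
    case 1
    \<comment> \<open>For h = 0 the claim is 0 <= L. As the bound by \<open>L\<close> holds only
      almost everywhere, this is obtained by integrating against the kernel of mass 1.\<close>
    have "(\<integral>y. 0 * ?K y \<partial>lebesgue_Rd d) \<le> (\<integral>y. L * ?K y \<partial>lebesgue_Rd d)"
    proof (rule integral_mono_AE)
      show "AE y in lebesgue_Rd d. 0 * ?K y \<le> L * ?K y"
        using L
      proof eventually_elim
        case (elim y)
        have "0 \<le> L" using elim HS_norm_nonneg[of d "M y"] by linarith
        then show ?case using K_0_nonneg[of x y] by simp
      qed
    qed (intro integrable_mult_right integrable_K_0)+
    then show ?thesis by (simp add: integral_K_0 1)
  qed (use le in simp)
  then show ?thesis by (simp add: h_def A_def)
qed

text \<open>\<open>H\<close> is symmetric because both orders of differentiation put the same two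
  derivatives on the kernel and act on the same component of V. The free constant \<open>a\<close>
  does not affect derivatives and is later chosen to centre the field.\<close>

lemma (in mollify) smooth_field_conv:
  assumes V: "gaussian_sobolev d p V DV" and p: "1 \<le> p"
    and L: "AE x in gaussian d. HS_norm d (DV x) \<le> L" and L0: "0 < L"
  shows "\<exists>H B. smooth_field d (\<lambda>x i. conv d D (\<lambda>_. 0) (\<lambda>y. V y i) x - a i)
     (\<lambda>x i j. conv d D (\<lambda>_. 0) (\<lambda>y. DV y i j) x) H L B"
proof -
  define o' where "o' = (\<lambda>_::nat. 0::nat)"
  define H where "H x i j k = conv d D (bump_index o' k) (\<lambda>y. DV y i j) x" for x i j k
  define B where "B = (\<Sum>k<d. L * (\<Prod>i<d. \<integral>t. \<bar>D (bump_index o' k i) t\<bar> \<partial>lborel))"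
  note int = gaussian_sobolev_integrable[OF V p]
  have dd: "distributional_deriv d j (\<lambda>x. V x i) (\<lambda>x. DV x i j)" if "i < d" "j < d" for i j
    using V that by (simp add: gaussian_sobolev_def)
  note conv_dd = conv_distributional_deriv[OF int(1) dd]
  have L': "AE x in lebesgue_Rd d. HS_norm d (DV x) \<le> L" using L by (simp add: AE_lebesgue_Rd_iff)
  have "smooth_field d (\<lambda>x i. conv d D o' (\<lambda>y. V y i) x - a i) (\<lambda>x i j. conv d D o' (\<lambda>y. DV y i j) x) H L B"
  proof
    fix c c' i t assume c: "smooth_path d c c'" and i: "i < d"
    have "((\<lambda>t. conv d D o' (\<lambda>y. V y i) (c t) - a i) has_real_derivative
        (\<Sum>j<d. conv d D (bump_index o' j) (\<lambda>y. V y i) (c t) * c' t j) - 0) (at t)"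
      by (intro DERIV_diff DERIV_const DERIV_conv[OF int(1)[OF i] c])
    then show "((\<lambda>t. conv d D o' (\<lambda>y. V y i) (c t) - a i) has_real_derivative
        (\<Sum>j<d. conv d D o' (\<lambda>y. DV y i j) (c t) * c' t j)) (at t)"
      using conv_dd[OF i i] conv_dd i by simp
  next
    fix c c' i j t assume c: "smooth_path d c c'" and i: "i < d" "j < d"
    show "((\<lambda>t. conv d D o' (\<lambda>y. DV y i j) (c t)) has_real_derivative (\<Sum>k<d. H (c t) i j k * c' t k)) (at t)"
      unfolding H_def by (rule DERIV_conv[OF int(2)[OF i] c])
  next
    fix x i j k assume i: "i < d" "j < d" "k < d"
    have "bump_index (bump_index o' k) j = bump_index (bump_index o' j) k" by (auto simp: fun_eq_iff)
    then show "H x i j k = H x i k j" unfolding H_def using conv_dd i by simp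
    have "\<bar>DV y i j\<bar> \<le> L" if "HS_norm d (DV y) \<le> L" for y using abs_le_HS_norm[OF i(1,2), of "DV y"] that by linarith
    then have "AE y in lebesgue_Rd d. \<bar>DV y i j\<bar> \<le> L" using L' by (auto elim: eventually_mono)
    then have "\<bar>H x i j k\<bar> \<le> L * (\<Prod>i<d. \<integral>t. \<bar>D (bump_index o' k i) t\<bar> \<partial>lborel)"
      unfolding H_def by (rule conv_bound[OF int(2)[OF i(1,2)]])
    also have "\<dots> \<le> B"
      unfolding B_def using i L0
      by (intro member_le_sum[of k _ "\<lambda>k. L * (\<Prod>i<d. \<integral>t. \<bar>D (bump_index o' k i) t\<bar> \<partial>lborel)"])
        (auto intro!: mult_nonneg_nonneg prod_nonneg integral_nonneg_AE)
    finally show "\<bar>H x i j k\<bar> \<le> B" .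
  next
    fix x show "HS_norm d (\<lambda>i j. conv d D o' (\<lambda>y. DV y i j) x) \<le> L"
      unfolding o'_def by (rule HS_norm_conv_le[OF int(2) L'])
  qed (use L0 in \<open>auto simp: H_def intro!: borel_measurable_diff conv_meas int\<close>)
  then show ?thesis unfolding o'_def by blast
qed

subsection \<open>Convergence of mollifications\<close>

context mollify
begin

abbreviation cv :: "((nat \<Rightarrow> real) \<Rightarrow> real) \<Rightarrow> (nat \<Rightarrow> real) \<Rightarrow> real" where
  "cv \<equiv> conv d D (\<lambda>_. 0)"

lemma integrable_mult_K:
  assumes v: "integrable (lebesgue_Rd d) v" shows "integrable (lebesgue_Rd d) (\<lambda>y. v y * K m x y)"
proof -
  obtain C where C: "\<And>x y. \<bar>K m x y\<bar> \<le> C" using K_bounded by blast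
  show ?thesis
  proof (rule Bochner_Integration.integrable_bound[OF integrable_mult_right[OF integrable_abs[OF v], of C]])
    show "AE y in lebesgue_Rd d. norm (v y * K m x y) \<le> norm (C * \<bar>v y\<bar>)"
    proof (rule AE_I2)
      fix y
      have "\<bar>K m x y\<bar> \<le> \<bar>C\<bar>" using C[of x y] by linarith
      then have "\<bar>v y\<bar> * \<bar>K m x y\<bar> \<le> \<bar>v y\<bar> * \<bar>C\<bar>" by (rule mult_left_mono) simp
      then show "norm (v y * K m x y) \<le> norm (C * \<bar>v y\<bar>)" by (simp add: abs_mult mult.commute)
    qed
  qed (use v in measurable)
qed

lemma cv_diff:
  assumes "integrable (lebesgue_Rd d) v" "integrable (lebesgue_Rd d) w"
  shows "cv (\<lambda>y. v y - w y) x = cv v x - cv w x"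
  unfolding conv_def left_diff_distrib
  by (intro Bochner_Integration.integral_diff integrable_mult_K assms)

lemma nn_integral_K_0_left: "(\<integral>\<^sup>+x. ennreal (K (\<lambda>_. 0) x y) \<partial>lebesgue_Rd d) = 1"
proof -
  have 1: "(\<integral>\<^sup>+t. ennreal (D 0 (t - a)) \<partial>lborel) = 1" for a
  proof -
    have "(\<integral>\<^sup>+t. ennreal (D 0 (t - a)) \<partial>lborel) = (\<integral>\<^sup>+t. ennreal (D 0 t) \<partial>lborel)"
      using nn_integral_real_affine[of "\<lambda>t. ennreal (D 0 t)" 1 "- a"] by simp
    also have "\<dots> = ennreal (\<integral>t. D 0 t \<partial>lborel)"
      by (intro nn_integral_eq_integral D_integrable) (simp add: D_nonneg)
    finally show ?thesis by (simp add: D_integral)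
  qed
  have "(\<integral>\<^sup>+x. ennreal (K (\<lambda>_. 0) x y) \<partial>lebesgue_Rd d) = (\<integral>\<^sup>+x. (\<Prod>i<d. ennreal (D 0 (x i - y i))) \<partial>lebesgue_Rd d)"
    by (simp add: kernel_def prod_ennreal D_nonneg)
  also have "\<dots> = (\<Prod>i<d. \<integral>\<^sup>+t. ennreal (D 0 (t - y i)) \<partial>lborel)"
    unfolding lebesgue_Rd_def by (rule lborel_product.product_nn_integral_prod) auto
  finally show ?thesis by (simp add: 1)
qed

lemma cv_meas:
  assumes [measurable]: "v \<in> borel_measurable (lebesgue_Rd d)" shows "cv v \<in> borel_measurable (lebesgue_Rd d)"
proof -
  have "(\<lambda>(x, y). v y * K (\<lambda>_. 0) x y) \<in> borel_measurable (lebesgue_Rd d \<Otimes>\<^sub>M lebesgue_Rd d)"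
    unfolding case_prod_unfold
    by (intro borel_measurable_times K_meas measurable_compose[OF measurable_snd assms]
        measurable_compose[OF measurable_fst measurable_coord] measurable_compose[OF measurable_snd measurable_coord])
  then show ?thesis
    unfolding conv_def[abs_def] by (rule lebesgue_Rd.borel_measurable_lebesgue_integral)
qed

text \<open>Fubini, together with the fact that the kernel has mass 1 also in its first
  argument.\<close>

lemma cv_contraction:
  assumes v: "integrable (lebesgue_Rd d) v"
  shows "integrable (lebesgue_Rd d) (cv v)" "(\<integral>x. \<bar>cv v x\<bar> \<partial>lebesgue_Rd d) \<le> (\<integral>x. \<bar>v x\<bar> \<partial>lebesgue_Rd d)"
proof -
  have vm[measurable]: "v \<in> borel_measurable (lebesgue_Rd d)" using v by auto
  have m1: "(\<lambda>(x, y). ennreal \<bar>v y * K (\<lambda>_. 0) x y\<bar>) \<in> borel_measurable (lebesgue_Rd d \<Otimes>\<^sub>M lebesgue_Rd d)"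
    unfolding case_prod_unfold
    by (intro measurable_compose[OF _ measurable_ennreal] borel_measurable_abs borel_measurable_times K_meas measurable_compose[OF measurable_snd vm]
        measurable_compose[OF measurable_fst measurable_coord] measurable_compose[OF measurable_snd measurable_coord])
  have "(\<integral>\<^sup>+x. ennreal (norm (cv v x)) \<partial>lebesgue_Rd d) \<le> (\<integral>\<^sup>+x. \<integral>\<^sup>+y. ennreal \<bar>v y * K (\<lambda>_. 0) x y\<bar> \<partial>lebesgue_Rd d \<partial>lebesgue_Rd d)"
    unfolding conv_def real_norm_def[symmetric]
    by (intro nn_integral_mono integral_norm_bound_ennreal integrable_mult_K v)
  also have "\<dots> = (\<integral>\<^sup>+y. \<integral>\<^sup>+x. ennreal \<bar>v y * K (\<lambda>_. 0) x y\<bar> \<partial>lebesgue_Rd d \<partial>lebesgue_Rd d)"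
    using m1 by (rule lebesgue_pair.Fubini'[symmetric])
  also have "\<dots> = (\<integral>\<^sup>+y. ennreal \<bar>v y\<bar> * (\<integral>\<^sup>+x. ennreal (K (\<lambda>_. 0) x y) \<partial>lebesgue_Rd d) \<partial>lebesgue_Rd d)"
  proof (rule nn_integral_cong)
    fix y
    have [measurable]: "(\<lambda>x. K (\<lambda>_. 0) x y) \<in> borel_measurable (lebesgue_Rd d)"
      using K_meas[of "\<lambda>x. x" "lebesgue_Rd d" "\<lambda>_. y"] by simp
    show "(\<integral>\<^sup>+x. ennreal \<bar>v y * K (\<lambda>_. 0) x y\<bar> \<partial>lebesgue_Rd d) = ennreal \<bar>v y\<bar> * (\<integral>\<^sup>+x. ennreal (K (\<lambda>_. 0) x y) \<partial>lebesgue_Rd d)"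
      by (subst nn_integral_cmult[symmetric]) (auto simp: abs_mult K_0_nonneg ennreal_mult')
  qed
  also have "\<dots> = (\<integral>\<^sup>+y. ennreal \<bar>v y\<bar> \<partial>lebesgue_Rd d)" by (simp add: nn_integral_K_0_left)
  also have "\<dots> = ennreal (\<integral>x. \<bar>v x\<bar> \<partial>lebesgue_Rd d)"
    by (intro nn_integral_eq_integral integrable_abs v) auto
  finally have le: "(\<integral>\<^sup>+x. ennreal (norm (cv v x)) \<partial>lebesgue_Rd d) \<le> ennreal (\<integral>x. \<bar>v x\<bar> \<partial>lebesgue_Rd d)" .
  then show int: "integrable (lebesgue_Rd d) (cv v)"
    by (intro integrableI_bounded cv_meas vm) (auto intro: le_less_trans)
  have "ennreal (\<integral>x. \<bar>cv v x\<bar> \<partial>lebesgue_Rd d) = (\<integral>\<^sup>+x. ennreal (norm (cv v x)) \<partial>lebesgue_Rd d)"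
    using nn_integral_eq_integral[OF integrable_abs[OF int]] by simp
  with le have "ennreal (\<integral>x. \<bar>cv v x\<bar> \<partial>lebesgue_Rd d) \<le> ennreal (\<integral>x. \<bar>v x\<bar> \<partial>lebesgue_Rd d)" by simp
  then show "(\<integral>x. \<bar>cv v x\<bar> \<partial>lebesgue_Rd d) \<le> (\<integral>x. \<bar>v x\<bar> \<partial>lebesgue_Rd d)"
    by (subst (asm) ennreal_le_iff) simp_all
qed

text \<open>The kernel vanishes outside the cube of radius \<epsilon>, so only the values of the
  function there count.\<close>

lemma cv_local:
  assumes "\<And>y. y \<in> Rd d \<Longrightarrow> (\<And>i. i < d \<Longrightarrow> \<bar>x i - y i\<bar> \<le> \<epsilon>) \<Longrightarrow> v y = w y"
  shows "cv v x = cv w x"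
  unfolding conv_def
proof (rule Bochner_Integration.integral_cong[OF refl])
  fix y assume "y \<in> space (lebesgue_Rd d)"
  then show "v y * K (\<lambda>_. 0) x y = w y * K (\<lambda>_. 0) x y"
    using assms[of y] K_support[of "\<lambda>_. 0" x y] by (cases "K (\<lambda>_. 0) x y = 0") auto
qed

lemma cv_const: "cv (\<lambda>_. c) x = c"
  unfolding conv_def by (simp add: integral_K_0)

end

section \<open>Mollifications converge in L1 for Lebesgue measure\<close>

definition mollifiers :: "nat \<Rightarrow> nat \<Rightarrow> real \<Rightarrow> real" where
  "mollifiers n = (SOME D. mollifier (1 / real (Suc n)) D)"

interpretation mollifiers: mollify d "1 / real (Suc n)" "mollifiers n" for d n
proof
  show "mollifier (1 / real (Suc n)) (mollifiers n)"
    unfolding mollifiers_def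
  proof (rule someI_ex[of "mollifier (1 / real (Suc n))"])
    show "\<exists>D. mollifier (1 / real (Suc n)) D" using mollifier_exists[of "1 / real (Suc n)"] by auto
  qed
qed simp

text \<open>The functions whose mollifications converge in L1. That every integrable function
  qualifies is shown by closure properties, starting from boxes.\<close>

definition L1_approx :: "nat \<Rightarrow> ((nat \<Rightarrow> real) \<Rightarrow> real) \<Rightarrow> bool" where
  "L1_approx d v \<longleftrightarrow> integrable (lebesgue_Rd d) v \<and>
     (\<lambda>n. \<integral>x. \<bar>conv d (mollifiers n) (\<lambda>_. 0) v x - v x\<bar> \<partial>lebesgue_Rd d) \<longlonglongrightarrow> 0"


abbreviation cvn :: "nat \<Rightarrow> nat \<Rightarrow> ((nat \<Rightarrow> real) \<Rightarrow> real) \<Rightarrow> (nat \<Rightarrow> real) \<Rightarrow> real" where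
  "cvn d n \<equiv> conv d (mollifiers n) (\<lambda>_. 0)"

lemma L1_diff_integrable:
  assumes "integrable (lebesgue_Rd d) v" shows "integrable (lebesgue_Rd d) (\<lambda>x. \<bar>cvn d n v x - v x\<bar>)"
  using mollifiers.cv_contraction(1)[OF assms] assms by auto

text \<open>The three-epsilon argument: by contraction the error committed on v - w does not grow
  under mollification.\<close>

lemma L1_approx_closure:
  assumes v: "integrable (lebesgue_Rd d) v"
    and approx: "\<And>e. 0 < e \<Longrightarrow> \<exists>w. L1_approx d w \<and> (\<integral>x. \<bar>v x - w x\<bar> \<partial>lebesgue_Rd d) < e"
  shows "L1_approx d v"
  unfolding L1_approx_def
proof (intro conjI v LIMSEQ_I)
  fix e :: real assume e: "0 < e"
  then obtain w where w: "L1_approx d w" and vw: "(\<integral>x. \<bar>v x - w x\<bar> \<partial>lebesgue_Rd d) < e / 3"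
    using approx[of "e / 3"] by auto
  have wi: "integrable (lebesgue_Rd d) w" using w by (simp add: L1_approx_def)
  obtain N where N: "\<And>n. n \<ge> N \<Longrightarrow> norm ((\<integral>x. \<bar>cvn d n w x - w x\<bar> \<partial>lebesgue_Rd d) - 0) < e / 3"
    using LIMSEQ_D[of "\<lambda>n. \<integral>x. \<bar>cvn d n w x - w x\<bar> \<partial>lebesgue_Rd d" 0 "e / 3"] w e by (auto simp: L1_approx_def)
  show "\<exists>N. \<forall>n\<ge>N. norm ((\<integral>x. \<bar>cvn d n v x - v x\<bar> \<partial>lebesgue_Rd d) - 0) < e"
  proof (intro exI allI impI)
    fix n assume n: "N \<le> n"
    have d: "integrable (lebesgue_Rd d) (\<lambda>x. v x - w x)" using v wi by simp
    note c = mollifiers.cv_contraction[OF d, of n]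
    have "(\<integral>x. \<bar>cvn d n v x - v x\<bar> \<partial>lebesgue_Rd d) \<le>
        (\<integral>x. \<bar>cvn d n (\<lambda>x. v x - w x) x\<bar> + \<bar>cvn d n w x - w x\<bar> + \<bar>v x - w x\<bar> \<partial>lebesgue_Rd d)"
    proof (rule integral_mono)
      show "\<bar>cvn d n v x - v x\<bar> \<le> \<bar>cvn d n (\<lambda>x. v x - w x) x\<bar> + \<bar>cvn d n w x - w x\<bar> + \<bar>v x - w x\<bar>" for x
        unfolding mollifiers.cv_diff[OF v wi] by linarith
    qed (use L1_diff_integrable[OF v] L1_diff_integrable[OF wi] c(1) d in auto)
    also have "\<dots> = (\<integral>x. \<bar>cvn d n (\<lambda>x. v x - w x) x\<bar> \<partial>lebesgue_Rd d) +
        (\<integral>x. \<bar>cvn d n w x - w x\<bar> \<partial>lebesgue_Rd d) + (\<integral>x. \<bar>v x - w x\<bar> \<partial>lebesgue_Rd d)"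
      using L1_diff_integrable[OF wi] integrable_abs[OF c(1)] integrable_abs[OF d] by simp
    also have "\<dots> < e" using c(2) N[OF n] vw by simp
    finally show "norm ((\<integral>x. \<bar>cvn d n v x - v x\<bar> \<partial>lebesgue_Rd d) - 0) < e" by simp
  qed
qed

lemma L1_approx_lincomb:
  assumes v: "L1_approx d v" and w: "L1_approx d w" shows "L1_approx d (\<lambda>x. v x - c * w x)"
proof -
  have vi: "integrable (lebesgue_Rd d) v" "integrable (lebesgue_Rd d) w" using v w by (auto simp: L1_approx_def)
  have lim: "(\<lambda>n. (\<integral>x. \<bar>cvn d n v x - v x\<bar> \<partial>lebesgue_Rd d) + \<bar>c\<bar> * (\<integral>x. \<bar>cvn d n w x - w x\<bar> \<partial>lebesgue_Rd d)) \<longlonglongrightarrow> 0 + \<bar>c\<bar> * 0"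
    using v w by (intro tendsto_intros) (auto simp: L1_approx_def)
  have cw: "cvn d n (\<lambda>x. c * w x) x = c * cvn d n w x" for n x
    by (simp add: conv_def mult.assoc)
  have le: "norm (\<integral>x. \<bar>cvn d n (\<lambda>x. v x - c * w x) x - (v x - c * w x)\<bar> \<partial>lebesgue_Rd d) \<le>
      (\<integral>x. \<bar>cvn d n v x - v x\<bar> \<partial>lebesgue_Rd d) + \<bar>c\<bar> * (\<integral>x. \<bar>cvn d n w x - w x\<bar> \<partial>lebesgue_Rd d)" for n
  proof -
    have "(\<integral>x. \<bar>cvn d n (\<lambda>x. v x - c * w x) x - (v x - c * w x)\<bar> \<partial>lebesgue_Rd d) \<le>
        (\<integral>x. \<bar>cvn d n v x - v x\<bar> + \<bar>c\<bar> * \<bar>cvn d n w x - w x\<bar> \<partial>lebesgue_Rd d)"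
    proof (rule integral_mono)
      fix x
      have "cvn d n (\<lambda>x. v x - c * w x) x - (v x - c * w x) = (cvn d n v x - v x) - c * (cvn d n w x - w x)"
        using vi by (subst mollifiers.cv_diff) (auto simp: cw algebra_simps)
      then show "\<bar>cvn d n (\<lambda>x. v x - c * w x) x - (v x - c * w x)\<bar> \<le> \<bar>cvn d n v x - v x\<bar> + \<bar>c\<bar> * \<bar>cvn d n w x - w x\<bar>"
        using abs_triangle_ineq4[of "cvn d n v x - v x" "c * (cvn d n w x - w x)"] by (simp add: abs_mult)
    next
      show "integrable (lebesgue_Rd d) (\<lambda>x. \<bar>cvn d n (\<lambda>x. v x - c * w x) x - (v x - c * w x)\<bar>)"
        by (rule L1_diff_integrable) (use vi in auto)
    qed (use L1_diff_integrable vi in auto)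
    then show ?thesis using L1_diff_integrable[OF vi(1)] L1_diff_integrable[OF vi(2)] by simp
  qed
  have "(\<lambda>n. \<integral>x. \<bar>cvn d n (\<lambda>x. v x - c * w x) x - (v x - c * w x)\<bar> \<partial>lebesgue_Rd d) \<longlonglongrightarrow> 0"
    by (rule Lim_null_comparison[OF always_eventually[OF allI[OF le]]]) (use lim in simp)
  then show ?thesis using vi by (auto simp: L1_approx_def)
qed

lemma L1_approx_add: "L1_approx d v \<Longrightarrow> L1_approx d w \<Longrightarrow> L1_approx d (\<lambda>x. v x + w x)"
  using L1_approx_lincomb[of d v w "-1"] by simp

lemma L1_approx_0: "L1_approx d (\<lambda>_. 0)"
  by (simp add: L1_approx_def conv_def)

lemma L1_approx_mult: "L1_approx d w \<Longrightarrow> L1_approx d (\<lambda>x. c * w x)"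
  using L1_approx_lincomb[OF L1_approx_0, of d w "-c"] by simp

lemma L1_approx_sum: "(\<And>i. i < n \<Longrightarrow> L1_approx d (v i)) \<Longrightarrow> L1_approx d (\<lambda>x. \<Sum>i<n::nat. v i x)"
  by (induction n) (auto intro: L1_approx_0 L1_approx_add)

lemma L1_approx_cong:
  assumes "\<And>x. x \<in> Rd d \<Longrightarrow> v x = w x" "L1_approx d v" shows "L1_approx d w"
proof -
  have "cvn d n v x = cvn d n w x" for n x
    unfolding conv_def using assms(1) by (intro Bochner_Integration.integral_cong) auto
  then have "(\<integral>x. \<bar>cvn d n v x - v x\<bar> \<partial>lebesgue_Rd d) = (\<integral>x. \<bar>cvn d n w x - w x\<bar> \<partial>lebesgue_Rd d)" for n
    using assms(1) by (intro Bochner_Integration.integral_cong) auto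
  moreover have "integrable (lebesgue_Rd d) v \<longleftrightarrow> integrable (lebesgue_Rd d) w"
    using assms(1) by (intro Bochner_Integration.integrable_cong) auto
  ultimately show ?thesis using assms(2) by (simp add: L1_approx_def)
qed

text \<open>Dominated pointwise convergence is L1 convergence, so the class is closed under
  it.\<close>

lemma L1_approx_lim:
  assumes f: "integrable (lebesgue_Rd d) f" and s: "\<And>i. L1_approx d (s i)"
    and lim: "\<And>x. x \<in> Rd d \<Longrightarrow> (\<lambda>i::nat. s i x) \<longlonglongrightarrow> f x"
    and g: "integrable (lebesgue_Rd d) g" and bd: "\<And>i x. x \<in> Rd d \<Longrightarrow> \<bar>s i x\<bar> \<le> g x"
  shows "L1_approx d f"
proof (rule L1_approx_closure[OF f])
  fix e :: real assume e: "0 < e"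
  have si: "integrable (lebesgue_Rd d) (s i)" for i using s by (simp add: L1_approx_def)
  have "(\<lambda>i. \<integral>x. \<bar>f x - s i x\<bar> \<partial>lebesgue_Rd d) \<longlonglongrightarrow> (\<integral>x. 0 \<partial>lebesgue_Rd d)"
  proof (rule integral_dominated_convergence[where w="\<lambda>x. \<bar>f x\<bar> + g x"])
    show "AE x in lebesgue_Rd d. (\<lambda>i. \<bar>f x - s i x\<bar>) \<longlonglongrightarrow> 0"
    proof (rule AE_I2)
      fix x assume "x \<in> space (lebesgue_Rd d)"
      then have "(\<lambda>i. \<bar>f x - s i x\<bar>) \<longlonglongrightarrow> \<bar>f x - f x\<bar>" by (intro tendsto_intros lim) simp
      then show "(\<lambda>i. \<bar>f x - s i x\<bar>) \<longlonglongrightarrow> 0" by simp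
    qed
    show "AE x in lebesgue_Rd d. norm \<bar>f x - s i x\<bar> \<le> \<bar>f x\<bar> + g x" for i
    proof (rule AE_I2)
      fix x assume "x \<in> space (lebesgue_Rd d)"
      then have "\<bar>s i x\<bar> \<le> g x" by (intro bd) simp
      then show "norm \<bar>f x - s i x\<bar> \<le> \<bar>f x\<bar> + g x" by simp
    qed
  qed (use f g si in auto)
  then have "(\<lambda>i. \<integral>x. \<bar>f x - s i x\<bar> \<partial>lebesgue_Rd d) \<longlonglongrightarrow> 0" by simp
  from LIMSEQ_D[OF this e] obtain N where "norm ((\<integral>x. \<bar>f x - s N x\<bar> \<partial>lebesgue_Rd d) - 0) < e" by blast
  then show "\<exists>w. L1_approx d w \<and> (\<integral>x. \<bar>f x - w x\<bar> \<partial>lebesgue_Rd d) < e"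
    using s by (intro exI[of _ "s N"]) auto
qed

definition obox :: "nat \<Rightarrow> (nat \<Rightarrow> real) \<Rightarrow> (nat \<Rightarrow> real) \<Rightarrow> (nat \<Rightarrow> real) set" where
  "obox d l r = {x \<in> Rd d. \<forall>i<d. l i < x i \<and> x i < r i}"

lemma obox_PiE: "obox d l r = (\<Pi>\<^sub>E i\<in>{..<d}. {l i<..<r i})"
  by (auto simp: obox_def Rd_def PiE_def Pi_def)

lemma obox_sets [measurable]: "obox d l r \<in> sets (lebesgue_Rd d)"
  unfolding obox_PiE lebesgue_Rd_def by (rule sets_PiM_I_finite) auto

lemma emeasure_obox: "emeasure (lebesgue_Rd d) (obox d l r) < \<infinity>"
proof -
  have "emeasure (lebesgue_Rd d) (obox d l r) = (\<Prod>i<d. emeasure lborel {l i<..<r i})"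
    unfolding obox_PiE lebesgue_Rd_def by (rule lborel_product.emeasure_PiM) auto
  also have "\<dots> < \<infinity>"
  proof -
    have "emeasure lborel {l i<..<r i} \<noteq> \<top>" for i by (cases "l i \<le> r i") auto
    then show ?thesis by (auto simp: less_top[symmetric] ennreal_prod_eq_top)
  qed
  finally show ?thesis .
qed

lemma AE_coord_neq: assumes "i < d" shows "AE x in lebesgue_Rd d. x i \<noteq> (c::real)"
proof -
  have "emeasure (lebesgue_Rd d) (\<Pi>\<^sub>E j\<in>{..<d}. if j = i then {c} else UNIV) = (\<Prod>j<d. emeasure lborel (if j = i then {c} else UNIV))"
    unfolding lebesgue_Rd_def by (rule lborel_product.emeasure_PiM) auto
  also have "\<dots> = 0" using assms by (auto simp: prod_zero_iff)
  finally have "(\<Pi>\<^sub>E j\<in>{..<d}. if j = i then {c} else UNIV) \<in> null_sets (lebesgue_Rd d)"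
    by (auto simp: lebesgue_Rd_def intro!: null_setsI sets_PiM_I_finite)
  moreover have "{x \<in> space (lebesgue_Rd d). \<not> x i \<noteq> c} \<subseteq> (\<Pi>\<^sub>E j\<in>{..<d}. if j = i then {c} else UNIV)"
    by (auto simp: Rd_def PiE_def Pi_def)
  ultimately show ?thesis by (rule AE_I')
qed

lemma integrable_indicator_obox: "integrable (lebesgue_Rd d) (indicator (obox d l r) :: _ \<Rightarrow> real)"
  using emeasure_obox by (intro integrable_real_indicator obox_sets) auto

lemma eventually_mollifier_eps:
  assumes "0 < (e::real)" shows "\<forall>\<^sub>F n in sequentially. 1 / real (Suc n) < e"
  using LIMSEQ_inverse_real_of_nat assms by (auto simp: inverse_eq_divide order_tendsto_iff)

text \<open>Off the hyperplanes carrying the faces the indicator is constant near \<open>x\<close>,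
  and averaging a constant returns it once the mollification radius is small.\<close>

lemma eventually_cvn_indicator:
  assumes "\<And>i. i < d \<Longrightarrow> x i \<noteq> l i" "\<And>i. i < d \<Longrightarrow> x i \<noteq> r i" "x \<in> Rd d"
  shows "\<forall>\<^sub>F n in sequentially. cvn d n (indicator (obox d l r)) x = indicator (obox d l r) x"
proof -
  \<comment> \<open>The distance to these hyperplanes. Inserting 1 keeps the set nonempty when
    \<open>d\<close> is 0.\<close>
  define e where "e = Min (insert 1 ((\<lambda>i. min \<bar>x i - l i\<bar> \<bar>x i - r i\<bar>) ` {..<d}))"
  have e0: "0 < e" unfolding e_def by (subst Min_gr_iff) (use assms in auto)
  have e: "e \<le> \<bar>x i - l i\<bar>" "e \<le> \<bar>x i - r i\<bar>" if "i < d" for i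
  proof -
    have "e \<le> min \<bar>x i - l i\<bar> \<bar>x i - r i\<bar>" unfolding e_def by (rule Min_le) (use that in auto)
    then show "e \<le> \<bar>x i - l i\<bar>" "e \<le> \<bar>x i - r i\<bar>" by auto
  qed
  show ?thesis
    using eventually_mollifier_eps[OF e0]
  proof eventually_elim
    case (elim n)
    have "cvn d n (indicator (obox d l r)) x = cvn d n (\<lambda>_. indicator (obox d l r) x) x"
    proof (rule mollifiers.cv_local)
      fix y assume y: "y \<in> Rd d" "\<And>i. i < d \<Longrightarrow> \<bar>x i - y i\<bar> \<le> 1 / real (Suc n)"
      have "(l i < y i \<and> y i < r i) \<longleftrightarrow> (l i < x i \<and> x i < r i)" if "i < d" for i
        using y(2)[OF that] e[OF that] elim by (auto simp: abs_if split: if_splits)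
      then show "indicator (obox d l r) y = (indicator (obox d l r) x :: real)"
        using y(1) assms(3) by (auto simp: obox_def indicator_def)
    qed
    then show ?case by (simp add: mollifiers.cv_const)
  qed
qed

lemma L1_approx_obox: "L1_approx d (indicator (obox d l r))"
proof -
  let ?v = "indicator (obox d l r) :: _ \<Rightarrow> real"
  \<comment> \<open>The mollification radius is at most 1, so all differences vanish outside the box
    enlarged by 2.\<close>
  let ?w = "indicator (obox d (\<lambda>i. l i - 2) (\<lambda>i. r i + 2)) :: _ \<Rightarrow> real"
  have "(\<lambda>n. \<integral>x. \<bar>cvn d n ?v x - ?v x\<bar> \<partial>lebesgue_Rd d) \<longlonglongrightarrow> (\<integral>x. 0 \<partial>lebesgue_Rd d)"
  proof (rule integral_dominated_convergence[where w="?w"])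
    have "AE x in lebesgue_Rd d. \<forall>i\<in>{..<d}. x i \<noteq> l i \<and> x i \<noteq> r i"
      by (rule AE_finite_allI) (auto intro: AE_conjI AE_coord_neq)
    then show "AE x in lebesgue_Rd d. (\<lambda>n. \<bar>cvn d n ?v x - ?v x\<bar>) \<longlonglongrightarrow> 0"
      using AE_space
    proof eventually_elim
      case (elim x)
      then have "\<forall>\<^sub>F n in sequentially. cvn d n ?v x = ?v x" by (intro eventually_cvn_indicator) auto
      then show ?case by (intro tendsto_eventually) (auto elim: eventually_mono)
    qed
    show "AE x in lebesgue_Rd d. norm \<bar>cvn d n ?v x - ?v x\<bar> \<le> ?w x" for n
    proof (rule AE_I2)
      fix x assume "x \<in> space (lebesgue_Rd d)"
      then have x: "x \<in> Rd d" by simp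
      show "norm \<bar>cvn d n ?v x - ?v x\<bar> \<le> ?w x"
      proof (cases "x \<in> obox d (\<lambda>i. l i - 2) (\<lambda>i. r i + 2)")
        case True
        have K: "integrable (lebesgue_Rd d) (\<lambda>y. ?v y * kernel d (mollifiers n) (\<lambda>_. 0) x y)"
          by (rule mollifiers.integrable_mult_K[OF integrable_indicator_obox])
        have "0 \<le> cvn d n ?v x" unfolding conv_def
          by (intro integral_nonneg_AE AE_I2) (simp add: mollifiers.K_0_nonneg)
        moreover have "cvn d n ?v x \<le> (\<integral>y. kernel d (mollifiers n) (\<lambda>_. 0) x y \<partial>lebesgue_Rd d)"
          unfolding conv_def
          by (rule integral_mono[OF K mollifiers.integrable_K_0]) (auto simp: indicator_def mollifiers.K_0_nonneg)
        ultimately have "0 \<le> cvn d n ?v x" "cvn d n ?v x \<le> 1" by (simp_all add: mollifiers.integral_K_0)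
        moreover have "0 \<le> ?v x" "?v x \<le> 1" by (auto simp: indicator_def)
        ultimately have "\<bar>cvn d n ?v x - ?v x\<bar> \<le> 1" by linarith
        then show ?thesis using True by simp
      next
        case False
        then obtain i where i: "i < d" "x i \<le> l i - 2 \<or> r i + 2 \<le> x i" using x by (auto simp: obox_def not_less)
        have "cvn d n ?v x = cvn d n (\<lambda>_. 0) x"
        proof (rule mollifiers.cv_local)
          fix y assume y: "\<And>i. i < d \<Longrightarrow> \<bar>x i - y i\<bar> \<le> 1 / real (Suc n)"
          have "1 / real (Suc n) \<le> 1" by simp
          with y[OF i(1)] have "\<bar>x i - y i\<bar> \<le> 1" by linarith
          then have "y \<notin> obox d l r" using i by (auto simp: obox_def intro!: exI[of _ i])
          then show "?v y = 0" by simp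
        qed
        moreover have "x \<notin> obox d l r" using i by (auto simp: obox_def intro!: exI[of _ i])
        ultimately show ?thesis by (simp add: mollifiers.cv_const)
      qed
    qed
  qed (auto intro!: integrable_indicator_obox L1_diff_integrable[THEN borel_measurable_integrable])
  then show ?thesis by (simp add: L1_approx_def integrable_indicator_obox)
qed

text \<open>Lower orthants form a generator closed under intersection, as Dynkin's argument demands,
  and they cut boxes into boxes.\<close>

lemma sets_lebesgue_Rd:
  "sets (lebesgue_Rd d) = sigma_sets (Rd d) {{x \<in> Rd d. \<forall>i<d. x i < a i} |a. True}"
proof -
  define P where "P = {{f\<in>(\<Pi>\<^sub>E i\<in>{..<d}. UNIV :: real set). \<forall>i\<in>j. f i \<in> A i} | A j. j \<in> {{..<d}} \<and> A \<in> Pi j (\<lambda>_. range lessThan)}"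
  have "sets (lebesgue_Rd d) = sets (Pi\<^sub>M {..<d} (\<lambda>_. borel :: real measure))"
    unfolding lebesgue_Rd_def by (intro sets_PiM_cong) auto
  also have "\<dots> = sets (Pi\<^sub>M {..<d} (\<lambda>_. sigma (UNIV :: real set) (range lessThan)))"
    by (simp flip: borel_Iio)
  also have "\<dots> = sets (sigma (\<Pi>\<^sub>E i\<in>{..<d}. UNIV) P)"
    unfolding P_def
  proof (rule sets_PiM_sigma)
    show "\<exists>S\<subseteq>range lessThan. countable S \<and> (UNIV :: real set) = \<Union> S"
      by (intro exI[of _ "range (\<lambda>n::nat. {..<real n})"]) (auto intro: reals_Archimedean2)
  qed auto
  also have "\<dots> = sigma_sets (Rd d) P"
    unfolding Rd_def by (rule sets_measure_of) (auto simp: P_def)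
  also have "P = {{x \<in> Rd d. \<forall>i<d. x i < a i} |a. True}"
  proof (intro equalityI subsetI)
    fix S assume "S \<in> P"
    then obtain A where A: "S = {f \<in> Rd d. \<forall>i<d. f i \<in> A i}" "\<And>i. i < d \<Longrightarrow> A i \<in> range lessThan"
      by (auto simp: P_def Rd_def)
    from A(2) have "\<forall>i. \<exists>a. i < d \<longrightarrow> A i = {..<a}" by blast
    then obtain a where "\<And>i. i < d \<Longrightarrow> A i = {..<a i}" by metis
    with A(1) have "S = {x \<in> Rd d. \<forall>i<d. x i < a i}" by auto
    then show "S \<in> {{x \<in> Rd d. \<forall>i<d. x i < a i} |a. True}" by blast
  next
    fix S assume "S \<in> {{x \<in> Rd d. \<forall>i<d. x i < a i} |a. True}"
    then obtain a where "S = {x \<in> Rd d. \<forall>i<d. x i < a i}" by blast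
    then show "S \<in> P" unfolding P_def Rd_def by (auto intro!: exI[of _ "\<lambda>i. {..<a i}"])
  qed
  finally show ?thesis .
qed

text \<open>Dynkin's argument relative to a fixed box: inside a set of finite measure complements
  remain integrable, and countable disjoint unions are dominated by the indicator of the
  box.\<close>

lemma L1_approx_indicator_box:
  assumes "A \<in> sets (lebesgue_Rd d)"
  shows "L1_approx d (indicator (A \<inter> obox d l r))"
proof -
  let ?B = "obox d l r"
  have B: "?B \<subseteq> Rd d" by (auto simp: obox_def)
  let ?G = "{{x \<in> Rd d. \<forall>i<d. x i < a i} |a. True}"
  have "Int_stable ?G"
  proof (rule Int_stableI, elim CollectE exE conjE)
      fix S S' a a' assume "S = {x \<in> Rd d. \<forall>i<d. x i < a i}" "S' = {x \<in> Rd d. \<forall>i<d. x i < a' i}"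
      then have "S \<inter> S' = {x \<in> Rd d. \<forall>i<d. x i < min (a i) (a' i)}" by auto
      then show "S \<inter> S' \<in> ?G"
        by (intro CollectI exI[of _ "\<lambda>i. min (a i) (a' i)"]) simp
  qed
  moreover have "?G \<subseteq> Pow (Rd d)" by auto
  moreover have "A \<in> sigma_sets (Rd d) ?G" using assms by (simp add: sets_lebesgue_Rd)
  ultimately show ?thesis
  proof (induction rule: sigma_sets_induct_disjoint)
    case (basic A)
    then obtain a where "A = {x \<in> Rd d. \<forall>i<d. x i < a i}" by blast
    then have "A \<inter> ?B = obox d l (\<lambda>i. min (a i) (r i))" by (auto simp: obox_def)
    then show ?case by (simp add: L1_approx_obox)
  next
    case empty
    show ?case by (simp add: L1_approx_0 indicator_def)
  next
    case (compl A)
    have "L1_approx d (\<lambda>x. indicator ?B x - 1 * indicator (A \<inter> ?B) x)"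
      by (intro L1_approx_lincomb L1_approx_obox compl)
    then show ?case
      by (rule L1_approx_cong[rotated]) (use B in \<open>auto simp: indicator_def\<close>)
  next
    case (union A)
    have A: "A i \<in> sets (lebesgue_Rd d)" for i using union(2) by (auto simp: sets_lebesgue_Rd)
    show ?case
    proof (rule L1_approx_lim[where s="\<lambda>n x. \<Sum>i<n. indicator (A i \<inter> ?B) x" and g="indicator ?B"])
      have sum: "(\<Sum>i<n. indicator (A i \<inter> ?B) x) = (indicator (\<Union>i<n. A i \<inter> ?B) x :: real)" for n x
        using union(1) by (intro indicator_UN_disjoint[symmetric]) (auto simp: disjoint_family_on_def)
      show "L1_approx d (\<lambda>x. \<Sum>i<n. indicator (A i \<inter> ?B) x)" for n by (intro L1_approx_sum union)
      show "\<bar>\<Sum>i<n. indicator (A i \<inter> ?B) x\<bar> \<le> (indicator ?B x :: real)" for n x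
        unfolding sum by (auto simp: indicator_def)
      show "(\<lambda>n. \<Sum>i<n. indicator (A i \<inter> ?B) x) \<longlonglongrightarrow> (indicator ((\<Union>i. A i) \<inter> ?B) x :: real)" for x
      proof -
        have "(\<lambda>n. indicator (\<Union>i<n. A i \<inter> ?B) x :: real) \<longlonglongrightarrow> indicator (\<Union>i. A i \<inter> ?B) x"
          by (rule LIMSEQ_indicator_UN)
        then show ?thesis unfolding sum by (simp add: Int_UN_distrib2 Int_commute)
      qed
      show "integrable (lebesgue_Rd d) (indicator ((\<Union>i. A i) \<inter> ?B) :: _ \<Rightarrow> real)"
        by (rule Bochner_Integration.integrable_bound[OF integrable_indicator_obox[of d l r]])
          (use A in \<open>auto simp: indicator_def intro!: AE_I2 borel_measurable_indicator\<close>)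
    qed (rule integrable_indicator_obox)
  qed
qed

text \<open>Induction over integrable functions; an indicator of a set of finite measure is
  exhausted by its intersections with growing boxes.\<close>

lemma L1_approx_integrable:
  assumes "integrable (lebesgue_Rd d) v" shows "L1_approx d v"
  using assms
proof (induction rule: integrable_induct)
  case (base A c)
  have int: "integrable (lebesgue_Rd d) (indicator A :: _ \<Rightarrow> real)"
    using base by (intro integrable_real_indicator) auto
  have "L1_approx d (indicator A)"
  proof (rule L1_approx_lim[where s="\<lambda>n. indicator (A \<inter> obox d (\<lambda>_. - real n) (\<lambda>_. real n))" and g="indicator A"])
    fix x assume x: "x \<in> Rd d"
    define r where "r = (\<Sum>i<d. \<bar>x i\<bar>)"
    have r: "\<bar>x i\<bar> \<le> r" if "i < d" for i
      unfolding r_def by (rule member_le_sum[of _ _ "\<lambda>i. \<bar>x i\<bar>"]) (use that in auto)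
    have "\<forall>\<^sub>F n in sequentially. r < real n"
      using eventually_gt_at_top[of "nat \<lceil>r\<rceil>"] by eventually_elim linarith
    then have "\<forall>\<^sub>F n in sequentially. indicator (A \<inter> obox d (\<lambda>_. - real n) (\<lambda>_. real n)) x = (indicator A x :: real)"
    proof eventually_elim
      case (elim n)
      have "- real n < x i \<and> x i < real n" if "i < d" for i using r[OF that] elim by linarith
      then show ?case using x by (auto simp: indicator_def obox_def)
    qed
    then show "(\<lambda>n. indicator (A \<inter> obox d (\<lambda>_. - real n) (\<lambda>_. real n)) x) \<longlonglongrightarrow> (indicator A x :: real)"
      by (rule tendsto_eventually)
  qed (use int base in \<open>auto simp: indicator_def intro: L1_approx_indicator_box\<close>)
  from L1_approx_mult[OF this, of c] show ?case by (simp add: mult.commute)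
next
  case (add f g)
  then show ?case by (intro L1_approx_add)
next
  case (lim f s)
  show ?case
  proof (rule L1_approx_lim[where s=s and g="\<lambda>x. 2 * \<bar>f x\<bar>"])
    show "integrable (lebesgue_Rd d) (\<lambda>x. 2 * \<bar>f x\<bar>)"
      by (rule integrable_mult_right[OF integrable_abs[OF lim(4)]])
    show "(\<lambda>i. s i x) \<longlonglongrightarrow> f x" "\<bar>s i x\<bar> \<le> 2 * \<bar>f x\<bar>" if "x \<in> Rd d" for x i
      using lim(2)[of x] lim(3)[of x i] that by simp_all
  qed (rule lim)+
qed

section \<open>Transfer to almost everywhere convergence under the Gaussian measure\<close>

lemma gauss_density_le_1: "gauss_density d x \<le> 1"
proof -
  have "std_normal_density t \<le> 1" for t :: real
  proof -
    have "1 \<le> sqrt (2 * pi)" using pi_gt3 by (intro real_le_rsqrt) simp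
    then have "1 / sqrt (2 * pi) * exp (- t\<^sup>2 / 2) \<le> 1 * 1"
      by (intro mult_mono) (auto simp: divide_simps)
    then show ?thesis by (simp add: normal_density_def)
  qed
  then show ?thesis unfolding gauss_density_def by (intro prod_le_1) auto
qed

lemma coord_bounded_by_sum: "i < (d :: nat) \<Longrightarrow> \<bar>x i\<bar> \<le> (\<Sum>i<d. \<bar>x i :: real\<bar>)"
  by (rule member_le_sum[of _ _ "\<lambda>i. \<bar>x i\<bar>"]) auto

lemma eventually_obox:
  assumes x: "x \<in> Rd d" shows "\<forall>\<^sub>F n in sequentially. x \<in> obox d (\<lambda>_. - real n) (\<lambda>_. real n)"
proof -
  have "\<forall>\<^sub>F n in sequentially. (\<Sum>i<d. \<bar>x i\<bar>) < real n"
    using eventually_gt_at_top[of "nat \<lceil>\<Sum>i<d. \<bar>x i\<bar>\<rceil>"] by eventually_elim linarith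
  then show ?thesis
  proof eventually_elim
    case (elim n)
    have "- real n < x i \<and> x i < real n" if "i < d" for i
      using coord_bounded_by_sum[OF that, of x] elim by linarith
    then show ?case using x by (simp add: obox_def)
  qed
qed

text \<open>On a cube the Gaussian density is bounded below by a positive constant, so Gaussian
  integrability becomes Lebesgue integrability there.\<close>

lemma integrable_mult_indicator_obox:
  fixes u :: "(nat \<Rightarrow> real) \<Rightarrow> real"
  assumes u: "integrable (gaussian d) u"
  shows "integrable (lebesgue_Rd d) (\<lambda>x. u x * indicator (obox d (\<lambda>_. - r) (\<lambda>_. r)) x)"
proof -
  have um[measurable]: "u \<in> borel_measurable (lebesgue_Rd d)" using u by (auto simp flip: measurable_gaussian_iff)
  have ui: "integrable (lebesgue_Rd d) (\<lambda>x. gauss_density d x * u x)" using u um by (simp add: integrable_gaussian_iff)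
  define b where "b = std_normal_density r ^ d"
  have b: "0 < b" by (simp add: b_def normal_density_pos)
  show ?thesis
  proof (rule Bochner_Integration.integrable_bound[OF integrable_mult_right[OF ui, of "1 / b"]], measurable, rule AE_I2)
    fix x
    show "norm (u x * indicator (obox d (\<lambda>_. - r) (\<lambda>_. r)) x) \<le> norm (1 / b * (gauss_density d x * u x))"
    proof (cases "x \<in> obox d (\<lambda>_. - r) (\<lambda>_. r)")
      case True
      have "(\<Prod>i<d. std_normal_density r) \<le> gauss_density d x"
        unfolding gauss_density_def
      proof (intro prod_mono conjI)
        fix i assume "i \<in> {..<d}"
        then have "- r < x i" "x i < r" using True by (auto simp: obox_def)
        then have "(x i)\<^sup>2 \<le> r\<^sup>2" by (subst abs_le_square_iff[symmetric]) auto
        then show "std_normal_density r \<le> std_normal_density (x i)"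
          by (simp add: normal_density_def divide_right_mono)
      qed simp
      then have "b \<le> gauss_density d x" by (simp add: b_def)
      then have "1 * \<bar>u x\<bar> \<le> gauss_density d x / b * \<bar>u x\<bar>"
        using b by (intro mult_right_mono) (auto simp: divide_simps)
      then show ?thesis using True b gauss_density_pos[of d x] by (simp add: abs_mult)
    qed simp
  qed
qed

lemma min_cvn_measurable:
  assumes u: "integrable (gaussian d) u"
  shows "(\<lambda>x. min 1 \<bar>cvn d n u x - u x\<bar>) \<in> borel_measurable (gaussian d)"
proof -
  have "u \<in> borel_measurable (gaussian d)" "cvn d n u \<in> borel_measurable (gaussian d)"
    using mollifiers.conv_meas[OF u] u by (auto simp: measurable_gaussian_iff)
  then show ?thesis by measurable
qed

lemma integrable_min_cvn:
  assumes u: "integrable (gaussian d) u"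
  shows "integrable (gaussian d) (\<lambda>x. min 1 \<bar>cvn d n u x - u x\<bar>)"
proof -
  interpret G: prob_space "gaussian d" by (rule prob_space_gaussian)
  show ?thesis
    by (rule G.integrable_const_bound[of _ 1]) (auto intro!: min_cvn_measurable u)
qed

text \<open>A Gaussian-integrable function need not be Lebesgue integrable, so L1 convergence is
  available only after cutting off to a cube. Truncation at 1 makes the outside contribute at most
  its Gaussian mass; inside, the density is at most 1 and the Lebesgue result applies.\<close>

lemma tendsto_integral_min_cvn:
  assumes u: "integrable (gaussian d) u"
  shows "(\<lambda>n. \<integral>x. min 1 \<bar>cvn d n u x - u x\<bar> \<partial>gaussian d) \<longlonglongrightarrow> 0"
proof (rule LIMSEQ_I)
  interpret G: prob_space "gaussian d" by (rule prob_space_gaussian)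
  fix e :: real assume e: "0 < e"
  define O' where "O' k = obox d (\<lambda>_. - real k) (\<lambda>_. real k)" for k
  have Om: "O' k \<in> sets (gaussian d)" for k by (simp add: O'_def sets_gaussian obox_sets)
  have ind_int: "integrable (gaussian d) (\<lambda>x. indicator (Rd d - O' k) x :: real)" for k
  proof -
    have "Rd d - O' k \<in> sets (gaussian d)" using Om[of k] sets.compl_sets[of "O' k" "gaussian d"] by simp
    then show ?thesis by (intro integrable_real_indicator) (auto simp: G.emeasure_eq_measure)
  qed
  have "(\<lambda>k. \<integral>x. indicator (Rd d - O' k) x \<partial>gaussian d) \<longlonglongrightarrow> (\<integral>x. 0 \<partial>gaussian d :: real)"
  proof (rule integral_dominated_convergence[where w="\<lambda>_. 1"])
    show "AE x in gaussian d. (\<lambda>k. indicator (Rd d - O' k) x :: real) \<longlonglongrightarrow> 0"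
    proof (rule AE_I2)
      fix x assume "x \<in> space (gaussian d)"
      then have "\<forall>\<^sub>F k in sequentially. x \<in> O' k" unfolding O'_def by (intro eventually_obox) simp
      then have "\<forall>\<^sub>F k in sequentially. indicator (Rd d - O' k) x = (0 :: real)"
        by eventually_elim simp
      then show "(\<lambda>k. indicator (Rd d - O' k) x :: real) \<longlonglongrightarrow> 0" by (rule tendsto_eventually)
    qed
  qed (use ind_int in \<open>auto simp: indicator_def intro!: AE_I2\<close>)
  then have "(\<lambda>k. \<integral>x. indicator (Rd d - O' k) x \<partial>gaussian d :: real) \<longlonglongrightarrow> 0" by simp
  from LIMSEQ_D[OF this, of "e / 2"] e obtain k where "norm ((\<integral>x. indicator (Rd d - O' k) x \<partial>gaussian d :: real) - 0) < e / 2"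
    by auto
  then have k: "(\<integral>x. indicator (Rd d - O' k) x \<partial>gaussian d :: real) < e / 2" by simp
  \<comment> \<open>The cut-off is one unit wider than the cube \<open>O' k\<close>: the
    mollification radius is at most 1, so on \<open>O' k\<close> mollifying \<open>v\<close> is the
    same as mollifying \<open>u\<close>.\<close>
  define v where "v x = u x * indicator (O' (Suc k)) x" for x
  have v: "integrable (lebesgue_Rd d) v"
    unfolding v_def O'_def by (rule integrable_mult_indicator_obox[OF u])
  have "(\<lambda>n. \<integral>x. \<bar>cvn d n v x - v x\<bar> \<partial>lebesgue_Rd d) \<longlonglongrightarrow> 0"
    using L1_approx_integrable[OF v] by (simp add: L1_approx_def)
  from LIMSEQ_D[OF this, of "e / 2"] e obtain N where N: "\<And>n. n \<ge> N \<Longrightarrow> norm ((\<integral>x. \<bar>cvn d n v x - v x\<bar> \<partial>lebesgue_Rd d) - 0) < e / 2"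
    by auto
  show "\<exists>N. \<forall>n\<ge>N. norm ((\<integral>x. min 1 \<bar>cvn d n u x - u x\<bar> \<partial>gaussian d) - 0) < e"
  proof (intro exI allI impI)
    fix n assume n: "N \<le> n"
    have dv: "integrable (lebesgue_Rd d) (\<lambda>x. \<bar>cvn d n v x - v x\<bar>)" by (rule L1_diff_integrable[OF v])
    have gdv: "integrable (lebesgue_Rd d) (\<lambda>x. gauss_density d x * \<bar>cvn d n v x - v x\<bar>)"
      by (rule Bochner_Integration.integrable_bound[OF dv])
        (use dv gauss_density_le_1 gauss_density_pos in \<open>auto simp: abs_mult less_imp_le intro!: AE_I2 mult_left_le_one_le\<close>)
    have dvm: "(\<lambda>x. \<bar>cvn d n v x - v x\<bar>) \<in> borel_measurable (lebesgue_Rd d)" using dv by auto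
    have dvg: "integrable (gaussian d) (\<lambda>x. \<bar>cvn d n v x - v x\<bar>)"
      using gdv unfolding integrable_gaussian_iff[OF dvm] .
    have "(\<integral>x. min 1 \<bar>cvn d n u x - u x\<bar> \<partial>gaussian d) \<le>
        (\<integral>x. indicator (Rd d - O' k) x + \<bar>cvn d n v x - v x\<bar> \<partial>gaussian d)"
    proof (rule integral_mono)
      fix x assume "x \<in> space (gaussian d)"
      then have x: "x \<in> Rd d" by simp
      show "min 1 \<bar>cvn d n u x - u x\<bar> \<le> indicator (Rd d - O' k) x + \<bar>cvn d n v x - v x\<bar>"
      proof (cases "x \<in> O' k")
        case True
        have "cvn d n u x = cvn d n v x"
        proof (rule mollifiers.cv_local)
          fix y assume y: "y \<in> Rd d" "\<And>i. i < d \<Longrightarrow> \<bar>x i - y i\<bar> \<le> 1 / real (Suc n)"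
          have "- real (Suc k) < y i \<and> y i < real (Suc k)" if "i < d" for i
          proof -
            have "1 / real (Suc n) \<le> 1" by simp
            then have "\<bar>x i - y i\<bar> \<le> 1" using y(2)[OF that] by linarith
            moreover have "- real k < x i" "x i < real k" using True that by (auto simp: O'_def obox_def)
            ultimately show ?thesis by (simp add: abs_le_iff)
          qed
          then have "y \<in> O' (Suc k)" using y(1) by (simp add: O'_def obox_def)
          then show "u y = v y" by (simp add: v_def)
        qed
        moreover have "u x = v x"
        proof -
          have "x \<in> O' (Suc k)" using True by (fastforce simp: O'_def obox_def)
          then show ?thesis by (simp add: v_def)
        qed
        ultimately show ?thesis using True by simp
      qed (use x in \<open>simp add: min.coboundedI1\<close>)
    qed (intro integrable_min_cvn u Bochner_Integration.integrable_add ind_int dvg)+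
    also have "\<dots> = (\<integral>x. indicator (Rd d - O' k) x \<partial>gaussian d) + (\<integral>x. \<bar>cvn d n v x - v x\<bar> \<partial>gaussian d)"
      by (rule Bochner_Integration.integral_add[OF ind_int dvg])
    also have "(\<integral>x. \<bar>cvn d n v x - v x\<bar> \<partial>gaussian d) = (\<integral>x. gauss_density d x * \<bar>cvn d n v x - v x\<bar> \<partial>lebesgue_Rd d)"
      by (rule integral_gaussian[OF dvm])
    also have "\<dots> \<le> (\<integral>x. \<bar>cvn d n v x - v x\<bar> \<partial>lebesgue_Rd d)"
      by (rule integral_mono[OF gdv dv]) (use gauss_density_le_1 gauss_density_pos in \<open>auto simp: less_imp_le intro!: mult_left_le_one_le\<close>)
    also have "\<dots> < e / 2" using N[OF n] by simp
    finally have "(\<integral>x. min 1 \<bar>cvn d n u x - u x\<bar> \<partial>gaussian d) < e" using k by simp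
    moreover have "0 \<le> (\<integral>x. min 1 \<bar>cvn d n u x - u x\<bar> \<partial>gaussian d)" by (rule integral_nonneg_AE) simp
    ultimately show "norm ((\<integral>x. min 1 \<bar>cvn d n u x - u x\<bar> \<partial>gaussian d) - 0) < e" by simp
  qed
qed

text \<open>Summing the truncated errors of all N functions yields one subsequence that serves them
  simultaneously.\<close>

lemma AE_convergent_subsequence:
  assumes u: "\<And>k. k < N \<Longrightarrow> integrable (gaussian d) (u k)"
  shows "\<exists>r::nat \<Rightarrow> nat. AE x in gaussian d. \<forall>k<N::nat. (\<lambda>n. cvn d (r n) (u k) x) \<longlonglongrightarrow> u k x"
proof -
  define h where "h n x = (\<Sum>k<N. min 1 \<bar>cvn d n (u k) x - u k x\<bar>)" for n x
  have hi: "integrable (gaussian d) (h n)" for n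
    unfolding h_def by (intro Bochner_Integration.integrable_sum integrable_min_cvn u) simp
  have h0: "0 \<le> h n x" for n x unfolding h_def by (intro sum_nonneg) simp
  have "(\<lambda>n. \<integral>x. norm (h n x) \<partial>gaussian d) = (\<lambda>n. \<Sum>k<N. \<integral>x. min 1 \<bar>cvn d n (u k) x - u k x\<bar> \<partial>gaussian d)"
  proof
    fix n
    have "(\<integral>x. norm (h n x) \<partial>gaussian d) = (\<integral>x. (\<Sum>k<N. min 1 \<bar>cvn d n (u k) x - u k x\<bar>) \<partial>gaussian d)"
      using h0[of n] by (simp add: h_def)
    also have "\<dots> = (\<Sum>k<N. \<integral>x. min 1 \<bar>cvn d n (u k) x - u k x\<bar> \<partial>gaussian d)"
      by (rule Bochner_Integration.integral_sum) (simp add: integrable_min_cvn u)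
    finally show "(\<integral>x. norm (h n x) \<partial>gaussian d) = (\<Sum>k<N. \<integral>x. min 1 \<bar>cvn d n (u k) x - u k x\<bar> \<partial>gaussian d)" .
  qed
  also have "\<dots> \<longlonglongrightarrow> (\<Sum>k<N. 0)"
    by (intro tendsto_sum tendsto_integral_min_cvn u) simp
  finally have lim: "(\<lambda>n. \<integral>x. norm (h n x) \<partial>gaussian d) \<longlonglongrightarrow> 0" by simp
  from tendsto_L1_AE_subseq[OF hi lim] obtain r where r: "AE x in gaussian d. (\<lambda>n. h (r n) x) \<longlonglongrightarrow> 0" by blast
  show ?thesis
  proof (rule exI[of _ r], use r in eventually_elim, intro allI impI)
    fix x k assume x: "(\<lambda>n. h (r n) x) \<longlonglongrightarrow> 0" and k: "k < N"
    have "(\<lambda>n. \<bar>cvn d (r n) (u k) x - u k x\<bar>) \<longlonglongrightarrow> 0"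
    proof (rule Lim_null_comparison[OF _ x])
      \<comment> \<open>Once the sum is below 1 the truncation is inactive, so it bounds the actual
        errors.\<close>
      have "\<forall>\<^sub>F n in sequentially. h (r n) x < 1" using order_tendstoD(2)[OF x, of 1] by simp
      then show "\<forall>\<^sub>F n in sequentially. norm \<bar>cvn d (r n) (u k) x - u k x\<bar> \<le> h (r n) x"
      proof eventually_elim
        case (elim n)
        have "min 1 \<bar>cvn d (r n) (u k) x - u k x\<bar> \<le> h (r n) x"
          unfolding h_def by (rule member_le_sum[of k _ "\<lambda>k. min 1 \<bar>cvn d (r n) (u k) x - u k x\<bar>"]) (use k in auto)
        then show ?case using elim by auto
      qed
    qed
    then have "(\<lambda>n. cvn d (r n) (u k) x - u k x) \<longlonglongrightarrow> 0" by (simp add: tendsto_rabs_zero_iff)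
    then show "(\<lambda>n. cvn d (r n) (u k) x) \<longlonglongrightarrow> u k x" by (rule LIM_zero_cancel)
  qed
qed

subsection \<open>Exponential integrability for Sobolev fields\<close>

text \<open>Each mollified field is centred by its own mean, which adds a linear function of
  \<open>x\<close> to the divergence; in the limit this becomes the subtracted Gaussian variable.
  Fatou's lemma transfers the uniform bound 3.\<close>

lemma nn_integral_exp_sobolev:
  assumes V: "gaussian_sobolev d p V DV" and p: "1 \<le> p"
    and L: "AE x in gaussian d. HS_norm d (DV x) \<le> L" and L0: "0 < L"
  shows "(\<integral>\<^sup>+x. ennreal (exp (\<bar>divergence_fun d V DV x - (\<Sum>i<d. gaussian_mean d V i * x i)\<bar> / (5 * L))) \<partial>gaussian d) \<le> 3"
proof -
  interpret G: prob_space "gaussian d" by (rule prob_space_gaussian)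
  note int = gaussian_sobolev_integrable[OF V p]
  \<comment> \<open>All functions entering the divergence in one list: the components of V first,
    then the diagonal entries of DV, so that a single subsequence is extracted.\<close>
  define u where "u k = (if k < d then (\<lambda>x. V x k) else (\<lambda>x. DV x (k - d) (k - d)))" for k
  have ui: "integrable (gaussian d) (u k)" if "k < d + d" for k
    using int that by (auto simp: u_def)
  obtain r where r: "AE x in gaussian d. \<forall>k<d + d. (\<lambda>n. cvn d (r n) (u k) x) \<longlonglongrightarrow> u k x"
    using AE_convergent_subsequence[of "d + d" d u] ui by blast
  define W where "W n x i = cvn d (r n) (\<lambda>y. V y i) x" for n x i
  define A where "A n x i j = cvn d (r n) (\<lambda>y. DV y i j) x" for n x i j
  have conv: "AE x in gaussian d. (\<forall>i<d. (\<lambda>n. W n x i) \<longlonglongrightarrow> V x i) \<and> (\<forall>i<d. (\<lambda>n. A n x i i) \<longlonglongrightarrow> DV x i i)"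
    using r
  proof eventually_elim
    case (elim x)
    have "(\<lambda>n. W n x i) \<longlonglongrightarrow> V x i" if "i < d" for i
      using elim[rule_format, of i] that by (simp add: W_def u_def)
    moreover have "(\<lambda>n. A n x i i) \<longlonglongrightarrow> DV x i i" if "i < d" for i
      using elim[rule_format, of "d + i"] that by (simp add: A_def u_def)
    ultimately show ?case by blast
  qed
  have sf: "\<exists>H B. smooth_field d (\<lambda>x i. W n x i - a i) (A n) H L B" for n a
    using mollifiers.smooth_field_conv[OF V p L L0, of "r n" a] by (simp add: W_def A_def[abs_def])
  have Wi: "integrable (gaussian d) (\<lambda>x. W n x i)" if "i < d" for n i
    using sf[of n "\<lambda>_. 0"] smooth_field.integrable_V[OF _ that] by fastforce
  define m where "m n i = (\<integral>x. W n x i \<partial>gaussian d)" for n i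
  have m_lim: "(\<lambda>n. m n i) \<longlonglongrightarrow> gaussian_mean d V i" if i: "i < d" for i
  proof -
    \<comment> \<open>One point of convergence anchors the mollified fields. Together with the
      common Lipschitz constant \<open>L\<close> it bounds them uniformly in n by an integrable
      function, so the means converge.\<close>
    have "\<exists>x. (\<forall>i<d. (\<lambda>n. W n x i) \<longlonglongrightarrow> V x i) \<and> x \<in> space (gaussian d)"
    proof (rule eventually_happens')
      show "ae_filter (gaussian d) \<noteq> bot" 
        unfolding ae_filter_eq_bot_iff using G.emeasure_space_1 by simp
      show "AE x in gaussian d. (\<forall>i<d. (\<lambda>n. W n x i) \<longlonglongrightarrow> V x i) \<and> x \<in> space (gaussian d)"
        using conv AE_space by eventually_elim auto
    qed
    then obtain x0 where x0: "x0 \<in> Rd d" "(\<lambda>n. W n x0 i) \<longlonglongrightarrow> V x0 i" using i by auto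
    obtain C where C: "\<And>n. \<bar>W n x0 i\<bar> \<le> C"
      using Bseq_eq_bounded[of "\<lambda>n. W n x0 i"] convergent_imp_Bseq[OF convergentI[OF x0(2)]] by (auto simp: Bseq_def)
    show ?thesis unfolding m_def gaussian_mean_def
    proof (rule integral_dominated_convergence[where w="\<lambda>x. C + L * (1 + (\<Sum>j<d. (x j)\<^sup>2) + euclidean_norm d x0)"])
      show "AE x in gaussian d. (\<lambda>n. W n x i) \<longlonglongrightarrow> V x i" using conv by eventually_elim (use i in auto)
      show "AE x in gaussian d. norm (W n x i) \<le> C + L * (1 + (\<Sum>j<d. (x j)\<^sup>2) + euclidean_norm d x0)" for n
      proof (rule AE_I2)
        fix x assume "x \<in> space (gaussian d)"
        then have x: "x \<in> Rd d" by simp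
        obtain H B where "smooth_field d (\<lambda>x i. W n x i - 0) (A n) H L B" using sf[of n "\<lambda>_. 0"] by blast
        from smooth_field.V_lipschitz[OF this x x0(1)]
        have "euclidean_norm d (\<lambda>i. W n x i - W n x0 i) \<le> L * euclidean_norm d (\<lambda>i. x i - x0 i)" by simp
        then have "\<bar>W n x i - W n x0 i\<bar> \<le> L * euclidean_norm d (\<lambda>i. x i - x0 i)"
          using abs_le_euclidean_norm[OF i, of "\<lambda>i. W n x i - W n x0 i"] by linarith
        also have "\<dots> \<le> L * (euclidean_norm d x + euclidean_norm d x0)"
          using L0 euclidean_norm_triangle[of d x "\<lambda>i. - x0 i"] by (intro mult_left_mono) auto
        also have "\<dots> \<le> L * (1 + (\<Sum>j<d. (x j)\<^sup>2) + euclidean_norm d x0)"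
        proof -
          have "2 * euclidean_norm d x \<le> (euclidean_norm d x)\<^sup>2 + 1"
            using sum_squares_bound[of "euclidean_norm d x" 1] by simp
          then have "euclidean_norm d x \<le> 1 + (euclidean_norm d x)\<^sup>2"
            using euclidean_norm_nonneg[of d x] by linarith
          then show ?thesis using L0 by (intro mult_left_mono) (auto simp: euclidean_norm_sqr)
        qed
        finally show "norm (W n x i) \<le> C + L * (1 + (\<Sum>j<d. (x j)\<^sup>2) + euclidean_norm d x0)"
          using C[of n] by simp
      qed
      show "integrable (gaussian d) (\<lambda>x. C + L * (1 + (\<Sum>j<d. (x j)\<^sup>2) + euclidean_norm d x0))"
        by (intro Bochner_Integration.integrable_add integrable_mult_right Bochner_Integration.integrable_sum
            integrable_gaussian_coord_sqr G.integrable_const) simp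
    qed (use Wi int i in auto)
  qed
  define f where "f n x = (\<Sum>j<d. x j * (W n x j - m n j)) - (\<Sum>j<d. A n x j j)" for n x
  have fb: "(\<integral>\<^sup>+x. ennreal (exp (\<bar>f n x\<bar> / (5 * L))) \<partial>gaussian d) \<le> 3" for n
  proof -
    obtain H B where S: "smooth_field d (\<lambda>x i. W n x i - m n i) (A n) H L B" using sf[of n "m n"] by blast
    have "(\<integral>x. W n x i - m n i \<partial>gaussian d) = 0" if "i < d" for i
      using Wi[OF that] G.prob_space by (simp add: m_def)
    from smooth_field.nn_integral_exp_abs_divergence[OF S this] show ?thesis
      by (simp add: smooth_field.divergence_def[OF S] f_def)
  qed
  have fm: "f n \<in> borel_measurable (gaussian d)" for n
  proof -
    have "(\<lambda>x. A n x i i) \<in> borel_measurable (gaussian d)" if "i < d" for i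
      using sf[of n "\<lambda>_. 0"] smooth_field.A_meas[OF _ that that] by (auto simp: measurable_gaussian_iff)
    then show ?thesis unfolding f_def
      using Wi by (intro borel_measurable_diff borel_measurable_sum borel_measurable_times measurable_coord_gaussian
        borel_measurable_const borel_measurable_integrable[OF Wi]) auto
  qed
  have "(\<integral>\<^sup>+x. ennreal (exp (\<bar>divergence_fun d V DV x - (\<Sum>i<d. gaussian_mean d V i * x i)\<bar> / (5 * L))) \<partial>gaussian d) \<le>
      (\<integral>\<^sup>+x. liminf (\<lambda>n. ennreal (exp (\<bar>f n x\<bar> / (5 * L)))) \<partial>gaussian d)"
  proof (rule nn_integral_mono_AE, use conv in eventually_elim)
    fix x assume x: "(\<forall>i<d. (\<lambda>n. W n x i) \<longlonglongrightarrow> V x i) \<and> (\<forall>i<d. (\<lambda>n. A n x i i) \<longlonglongrightarrow> DV x i i)"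
    have "(\<lambda>n. f n x) \<longlonglongrightarrow> (\<Sum>j<d. x j * (V x j - gaussian_mean d V j)) - (\<Sum>j<d. DV x j j)"
      unfolding f_def using x by (intro tendsto_intros m_lim) auto
    also have "(\<Sum>j<d. x j * (V x j - gaussian_mean d V j)) - (\<Sum>j<d. DV x j j) =
        divergence_fun d V DV x - (\<Sum>i<d. gaussian_mean d V i * x i)"
      by (simp add: divergence_fun_def right_diff_distrib sum_subtractf mult.commute)
    finally have lim: "(\<lambda>n. ennreal (exp (\<bar>f n x\<bar> / (5 * L)))) \<longlonglongrightarrow>
        ennreal (exp (\<bar>divergence_fun d V DV x - (\<Sum>i<d. gaussian_mean d V i * x i)\<bar> / (5 * L)))"
      using L0 by (intro tendsto_ennrealI tendsto_intros) auto
    show "ennreal (exp (\<bar>divergence_fun d V DV x - (\<Sum>i<d. gaussian_mean d V i * x i)\<bar> / (5 * L))) \<le>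
        liminf (\<lambda>n. ennreal (exp (\<bar>f n x\<bar> / (5 * L))))"
      unfolding lim_imp_Liminf[OF trivial_limit_sequentially lim] by (rule order.refl)
  qed
  also have "\<dots> \<le> liminf (\<lambda>n. \<integral>\<^sup>+x. ennreal (exp (\<bar>f n x\<bar> / (5 * L))) \<partial>gaussian d)"
    by (intro nn_integral_liminf measurable_compose[OF _ measurable_ennreal] measurable_compose[OF _ borel_measurable_exp]
        borel_measurable_divide borel_measurable_abs fm borel_measurable_const)
  also have "\<dots> \<le> 3"
    using fb by (intro Liminf_le) auto
  finally show ?thesis .
qed

subsection \<open>Moments and tails\<close>

text \<open>Raise z/p <= exp(z/p) to the power p.\<close>

lemma powr_le_exp:
  assumes "0 \<le> z" "0 < p" shows "z powr p \<le> p powr p * exp (z::real)"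
proof -
  have "z / p \<le> exp (z / p)" using exp_ge_add_one_self[of "z / p"] by linarith
  then have "(z / p) powr p \<le> exp (z / p) powr p"
    using assms by (intro powr_mono2) auto
  also have "\<dots> = exp z" using assms by (simp add: powr_def)
  finally have "p powr p * (z / p) powr p \<le> p powr p * exp z" by (intro mult_left_mono) auto
  moreover have "p powr p * (z / p) powr p = z powr p" using assms by (simp add: powr_divide)
  ultimately show ?thesis by simp
qed

lemma powr_add_le:
  fixes a b p :: real assumes "0 \<le> a" "0 \<le> b" "1 \<le> p" shows "a powr p + b powr p \<le> (a + b) powr p"
proof -
  have *: "x powr p = x * x powr (p - 1)" if "0 \<le> x" for x :: real
    using that by (cases "x = 0") (auto simp: powr_diff)
  have "a * a powr (p - 1) \<le> a * (a + b) powr (p - 1)" "b * b powr (p - 1) \<le> b * (a + b) powr (p - 1)"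
    using assms by (auto intro!: mult_left_mono powr_mono2)
  then show ?thesis using assms *[of a] *[of b] *[of "a + b"] by (simp add: distrib_right)
qed

lemma powr_add_upper:
  fixes a b p :: real assumes "0 \<le> p" shows "\<bar>a + b\<bar> powr p \<le> 2 powr p * (\<bar>a\<bar> powr p + \<bar>b\<bar> powr p)"
proof -
  have "\<bar>a + b\<bar> powr p \<le> (2 * max \<bar>a\<bar> \<bar>b\<bar>) powr p" using assms by (intro powr_mono2) auto
  also have "\<dots> = 2 powr p * (max \<bar>a\<bar> \<bar>b\<bar>) powr p" by (rule powr_mult)
  also have "\<dots> \<le> 2 powr p * (\<bar>a\<bar> powr p + \<bar>b\<bar> powr p)"
    by (intro mult_left_mono) (auto simp: max_def)
  finally show ?thesis .
qed

text \<open>A bounded exponential moment at scale \<open>s\<close> gives a p-th moment of order (s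
  p)^p, that is an Lp norm growing linearly in p.\<close>

lemma nn_integral_powr_of_exp:
  assumes f: "(\<integral>\<^sup>+x. ennreal (exp (\<bar>f x\<bar> / s)) \<partial>M) \<le> ennreal K" and K: "0 \<le> K" and s: "0 < s" and p: "0 < p"
    and [measurable]: "f \<in> borel_measurable M"
  shows "(\<integral>\<^sup>+x. ennreal (\<bar>f x\<bar> powr p) \<partial>M) \<le> ennreal (K * (s * p) powr p)"
proof -
  have le: "\<bar>f x\<bar> powr p \<le> (s * p) powr p * exp (\<bar>f x\<bar> / s)" for x
  proof -
    have "(\<bar>f x\<bar> / s) powr p \<le> p powr p * exp (\<bar>f x\<bar> / s)" using s p by (intro powr_le_exp) auto
    then have "s powr p * (\<bar>f x\<bar> / s) powr p \<le> s powr p * (p powr p * exp (\<bar>f x\<bar> / s))" by (intro mult_left_mono) auto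
    then show ?thesis using s p by (simp add: powr_mult powr_divide mult.assoc)
  qed
  have "(\<integral>\<^sup>+x. ennreal (\<bar>f x\<bar> powr p) \<partial>M) \<le> (\<integral>\<^sup>+x. ennreal ((s * p) powr p) * ennreal (exp (\<bar>f x\<bar> / s)) \<partial>M)"
    using le by (intro nn_integral_mono) (simp add: ennreal_mult'[symmetric] ennreal_leI)
  also have "\<dots> = ennreal ((s * p) powr p) * (\<integral>\<^sup>+x. ennreal (exp (\<bar>f x\<bar> / s)) \<partial>M)"
    by (rule nn_integral_cmult) measurable
  also have "\<dots> \<le> ennreal ((s * p) powr p) * ennreal K" by (intro mult_left_mono f) simp
  also have "\<dots> = ennreal (K * (s * p) powr p)" using K by (simp add: ennreal_mult'[symmetric] mult.commute)
  finally show ?thesis .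
qed

lemma nn_integral_gaussian_linear_powr:
  assumes p: "0 < p"
  shows "(\<integral>\<^sup>+x. ennreal (\<bar>\<Sum>i<d. b i * x i\<bar> powr p) \<partial>gaussian d) \<le> ennreal (2 * exp (p / 2) * (sqrt p * euclidean_norm d b) powr p)"
proof (cases "euclidean_norm d b = 0")
  case True
  then have "(\<Sum>i<d. b i * x i) = 0" for x using abs_sum_mult_le[of b x d] by simp
  then show ?thesis by simp
next
  case False
  \<comment> \<open>A scale depending on p: the exponential moment is then at most 2 exp(p/2), still
    only a p-th power, while s p is sqrt p times the length of \<open>b\<close>. This improves p to
    sqrt p for the Gaussian part.\<close>
  define s where "s = euclidean_norm d b / sqrt p"
  have M: "0 < euclidean_norm d b" using False euclidean_norm_nonneg[of d b] by linarith
  then have s: "0 < s" using p by (simp add: s_def)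
  have eq: "(c * (\<Sum>i<d. b i * x i)) / s = (\<Sum>i<d. (c / s * b i) * x i)" for c x
    by (simp add: sum_distrib_left sum_divide_distrib mult_ac)
  have E: "(\<integral>\<^sup>+x. ennreal (exp ((c * (\<Sum>i<d. b i * x i)) / s)) \<partial>gaussian d) = ennreal (exp (p / 2))" if "c\<^sup>2 = 1" for c
  proof -
    have "(\<bar>c / s\<bar> * euclidean_norm d b)\<^sup>2 = c\<^sup>2 * p"
      using M p by (simp add: s_def power_mult_distrib power_divide)
    then show ?thesis unfolding eq nn_integral_gaussian_exp_linear euclidean_norm_scale using that by simp
  qed
  have [measurable]: "(\<lambda>x. \<Sum>i<d. b i * x i) \<in> borel_measurable (gaussian d)"
    by (intro borel_measurable_sum borel_measurable_times measurable_coord_gaussian) auto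
  have "(\<integral>\<^sup>+x. ennreal (exp (\<bar>\<Sum>i<d. b i * x i\<bar> / s)) \<partial>gaussian d) \<le>
      (\<integral>\<^sup>+x. ennreal (exp ((1 * (\<Sum>i<d. b i * x i)) / s)) + ennreal (exp (((-1) * (\<Sum>i<d. b i * x i)) / s)) \<partial>gaussian d)"
  proof (rule nn_integral_mono)
    fix x
    have "exp (\<bar>z\<bar> / s) \<le> exp ((1 * z) / s) + exp (((-1) * z) / s)" for z by (cases "0 \<le> z") auto
    then show "ennreal (exp (\<bar>\<Sum>i<d. b i * x i\<bar> / s)) \<le>
        ennreal (exp ((1 * (\<Sum>i<d. b i * x i)) / s)) + ennreal (exp (((-1) * (\<Sum>i<d. b i * x i)) / s))"
      by (simp only: ennreal_plus[symmetric] exp_ge_zero ennreal_leI)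
  qed
  also have "\<dots> = ennreal (exp (p / 2)) + ennreal (exp (p / 2))"
    by (subst nn_integral_add) (measurable, simp only: E power_one power2_minus)
  also have "\<dots> = ennreal (2 * exp (p / 2))" by (simp flip: ennreal_plus)
  finally have "(\<integral>\<^sup>+x. ennreal (\<bar>\<Sum>i<d. b i * x i\<bar> powr p) \<partial>gaussian d) \<le> ennreal (2 * exp (p / 2) * (s * p) powr p)"
    by (rule nn_integral_powr_of_exp) (use s p in auto)
  moreover have "s * p = sqrt p * euclidean_norm d b"
    using p by (simp add: s_def field_simps)
  ultimately show ?thesis by simp
qed

text \<open>Markov's inequality gives the constant 3 at rate 1/s. Giving up half of the rate reduces
  the constant to 2.\<close>

lemma measure_tail_le:
  assumes f: "(\<integral>\<^sup>+x. ennreal (exp (\<bar>f x\<bar> / s)) \<partial>gaussian d) \<le> 3" and s: "0 < s"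
    and fm: "f \<in> borel_measurable (gaussian d)"
  shows "measure (gaussian d) {x \<in> space (gaussian d). t \<le> \<bar>f x\<bar>} \<le> 2 * exp (- (t / (2 * s)))"
proof -
  interpret G: prob_space "gaussian d" by (rule prob_space_gaussian)
  let ?S = "{x \<in> space (gaussian d). t \<le> \<bar>f x\<bar>}"
  have S: "?S \<in> sets (gaussian d)"
    by (intro borel_measurable_le borel_measurable_const borel_measurable_abs fm)
  have em: "(\<lambda>x. ennreal (exp (\<bar>f x\<bar> / s))) \<in> borel_measurable (gaussian d)"
    by (intro measurable_compose[OF _ measurable_ennreal] measurable_compose[OF _ borel_measurable_exp]
        borel_measurable_divide borel_measurable_abs fm borel_measurable_const)
  have "ennreal (measure (gaussian d) ?S) = (\<integral>\<^sup>+x. indicator ?S x \<partial>gaussian d)"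
    using S by (simp add: G.emeasure_eq_measure)
  also have "\<dots> \<le> (\<integral>\<^sup>+x. ennreal (exp (- (t / s))) * ennreal (exp (\<bar>f x\<bar> / s)) \<partial>gaussian d)"
  proof (rule nn_integral_mono)
    fix x
    have "1 \<le> exp (- (t / s)) * exp (\<bar>f x\<bar> / s)" if "t \<le> \<bar>f x\<bar>"
      unfolding exp_add[symmetric] using that s by (simp add: divide_right_mono)
    then show "indicator ?S x \<le> ennreal (exp (- (t / s))) * ennreal (exp (\<bar>f x\<bar> / s))"
      by (auto simp: indicator_def ennreal_mult'[symmetric])
  qed
  also have "\<dots> = ennreal (exp (- (t / s))) * (\<integral>\<^sup>+x. ennreal (exp (\<bar>f x\<bar> / s)) \<partial>gaussian d)"
    by (rule nn_integral_cmult[OF em])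
  also have "\<dots> \<le> ennreal (exp (- (t / s))) * ennreal 3" using f by (intro mult_left_mono) auto
  also have "\<dots> = ennreal (3 * exp (- (t / s)))" by (simp add: ennreal_mult'' mult.commute)
  finally have 1: "measure (gaussian d) ?S \<le> 3 * exp (- (t / s))" by simp
  \<comment> \<open>Markov's bound reads 3 y^2. For y <= 2/3 this is at most 2 y; for larger y the
    claimed bound exceeds 1 and is trivial.\<close>
  define y where "y = exp (- (t / (2 * s)))"
  have y: "exp (- (t / s)) = y * y" "0 < y"
    using s by (auto simp: y_def exp_add[symmetric] field_simps)
  show ?thesis
  proof (cases "y \<le> 2 / 3")
    case True
    then have "3 * (y * y) \<le> 2 * y" using y(2) by simp
    with 1 have "measure (gaussian d) ?S \<le> 2 * y" unfolding y(1) by linarith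
    then show ?thesis by (simp add: y_def)
  next
    case False
    then have "1 \<le> 2 * y" by linarith
    then show ?thesis using G.prob_le_1[of ?S] unfolding y_def by linarith
  qed
qed

text \<open>This settles L = 0. Since |f| <= s exp(|f|/s), the integral of |f| is at most 3 s for
  every s > 0.\<close>

lemma AE_eq_0_of_exp:
  assumes f: "\<And>s. 0 < s \<Longrightarrow> (\<integral>\<^sup>+x. ennreal (exp (\<bar>f x\<bar> / s)) \<partial>M) \<le> 3" and fm: "f \<in> borel_measurable M"
  shows "AE x in M. f x = (0 :: real)"
proof -
  have em: "(\<lambda>x. ennreal \<bar>f x\<bar>) \<in> borel_measurable M"
    by (intro measurable_compose[OF _ measurable_ennreal] borel_measurable_abs fm)
  have "(\<integral>\<^sup>+x. ennreal \<bar>f x\<bar> \<partial>M) \<le> 0"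
  proof (rule ennreal_le_epsilon)
    fix e :: real assume e: "0 < e"
    have em': "(\<lambda>x. ennreal (exp (\<bar>f x\<bar> / (e / 3)))) \<in> borel_measurable M"
      by (intro measurable_compose[OF _ measurable_ennreal] measurable_compose[OF _ borel_measurable_exp]
          borel_measurable_divide borel_measurable_abs fm borel_measurable_const)
    have "(\<integral>\<^sup>+x. ennreal \<bar>f x\<bar> \<partial>M) \<le> (\<integral>\<^sup>+x. ennreal (e / 3) * ennreal (exp (\<bar>f x\<bar> / (e / 3))) \<partial>M)"
    proof (rule nn_integral_mono)
      fix x
      have "\<bar>f x\<bar> / (e / 3) \<le> exp (\<bar>f x\<bar> / (e / 3))" using exp_ge_add_one_self[of "\<bar>f x\<bar> / (e / 3)"] by linarith
      then have "\<bar>f x\<bar> \<le> e / 3 * exp (\<bar>f x\<bar> / (e / 3))" using e by (simp add: field_simps)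
      then show "ennreal \<bar>f x\<bar> \<le> ennreal (e / 3) * ennreal (exp (\<bar>f x\<bar> / (e / 3)))"
        using e by (subst ennreal_mult'[symmetric]) (auto intro: ennreal_leI)
    qed
    also have "\<dots> = ennreal (e / 3) * (\<integral>\<^sup>+x. ennreal (exp (\<bar>f x\<bar> / (e / 3))) \<partial>M)" by (rule nn_integral_cmult[OF em'])
    also have "\<dots> \<le> ennreal (e / 3) * ennreal 3" using f[of "e / 3"] e by (intro mult_left_mono) auto
    also have "\<dots> = ennreal e" using e by (subst ennreal_mult''[symmetric]) auto
    finally show "(\<integral>\<^sup>+x. ennreal \<bar>f x\<bar> \<partial>M) \<le> 0 + ennreal e" by simp
  qed
  then have "AE x in M. ennreal \<bar>f x\<bar> = 0" using nn_integral_0_iff_AE[OF em] by simp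
  then show ?thesis by eventually_elim simp
qed

section \<open>Assembly of the final estimates\<close>

lemma Linfinity_norm_eq_ereal:
  assumes "Linfinity_norm (gaussian d) f = ereal L"
  shows "AE x in gaussian d. \<bar>f x\<bar> \<le> L" "0 \<le> L"
proof -
  interpret G: prob_space "gaussian d" by (rule prob_space_gaussian)
  have "AE x in gaussian d. ereal \<bar>f x\<bar> \<le> ereal L"
    using esssup_AE[of "\<lambda>x. ereal \<bar>f x\<bar>" "gaussian d"] assms by (simp add: Linfinity_norm_def)
  then show ae: "AE x in gaussian d. \<bar>f x\<bar> \<le> L" by simp
  show "0 \<le> L"
  proof (rule ccontr)
    assume "\<not> 0 \<le> L"
    have "AE x in gaussian d. False"
      using ae
    proof eventually_elim
      case (elim x)
      then show False using \<open>\<not> 0 \<le> L\<close> abs_ge_zero[of "f x"] by linarith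
    qed
    then show False
      unfolding eventually_False ae_filter_eq_bot_iff using G.emeasure_space_1 by simp
  qed
qed

lemma divergence_fun_measurable:
  assumes "gaussian_sobolev d p V DV" shows "divergence_fun d V DV \<in> borel_measurable (gaussian d)"
  unfolding divergence_fun_def[abs_def] using assms
  by (intro borel_measurable_diff borel_measurable_sum borel_measurable_times measurable_coord_gaussian)
    (auto simp: gaussian_sobolev_def)

text \<open>Split the divergence into the Gaussian variable \<open>Y\<close>, of order sqrt q times
  the length of the mean, and the centred part \<open>W\<close>, of order q L. Numerical prefactors
  of q-th powers are absorbed into the base, and superadditivity of the power recombines the two
  parts.\<close>

lemma divergence_Lp:
  fixes p q :: real
  assumes V: "gaussian_sobolev d p V DV" and p: "1 \<le> p"
    and L: "AE x in gaussian d. HS_norm d (DV x) \<le> L" and L0: "0 \<le> L" and q: "2 \<le> q"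
  shows "in_Lp (gaussian d) q (divergence_fun d V DV)"
    and "Lp_norm (gaussian d) q (divergence_fun d V DV)
       \<le> 30 * sqrt q * euclidean_norm d (gaussian_mean d V) + 30 * q * L"
proof -
  interpret G: prob_space "gaussian d" by (rule prob_space_gaussian)
  define f where "f = divergence_fun d V DV"
  define Y where "Y x = (\<Sum>i<d. gaussian_mean d V i * x i)" for x
  define W where "W x = f x - Y x" for x
  define M where "M = euclidean_norm d (gaussian_mean d V)"
  have fm: "f \<in> borel_measurable (gaussian d)" unfolding f_def by (rule divergence_fun_measurable[OF V])
  have Ym: "Y \<in> borel_measurable (gaussian d)"
    unfolding Y_def[abs_def] by (intro borel_measurable_sum borel_measurable_times measurable_coord_gaussian) auto
  have Wm: "W \<in> borel_measurable (gaussian d)" unfolding W_def[abs_def] by (intro borel_measurable_diff fm Ym)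
  have E: "(\<integral>\<^sup>+x. ennreal (exp (\<bar>W x\<bar> / (5 * l))) \<partial>gaussian d) \<le> 3" if "L \<le> l" "0 < l" for l
  proof -
    have "AE x in gaussian d. HS_norm d (DV x) \<le> l" using L by eventually_elim (use that in simp)
    from nn_integral_exp_sobolev[OF V p this that(2)] show ?thesis by (simp add: W_def f_def Y_def)
  qed
  have pw: "(\<lambda>x. ennreal (\<bar>h x\<bar> powr q)) \<in> borel_measurable (gaussian d)" if "h \<in> borel_measurable (gaussian d)" for h :: "_ \<Rightarrow> real"
    by (intro measurable_compose[OF _ measurable_ennreal] powr_real_measurable borel_measurable_abs that borel_measurable_const)
  have WI: "(\<integral>\<^sup>+x. ennreal (\<bar>W x\<bar> powr q) \<partial>gaussian d) \<le> ennreal (3 * (5 * L * q) powr q)"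
  proof (cases "L = 0")
    case True
    have "AE x in gaussian d. W x = 0"
    proof (rule AE_eq_0_of_exp[OF _ Wm])
      fix s :: real assume "0 < s"
      then show "(\<integral>\<^sup>+x. ennreal (exp (\<bar>W x\<bar> / s)) \<partial>gaussian d) \<le> 3" using E[of "s / 5"] True by simp
    qed
    then have "AE x in gaussian d. ennreal (\<bar>W x\<bar> powr q) = 0" by eventually_elim simp
    then have "(\<integral>\<^sup>+x. ennreal (\<bar>W x\<bar> powr q) \<partial>gaussian d) = 0"
      using nn_integral_0_iff_AE[OF pw[OF Wm]] by simp
    then show ?thesis by simp
  next
    case False
    then have "(\<integral>\<^sup>+x. ennreal (exp (\<bar>W x\<bar> / (5 * L))) \<partial>gaussian d) \<le> ennreal 3" using E[of L] L0 by simp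
    then show ?thesis by (rule nn_integral_powr_of_exp) (use False L0 q Wm in auto)
  qed
  have YI: "(\<integral>\<^sup>+x. ennreal (\<bar>Y x\<bar> powr q) \<partial>gaussian d) \<le> ennreal (2 * exp (q / 2) * (sqrt q * M) powr q)"
    unfolding Y_def M_def by (rule nn_integral_gaussian_linear_powr) (use q in simp)
  have "(\<integral>\<^sup>+x. ennreal (\<bar>f x\<bar> powr q) \<partial>gaussian d) \<le>
      (\<integral>\<^sup>+x. ennreal (2 powr q) * (ennreal (\<bar>Y x\<bar> powr q) + ennreal (\<bar>W x\<bar> powr q)) \<partial>gaussian d)"
  proof (rule nn_integral_mono)
    fix x
    have "\<bar>f x\<bar> powr q \<le> 2 powr q * (\<bar>Y x\<bar> powr q + \<bar>W x\<bar> powr q)"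
      using powr_add_upper[of q "Y x" "W x"] q by (simp add: W_def)
    then have "ennreal (\<bar>f x\<bar> powr q) \<le> ennreal (2 powr q * (\<bar>Y x\<bar> powr q + \<bar>W x\<bar> powr q))" by (rule ennreal_leI)
    also have "\<dots> = ennreal (2 powr q) * (ennreal (\<bar>Y x\<bar> powr q) + ennreal (\<bar>W x\<bar> powr q))"
      by (subst ennreal_mult') auto
    finally show "ennreal (\<bar>f x\<bar> powr q) \<le> ennreal (2 powr q) * (ennreal (\<bar>Y x\<bar> powr q) + ennreal (\<bar>W x\<bar> powr q))" .
  qed
  also have "\<dots> = ennreal (2 powr q) * ((\<integral>\<^sup>+x. ennreal (\<bar>Y x\<bar> powr q) \<partial>gaussian d) + (\<integral>\<^sup>+x. ennreal (\<bar>W x\<bar> powr q) \<partial>gaussian d))"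
    by (subst nn_integral_cmult[OF borel_measurable_add[OF pw[OF Ym] pw[OF Wm]]], subst nn_integral_add[OF pw[OF Ym] pw[OF Wm]]) simp
  also have "\<dots> \<le> ennreal (2 powr q) * (ennreal (2 * exp (q / 2) * (sqrt q * M) powr q) + ennreal (3 * (5 * L * q) powr q))"
    by (intro mult_left_mono add_mono YI WI) simp
  also have "\<dots> = ennreal (2 powr q * (2 * exp (q / 2) * (sqrt q * M) powr q + 3 * (5 * L * q) powr q))"
    by (subst ennreal_mult') auto
  also have "\<dots> \<le> ennreal ((30 * sqrt q * M + 30 * q * L) powr q)"
  proof (rule ennreal_leI)
    have M0: "0 \<le> M" by (simp add: M_def)
    have c: "c \<le> c powr q" if "1 \<le> c" for c :: real
      using powr_mono[of 1 q c] that q by simp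
    have "exp (q / 2) \<le> 2 powr q"
    proof -
      have "exp (1 / 2 :: real) \<le> 2" using exp_bound[of "1 / 2"] by (simp add: power2_eq_square)
      then have "exp (1 / 2) powr q \<le> 2 powr q" using q by (intro powr_mono2) auto
      then show ?thesis by (simp add: powr_def mult.commute)
    qed
    \<comment> \<open>With the 2^q from splitting the sum, the Gaussian part has total prefactor at
      most 8^q.\<close>
    then have "2 * exp (q / 2) \<le> 2 powr q * 2 powr q" using c[of 2] by (intro mult_mono) auto
    then have "2 powr q * (2 * exp (q / 2) * (sqrt q * M) powr q) \<le> 2 powr q * (2 powr q * 2 powr q * (sqrt q * M) powr q)"
      by (intro mult_left_mono mult_right_mono) auto
    also have "\<dots> = (8 * (sqrt q * M)) powr q" by (simp add: powr_mult[symmetric])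
    also have "\<dots> \<le> (30 * sqrt q * M) powr q" using M0 q by (intro powr_mono2) (auto simp: mult.assoc intro!: mult_right_mono)
    finally have 1: "2 powr q * (2 * exp (q / 2) * (sqrt q * M) powr q) \<le> (30 * sqrt q * M) powr q" .
    \<comment> \<open>Here 30 = 2 * 3 * 5: the splitting factor, the bound on the exponential
      moment, and the scale 5 L.\<close>
    have "2 powr q * (3 * (5 * L * q) powr q) \<le> 2 powr q * (3 powr q * (5 * L * q) powr q)"
      using c[of 3] by (intro mult_left_mono mult_right_mono) auto
    also have "\<dots> = (30 * q * L) powr q" by (simp add: powr_mult[symmetric] mult_ac)
    finally have 2: "2 powr q * (3 * (5 * L * q) powr q) \<le> (30 * q * L) powr q" .
    have "(30 * sqrt q * M) powr q + (30 * q * L) powr q \<le> (30 * sqrt q * M + 30 * q * L) powr q"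
      using M0 L0 q by (intro powr_add_le) auto
    then show "2 powr q * (2 * exp (q / 2) * (sqrt q * M) powr q + 3 * (5 * L * q) powr q) \<le> (30 * sqrt q * M + 30 * q * L) powr q"
      using 1 2 by (simp only: distrib_left)
  qed
  finally have le: "(\<integral>\<^sup>+x. ennreal (\<bar>f x\<bar> powr q) \<partial>gaussian d) \<le> ennreal ((30 * sqrt q * M + 30 * q * L) powr q)" .
  have fq: "(\<lambda>x. \<bar>f x\<bar> powr q) \<in> borel_measurable (gaussian d)"
    by (intro powr_real_measurable borel_measurable_abs fm borel_measurable_const)
  have int: "integrable (gaussian d) (\<lambda>x. \<bar>f x\<bar> powr q)"
    by (rule integrableI_nonneg[OF fq]) (use le in \<open>auto intro: le_less_trans\<close>)
  then show "in_Lp (gaussian d) q (divergence_fun d V DV)" using fm by (simp add: in_Lp_def f_def)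
  have "ennreal (\<integral>x. \<bar>f x\<bar> powr q \<partial>gaussian d) \<le> ennreal ((30 * sqrt q * M + 30 * q * L) powr q)"
    using le nn_integral_eq_integral[OF int] by simp
  then have le': "(\<integral>x. \<bar>f x\<bar> powr q \<partial>gaussian d) \<le> (30 * sqrt q * M + 30 * q * L) powr q"
    by (subst (asm) ennreal_le_iff) auto
  have "0 \<le> 30 * sqrt q * M + 30 * q * L" using L0 q by (auto simp: M_def intro!: add_nonneg_nonneg mult_nonneg_nonneg)
  then have "((30 * sqrt q * M + 30 * q * L) powr q) powr (1 / q) = 30 * sqrt q * M + 30 * q * L"
    using q by (simp add: powr_powr)
  moreover have "(\<integral>x. \<bar>f x\<bar> powr q \<partial>gaussian d) powr (1 / q) \<le> ((30 * sqrt q * M + 30 * q * L) powr q) powr (1 / q)"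
    using le' q by (intro powr_mono2) (auto intro!: integral_nonneg_AE)
  ultimately show "Lp_norm (gaussian d) q (divergence_fun d V DV)
       \<le> 30 * sqrt q * euclidean_norm d (gaussian_mean d V) + 30 * q * L"
    by (simp add: Lp_norm_def f_def M_def)
qed

text \<open>Zero mean removes the linear correction, so the exponential moment at scale 5 L concerns
  the divergence itself. The rate 1/(5 L) is halved in passing to the constant 2, hence
  1/10.\<close>

lemma divergence_tail:
  assumes V: "gaussian_sobolev d p V DV" and p: "1 \<le> p"
    and L: "AE x in gaussian d. HS_norm d (DV x) \<le> L" and L0: "0 \<le> L"
    and mean: "\<And>i. i < d \<Longrightarrow> gaussian_mean d V i = 0"
  shows "if L = 0 then AE x in gaussian d. divergence_fun d V DV x = 0
    else \<forall>t\<ge>0. measure (gaussian d) {x \<in> space (gaussian d). \<bar>divergence_fun d V DV x\<bar> \<ge> t}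
      \<le> 2 * exp (- (1 / 10 * t / L))"
proof -
  have E: "(\<integral>\<^sup>+x. ennreal (exp (\<bar>divergence_fun d V DV x\<bar> / (5 * l))) \<partial>gaussian d) \<le> 3" if "L \<le> l" "0 < l" for l
  proof -
    have "AE x in gaussian d. HS_norm d (DV x) \<le> l" using L by eventually_elim (use that in simp)
    from nn_integral_exp_sobolev[OF V p this that(2)] show ?thesis by (simp add: mean)
  qed
  note fm = divergence_fun_measurable[OF V]
  show ?thesis
  proof (cases "L = 0")
    case True
    have "AE x in gaussian d. divergence_fun d V DV x = 0"
    proof (rule AE_eq_0_of_exp[OF _ fm])
      fix s :: real assume "0 < s"
      then show "(\<integral>\<^sup>+x. ennreal (exp (\<bar>divergence_fun d V DV x\<bar> / s)) \<partial>gaussian d) \<le> 3"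
        using E[of "s / 5"] True by simp
    qed
    then show ?thesis using True by simp
  next
    case False
    then show ?thesis using measure_tail_le[OF E[of L] _ fm] L0 by simp
  qed
qed

theorem corollaryB1:
  shows "\<exists>C c :: real. c > 0 \<and>
    (\<forall>d\<ge>1. \<forall>p\<^sub>0\<ge>2. \<forall>V DV. \<forall>L :: real.
       gaussian_sobolev d p\<^sub>0 V DV \<longrightarrow>
       Linfinity_norm (gaussian d) (\<lambda>x. HS_norm d (DV x)) = ereal L \<longrightarrow>
       gaussian_divergence d V (divergence_fun d V DV) \<and>
       (\<forall>p\<ge>2. in_Lp (gaussian d) p (divergence_fun d V DV) \<and>
          Lp_norm (gaussian d) p (divergence_fun d V DV)
            \<le> C * sqrt p * euclidean_norm d (gaussian_mean d V) + C * p * L) \<and>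
       ((\<forall>i<d. gaussian_mean d V i = 0) \<longrightarrow>
          (if L = 0 then AE x in gaussian d. divergence_fun d V DV x = 0
           else \<forall>t\<ge>0. measure (gaussian d) {x \<in> space (gaussian d). \<bar>divergence_fun d V DV x\<bar> \<ge> t}
                  \<le> 2 * exp (- (c * t / L)))))"
proof (rule exI[of _ 30], rule exI[of _ "1 / 10"], intro conjI allI impI)
  fix d :: nat and p\<^sub>0 :: real and V DV and L :: real
  assume p: "2 \<le> p\<^sub>0" and V: "gaussian_sobolev d p\<^sub>0 V DV"
    and L: "Linfinity_norm (gaussian d) (\<lambda>x. HS_norm d (DV x)) = ereal L"
  have p1: "1 \<le> p\<^sub>0" using p by simp
  have ae: "AE x in gaussian d. HS_norm d (DV x) \<le> L" and L0: "0 \<le> L"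
    using Linfinity_norm_eq_ereal[OF L] by simp_all
  show "gaussian_divergence d V (divergence_fun d V DV)"
    by (rule gaussian_divergence_divergence_fun[OF V p1])
  show "in_Lp (gaussian d) q (divergence_fun d V DV)"
    "Lp_norm (gaussian d) q (divergence_fun d V DV)
       \<le> 30 * sqrt q * euclidean_norm d (gaussian_mean d V) + 30 * q * L" if "2 \<le> q" for q
    using divergence_Lp[OF V p1 ae L0 that] by blast+
  show "if L = 0 then AE x in gaussian d. divergence_fun d V DV x = 0
    else \<forall>t\<ge>0. measure (gaussian d) {x \<in> space (gaussian d). \<bar>divergence_fun d V DV x\<bar> \<ge> t}
      \<le> 2 * exp (- (1 / 10 * t / L))" if "\<forall>i<d. gaussian_mean d V i = 0"
    using divergence_tail[OF V p1 ae L0] that by blast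
qed simp

end
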